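(* Let $d\in\mathbb{N}$, $\mu>0$, $(v_0,v_1)\in H^1(\mathbb{R}^d)\times L^2(\mathbb{R}^d)$, and let $v$ be the solution of $$\partial_t^2 v-\Delta v+\frac{\mu}{(1+t)^2}v=0\ \text{ in }(0,\infty)\times\mathbb{R}^d,\qquad (v(0),\partial_t v(0))=(v_0,v_1).$$ Then there exists $\overrightarrow{v_+}\in\dot H^1(\mathbb{R}^d)\times L^2(\mathbb{R}^d)$ such that $$\lim_{t\to\infty}(1+t)^{\frac12-\operatorname{Re}\nu}\|\overrightarrow v(t)-\mathcal{W}(t)\overrightarrow{v_+}\|_{\dot H^1\times L^2}=0\quad\text{if }\mu\ne1/4,$$ $$\lim_{t\to\infty}(1+t)^{\frac12}\{1+\log(1+t)\}^{-1}\|\overrightarrow v(t)-\mathcal{W}(t)\overrightarrow{v_+}\|_{\dot H^1\times L^2}=0\quad\text{if }\mu=1/4.$$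
   Context: Notation. For $\mu\in\mathbb{R}$ set $\nu:=\frac12\sqrt{1-4\mu}$ if $\mu\le 1/4$ and $\nu:=\frac{i}{2}\sqrt{4\mu-1}$ if $\mu>1/4$ (so $\operatorname{Re}\nu=0$ for $\mu\geq 1/4$). $\overrightarrow v(t):=(v(t),\partial_tv(t))$. $\dot H^1(\mathbb{R}^d)$ is the (complete) homogeneous Sobolev space with norm $\|f\|_{\dot H^1}=\||\xi|\widehat f\,\|_{L^2}$, and $\dot H^1\times L^2$ carries the product norm. $\mathcal{W}(t)$ is the solution map of the free wave equation: $\mathcal{W}(t)(f,g)=\big(\cos(t|\nabla|)f+|\nabla|^{-1}\sin(t|\nabla|)g,\ -|\nabla|\sin(t|\nabla|)f+\cos(t|\nabla|)g\big)$, where functions of $|\nabla|$ are Fourier multipliers in $|\xi|$. "The solution" is the unique solution in $C([0,\infty);H^1)\cap C^1([0,\infty);L^2)$; equivalently, for a.e. $\xi$, $\widehat v(t,\xi)$ solves $\partial_t^2\widehat v+|\xi|^2\widehat v+\mu(1+t)^{-2}\widehat v=0$ with data $(\widehat v_0(\xi),\widehat v_1(\xi))$. *)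

theory Defs
  imports "HOL-Analysis.Analysis"
begin

text \<open>
  Elements of \<open>L\<^sup>2(\<real>\<^sup>d)\<close> are represented by complex-valued Borel functions on
  \<open>real ^ 'd\<close>, with \<open>d = CARD('d)\<close>; two functions that agree almost everywhere represent the
  same element.
\<close>

definition L2 :: "(real ^ 'd \<Rightarrow> complex) set" where
  "L2 = {f \<in> borel_measurable lborel. integrable lborel (\<lambda>x. (norm (f x))\<^sup>2)}"

definition L2_norm :: "(real ^ 'd \<Rightarrow> complex) \<Rightarrow> real" where
  "L2_norm f = sqrt (LINT x|lborel. (norm (f x))\<^sup>2)"

text \<open>
  The unitary Fourier transform on \<open>L\<^sup>2\<close>: the \<open>L\<^sup>2\<close>-limit, as \<open>R\<close> tends to infinity, of the
  Fourier integrals over the balls of radius \<open>R\<close>.  The limit is determined only almost everywhere,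
  hence the relation and the choice of a representative.
\<close>

definition fourier_integral :: "real \<Rightarrow> (real ^ 'd \<Rightarrow> complex) \<Rightarrow> real ^ 'd \<Rightarrow> complex" where
  "fourier_integral R f \<xi> =
     of_real ((2 * pi) powr (- real CARD('d) / 2)) *
     (LINT x:cball 0 R|lborel. cis (- (x \<bullet> \<xi>)) * f x)"

definition is_fourier :: "(real ^ 'd \<Rightarrow> complex) \<Rightarrow> (real ^ 'd \<Rightarrow> complex) \<Rightarrow> bool" where
  "is_fourier f g \<longleftrightarrow> f \<in> L2 \<and> g \<in> L2 \<and>
     ((\<lambda>R. L2_norm (fourier_integral R f - g)) \<longlongrightarrow> 0) at_top"

definition FT :: "(real ^ 'd \<Rightarrow> complex) \<Rightarrow> real ^ 'd \<Rightarrow> complex" where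
  "FT f = (SOME g. is_fourier f g)"

definition FT_inv :: "(real ^ 'd \<Rightarrow> complex) \<Rightarrow> real ^ 'd \<Rightarrow> complex" where
  "FT_inv g = (SOME f. is_fourier f g)"

definition H1 :: "(real ^ 'd \<Rightarrow> complex) set" where
  "H1 = {f \<in> L2. (\<lambda>\<xi>. of_real (sqrt (1 + (norm \<xi>)\<^sup>2)) * FT f \<xi>) \<in> L2}"

definition H1_norm :: "(real ^ 'd \<Rightarrow> complex) \<Rightarrow> real" where
  "H1_norm f = L2_norm (\<lambda>\<xi>. of_real (sqrt (1 + (norm \<xi>)\<^sup>2)) * FT f \<xi>)"

text \<open>
  The complete homogeneous Sobolev space is not a space of functions of \<open>x\<close> when \<open>d \<le> 2\<close>.
  In every dimension an element is therefore represented by its Fourier transform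
  \<open>\<phi>\<close>, that is, the space is realised as \<open>L\<^sup>2(\<bar>\<xi>\<bar>\<^sup>2 d\<xi>)\<close>; a function \<open>f\<close> in
  \<open>H\<^sup>1\<close> is identified with \<open>FT f\<close>.  Likewise \<open>Hm1_norm\<close>, the norm of \<open>H\<^sup>-\<^sup>1\<close>, is
  applied to Fourier transforms.
\<close>

definition Hdot1 :: "(real ^ 'd \<Rightarrow> complex) set" where
  "Hdot1 = {\<phi> \<in> borel_measurable lborel. (\<lambda>\<xi>. of_real (norm \<xi>) * \<phi> \<xi>) \<in> L2}"

definition Hdot1_norm :: "(real ^ 'd \<Rightarrow> complex) \<Rightarrow> real" where
  "Hdot1_norm \<phi> = L2_norm (\<lambda>\<xi>. of_real (norm \<xi>) * \<phi> \<xi>)"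

definition Hm1_norm :: "(real ^ 'd \<Rightarrow> complex) \<Rightarrow> real" where
  "Hm1_norm \<phi> = L2_norm (\<lambda>\<xi>. \<phi> \<xi> / of_real (sqrt (1 + (norm \<xi>)\<^sup>2)))"

text \<open>
  In a pair \<open>(\<phi>, g)\<close> of \<open>Hdot1 \<times> L2\<close> the first component is a Fourier transform, the second one
  a function of \<open>x\<close>.
\<close>

definition energy_norm ::
  "(real ^ 'd \<Rightarrow> complex) \<times> (real ^ 'd \<Rightarrow> complex) \<Rightarrow> real" where
  "energy_norm p = sqrt ((Hdot1_norm (fst p))\<^sup>2 + (L2_norm (snd p))\<^sup>2)"

definition free_wave ::
  "real \<Rightarrow> (real ^ 'd \<Rightarrow> complex) \<times> (real ^ 'd \<Rightarrow> complex) \<Rightarrow>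
    (real ^ 'd \<Rightarrow> complex) \<times> (real ^ 'd \<Rightarrow> complex)" where
  "free_wave t = (\<lambda>(\<phi>, g).
     (\<lambda>\<xi>. of_real (cos (t * norm \<xi>)) * \<phi> \<xi> + of_real (sin (t * norm \<xi>) / norm \<xi>) * FT g \<xi>,
      FT_inv (\<lambda>\<xi>. - of_real (norm \<xi> * sin (t * norm \<xi>)) * \<phi> \<xi>
                  + of_real (cos (t * norm \<xi>)) * FT g \<xi>)))"

text \<open>
  \<open>v\<close> is a solution in \<open>C([0,\<infinity>); H\<^sup>1) \<inter> C\<^sup>1([0,\<infinity>); L\<^sup>2)\<close> with time derivative \<open>vt\<close>.
  The equation itself holds in \<open>H\<^sup>-\<^sup>1\<close>: at every \<open>t > 0\<close> the \<open>H\<^sup>-\<^sup>1\<close>-derivative of \<open>vt\<close> is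
  \<open>\<Delta>v - \<mu>(1+t)\<^sup>-\<^sup>2 v\<close>, with Fourier transform \<open>- \<bar>\<xi>\<bar>\<^sup>2 FT v - \<mu>(1+t)\<^sup>-\<^sup>2 FT v\<close>.
  Only the values of \<open>v\<close> and \<open>vt\<close> at times \<open>t \<ge> 0\<close> matter.
\<close>

definition wave_solution ::
  "real \<Rightarrow> (real ^ 'd \<Rightarrow> complex) \<Rightarrow> (real ^ 'd \<Rightarrow> complex) \<Rightarrow>
    (real \<Rightarrow> real ^ 'd \<Rightarrow> complex) \<Rightarrow> (real \<Rightarrow> real ^ 'd \<Rightarrow> complex) \<Rightarrow> bool" where
  "wave_solution \<mu> v0 v1 v vt \<longleftrightarrow>
     (\<forall>t\<ge>0. v t \<in> H1 \<and> ((\<lambda>s. H1_norm (v s - v t)) \<longlongrightarrow> 0) (at t within {0..})) \<and>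
     (\<forall>t\<ge>0. vt t \<in> L2 \<and> ((\<lambda>s. L2_norm (vt s - vt t)) \<longlongrightarrow> 0) (at t within {0..})) \<and>
     (\<forall>t\<ge>0. ((\<lambda>s. L2_norm (\<lambda>x. (v s x - v t x) / of_real (s - t) - vt t x)) \<longlongrightarrow> 0)
               (at t within {0..})) \<and>
     (\<forall>t>0. ((\<lambda>s. Hm1_norm (\<lambda>\<xi>. (FT (vt s) \<xi> - FT (vt t) \<xi>) / of_real (s - t)
                 + of_real ((norm \<xi>)\<^sup>2) * FT (v t) \<xi>
                 + of_real (\<mu> / (1 + t)\<^sup>2) * FT (v t) \<xi>)) \<longlongrightarrow> 0)
               (at t within {0..})) \<and>
     (AE x in lborel. v 0 x = v0 x) \<and> (AE x in lborel. vt 0 x = v1 x)"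

definition nu :: "real \<Rightarrow> complex" where
  "nu \<mu> = (if \<mu> \<le> 1/4 then of_real (sqrt (1 - 4 * \<mu>) / 2)
          else \<i> / 2 * of_real (sqrt (4 * \<mu> - 1)))"

end

theory Submission
  imports Defs "HOL-Probability.Characteristic_Functions" "HOL-Real_Asymp.Real_Asymp"
begin

text \<open>
  By Plancherel's theorem the solution splits into modes
  \<open>w'' + (\<rho>\<^sup>2 + \<mu> (1 + t)\<^sup>-\<^sup>2) w = 0\<close> with \<open>\<rho> = \<bar>\<xi>\<bar>\<close>.  As long as \<open>\<rho> (1 + t) \<le> 1\<close>, a mode grows
  at most like the solutions for \<open>\<rho> = 0\<close>, that is like \<open>(1 + t)\<close> to the power \<open>1/2 + Re \<nu>\<close>
  (with a logarithm if \<open>\<mu> = 1/4\<close>).  Afterwards the energy including the potential decreases, so that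
  \<open>cis (\<mp> \<rho> t) (w' \<plusminus> \<i> \<rho> w)\<close> converges with an error of order \<open>1 / (\<rho> (1 + t))\<close> relative to the
  energy at time \<open>1 / \<rho>\<close>.  Multiplied by the weight of the theorem, the error is bounded in
  all frequencies by the initial data and tends to \<open>0\<close> for each \<open>\<xi> \<noteq> 0\<close>; dominated convergence
  concludes.
\<close>

subsection \<open>The space \<open>L2\<close>\<close>

text \<open>Two obstacles shape the proof. The derivative of \<open>vt\<close> exists only in H^-1,
  and limits in L2 say nothing about a single \<xi>, so the mode equation cannot be read off the
  solution pointwise. Instead two real modes are built for every frequency, measurably in \<rho>;
  the Wronskian of each with the solution is constant for almost every \<xi>, and Cramer's rule
  recovers the solution.

  The other obstacle is uniformity near \<xi> = 0. For \<rho> = 0 the growth rate bounds w' and w /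
  \<tau>, with \<tau> = 1 + t, by a multiple of \<open>decay \<mu> \<tau>\<close>, the reciprocal of
  the weight. A mode handed over at \<tau> = 1 / \<rho> later has an error of order
  \<open>decay \<mu> (1 / \<rho>) / (\<rho> * \<tau>)\<close>; this is at most of order
  \<open>decay \<mu> \<tau>\<close>, because \<open>\<tau> * decay \<mu> \<tau>\<close> increases.
  The low-frequency bound contains |w 0| without a factor \<rho>, so the L2 part of the H^1 norm is
  used although the conclusion lives in the homogeneous space.\<close>

lemma L2I:
  assumes "f \<in> borel_measurable lborel" "integrable lborel (\<lambda>x. (norm (f x))\<^sup>2)"
  shows "f \<in> L2"
  using assms by (simp add: L2_def)

lemma L2_measurable: "f \<in> L2 \<Longrightarrow> f \<in> borel_measurable lborel"
  by (simp add: L2_def)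

lemma L2_integrable: "f \<in> L2 \<Longrightarrow> integrable lborel (\<lambda>x. (norm (f x))\<^sup>2)"
  by (simp add: L2_def)

lemma L2_norm_nonneg [simp]: "0 \<le> L2_norm f"
  by (simp add: L2_norm_def)

lemma L2_norm_power2: "(L2_norm f)\<^sup>2 = (LINT x|lborel. (norm (f x))\<^sup>2)"
  by (simp add: L2_norm_def)

lemma L2_dominated:
  assumes "f \<in> L2" "g \<in> borel_measurable lborel" "AE x in lborel. norm (g x) \<le> C * norm (f x)"
  shows "g \<in> L2"
proof (rule L2I)
  show "integrable lborel (\<lambda>x. (norm (g x))\<^sup>2)"
  proof (rule Bochner_Integration.integrable_bound)
    show "integrable lborel (\<lambda>x. C\<^sup>2 * (norm (f x))\<^sup>2)"
      using L2_integrable[OF assms(1)] by simp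
    show "(\<lambda>x. (norm (g x))\<^sup>2) \<in> borel_measurable lborel"
      using assms(2) by measurable
    show "AE x in lborel. norm ((norm (g x))\<^sup>2) \<le> norm (C\<^sup>2 * (norm (f x))\<^sup>2)"
      using assms(3)
    proof eventually_elim
      case (elim x)
      then have "(norm (g x))\<^sup>2 \<le> (C * norm (f x))\<^sup>2"
        by (intro power_mono) auto
      then show ?case by (simp add: power_mult_distrib abs_mult)
    qed
  qed
qed (fact assms(2))

lemma L2_norm_mono:
  assumes "f \<in> L2" "g \<in> borel_measurable lborel" "AE x in lborel. norm (g x) \<le> norm (f x)"
  shows "L2_norm g \<le> L2_norm f"
proof -
  have "g \<in> L2" using L2_dominated[of f g 1] assms by simp
  have "(LINT x|lborel. (norm (g x))\<^sup>2) \<le> (LINT x|lborel. (norm (f x))\<^sup>2)"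
    using assms(3) by (intro integral_mono_AE L2_integrable assms \<open>g \<in> L2\<close>)
      (auto elim!: eventually_mono intro: power_mono)
  then show ?thesis by (simp add: L2_norm_def)
qed

lemma L2_norm_cong_AE:
  fixes f g :: "real ^ 'd \<Rightarrow> complex"
  assumes "f \<in> borel_measurable lborel" "g \<in> borel_measurable lborel"
    and "AE x in lborel. norm (f x) = norm (g x)"
  shows "L2_norm f = L2_norm g"
proof -
  have "(LINT x|lborel. (norm (f x))\<^sup>2) = (LINT x|lborel. (norm (g x))\<^sup>2)"
  proof (rule integral_cong_AE)
    show "(\<lambda>x. (norm (f x))\<^sup>2) \<in> borel_measurable lborel"
      using assms(1) by measurable
    show "(\<lambda>x. (norm (g x))\<^sup>2) \<in> borel_measurable lborel"
      using assms(2) by measurable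
    show "AE x in lborel. (norm (f x))\<^sup>2 = (norm (g x))\<^sup>2"
      using assms(3) by eventually_elim simp
  qed
  then show ?thesis by (simp add: L2_norm_def)
qed

lemma L2_norm_eq_0_AE:
  assumes "f \<in> L2" "L2_norm f = 0"
  shows "AE x in lborel. f x = 0"
proof -
  have "(LINT x|lborel. (norm (f x))\<^sup>2) = 0"
    using assms(2) by (simp add: L2_norm_def)
  then have "AE x in lborel. (norm (f x))\<^sup>2 = 0"
    using integral_nonneg_eq_0_iff_AE[OF L2_integrable[OF assms(1)]] by simp
  then show ?thesis by simp
qed

lemma L2_zero [simp]: "(\<lambda>x. 0) \<in> L2"
  by (rule L2I) auto

lemma L2_add:
  assumes "f \<in> L2" "g \<in> L2"
  shows "(\<lambda>x. f x + g x) \<in> L2"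
proof (rule L2I)
  note [measurable] = L2_measurable[OF assms(1)] L2_measurable[OF assms(2)]
  show "(\<lambda>x. f x + g x) \<in> borel_measurable lborel" by measurable
  show "integrable lborel (\<lambda>x. (norm (f x + g x))\<^sup>2)"
  proof (rule Bochner_Integration.integrable_bound)
    show "integrable lborel (\<lambda>x. 2 * (norm (f x))\<^sup>2 + 2 * (norm (g x))\<^sup>2)"
      using assms by (auto dest!: L2_integrable)
    have "(norm (f x + g x))\<^sup>2 \<le> 2 * (norm (f x))\<^sup>2 + 2 * (norm (g x))\<^sup>2" for x
    proof -
      have "(norm (f x + g x))\<^sup>2 \<le> (norm (f x) + norm (g x))\<^sup>2"
        by (intro power_mono norm_triangle_ineq) auto
      also have "\<dots> \<le> 2 * (norm (f x))\<^sup>2 + 2 * (norm (g x))\<^sup>2"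
        using sum_squares_bound[of "norm (f x)" "norm (g x)"] by (simp add: power2_sum)
      finally show ?thesis .
    qed
    then show "AE x in lborel. norm ((norm (f x + g x))\<^sup>2)
        \<le> norm (2 * (norm (f x))\<^sup>2 + 2 * (norm (g x))\<^sup>2)"
      by simp
  qed measurable
qed

lemma L2_scale:
  assumes "f \<in> L2"
  shows "(\<lambda>x. c * f x) \<in> L2"
  using L2_measurable[OF assms]
  by (intro L2_dominated[OF assms, of _ "norm c"]) (auto simp: norm_mult)

lemma L2_norm_scale: "L2_norm (\<lambda>x. c * f x) = norm c * L2_norm f"
  by (simp add: L2_norm_def norm_mult power_mult_distrib real_sqrt_mult)

lemma L2_diff:
  assumes "f \<in> L2" "g \<in> L2"
  shows "(\<lambda>x. f x - g x) \<in> L2"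
  using L2_add[OF assms(1) L2_scale[OF assms(2), of "-1"]] by simp

lemma L2_norm_minus_commute: "L2_norm (\<lambda>x. f x - g x) = L2_norm (\<lambda>x. g x - f x)"
  by (simp add: L2_norm_def norm_minus_commute)

lemma borel_measurable_cnj [measurable]: "cnj \<in> borel_measurable borel"
  by (intro borel_measurable_continuous_onI continuous_intros)

lemma L2_cnj:
  assumes "f \<in> L2"
  shows "(\<lambda>x. cnj (f x)) \<in> L2"
proof (rule L2I)
  note [measurable] = L2_measurable[OF assms]
  show "(\<lambda>x. cnj (f x)) \<in> borel_measurable lborel" by measurable
qed (use L2_integrable[OF assms] in simp)

lemma L2_norm_cnj: "L2_norm (\<lambda>x. cnj (f x)) = L2_norm f"
  by (simp add: L2_norm_def)

lemma L2_mult_integrable_norm: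
  assumes "f \<in> L2" "g \<in> L2"
  shows "integrable lborel (\<lambda>x. norm (f x) * norm (g x))"
proof (rule Bochner_Integration.integrable_bound)
  note [measurable] = L2_measurable[OF assms(1)] L2_measurable[OF assms(2)]
  show "integrable lborel (\<lambda>x. (norm (f x))\<^sup>2 + (norm (g x))\<^sup>2)"
    using assms by (auto dest!: L2_integrable)
  have "norm (f x) * norm (g x) \<le> (norm (f x))\<^sup>2 + (norm (g x))\<^sup>2" for x
  proof -
    have "0 \<le> norm (f x) * norm (g x)" by simp
    then show ?thesis using sum_squares_bound[of "norm (f x)" "norm (g x)"] by linarith
  qed
  then show "AE x in lborel. norm (norm (f x) * norm (g x))
      \<le> norm ((norm (f x))\<^sup>2 + (norm (g x))\<^sup>2)"
    by simp
  show "(\<lambda>x. norm (f x) * norm (g x)) \<in> borel_measurable lborel" by measurable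
qed

lemma L2_mult_integrable:
  assumes "f \<in> L2" "g \<in> L2"
  shows "integrable lborel (\<lambda>x. f x * g x)"
proof (rule Bochner_Integration.integrable_bound[OF L2_mult_integrable_norm[OF assms]])
  note [measurable] = L2_measurable[OF assms(1)] L2_measurable[OF assms(2)]
  show "(\<lambda>x. f x * g x) \<in> borel_measurable lborel" by measurable
qed (simp add: norm_mult)

text \<open>Young's inequality with the weight \<open>q\<close> that balances its two terms. Both
  norms are enlarged by \<open>e\<close> > 0, so that \<open>q\<close> is positive and finite even
  if one of them vanishes; then \<open>e\<close> tends to 0.\<close>

lemma L2_Cauchy_Schwarz_norm:
  assumes "f \<in> L2" "g \<in> L2"
  shows "(LINT x|lborel. norm (f x) * norm (g x)) \<le> L2_norm f * L2_norm g"
proof -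
  let ?a = "L2_norm f" and ?b = "L2_norm g"
  let ?C = "LINT x|lborel. norm (f x) * norm (g x)"
  have "?C \<le> (?a + e) * (?b + e)" if "e > 0" for e
  proof -
    have pos: "?a + e > 0" "?b + e > 0" using that L2_norm_nonneg[of f] L2_norm_nonneg[of g]
      by linarith+
    define q where "q = (?b + e) / (?a + e)"
    have q: "q > 0" using pos by (simp add: q_def)
    have pt: "norm (f x) * norm (g x) \<le> (q * (norm (f x))\<^sup>2 + (norm (g x))\<^sup>2 / q) / 2" for x
    proof -
      have "0 \<le> (q * norm (f x) - norm (g x))\<^sup>2 / q" using q by simp
      also have "\<dots> = q * (norm (f x))\<^sup>2 + (norm (g x))\<^sup>2 / q - 2 * norm (f x) * norm (g x)"
        using q by (simp add: power2_eq_square field_simps)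
      finally show ?thesis by simp
    qed
    have "?C \<le> (LINT x|lborel. (q * (norm (f x))\<^sup>2 + (norm (g x))\<^sup>2 / q) / 2)"
      using assms pt by (intro integral_mono L2_mult_integrable_norm) (auto dest!: L2_integrable)
    also have "\<dots> = (q * ?a\<^sup>2 + ?b\<^sup>2 / q) / 2"
      using assms by (subst integral_divide_zero, subst Bochner_Integration.integral_add)
        (auto dest!: L2_integrable simp: L2_norm_power2)
    also have "\<dots> \<le> (q * (?a + e)\<^sup>2 + (?b + e)\<^sup>2 / q) / 2"
      using q that by (intro divide_right_mono add_mono mult_left_mono power_mono) auto
    also have "\<dots> = (?a + e) * (?b + e)"
      using pos by (simp add: q_def power2_eq_square)
    finally show ?thesis .
  qed
  then have ev: "\<forall>\<^sub>F e in at_right 0. ?C \<le> (?a + e) * (?b + e)"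
    by (auto simp: eventually_at_filter)
  have lim: "((\<lambda>e. (?a + e) * (?b + e)) \<longlongrightarrow> (?a + 0) * (?b + 0)) (at_right 0)"
    by (intro tendsto_intros)
  show ?thesis using tendsto_lowerbound[OF lim ev] by simp
qed

lemma L2_Cauchy_Schwarz:
  assumes "f \<in> L2" "g \<in> L2"
  shows "norm (LINT x|lborel. f x * g x) \<le> L2_norm f * L2_norm g"
proof -
  have "norm (LINT x|lborel. f x * g x) \<le> (LINT x|lborel. norm (f x * g x))"
    by (rule integral_norm_bound)
  then show ?thesis using L2_Cauchy_Schwarz_norm[OF assms] by (simp add: norm_mult)
qed

lemma L2_triangle:
  assumes "f \<in> L2" "g \<in> L2"
  shows "L2_norm (\<lambda>x. f x + g x) \<le> L2_norm f + L2_norm g"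
proof (rule power2_le_imp_le)
  have "(L2_norm (\<lambda>x. f x + g x))\<^sup>2 \<le>
      (LINT x|lborel. (norm (f x))\<^sup>2 + (norm (g x))\<^sup>2 + 2 * (norm (f x) * norm (g x)))"
    unfolding L2_norm_power2
  proof (rule integral_mono)
    show "integrable lborel (\<lambda>x. (norm (f x + g x))\<^sup>2)"
      by (intro L2_integrable L2_add assms)
    show "integrable lborel (\<lambda>x. (norm (f x))\<^sup>2 + (norm (g x))\<^sup>2 + 2 * (norm (f x) * norm (g x)))"
      using assms by (auto intro!: L2_integrable L2_mult_integrable_norm)
    fix x
    have "(norm (f x + g x))\<^sup>2 \<le> (norm (f x) + norm (g x))\<^sup>2"
      by (intro power_mono norm_triangle_ineq) auto
    then show "(norm (f x + g x))\<^sup>2 \<le>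
        (norm (f x))\<^sup>2 + (norm (g x))\<^sup>2 + 2 * (norm (f x) * norm (g x))"
      by (simp add: power2_sum)
  qed
  also have "\<dots> = (L2_norm f)\<^sup>2 + (L2_norm g)\<^sup>2 + 2 * (LINT x|lborel. norm (f x) * norm (g x))"
    using assms by (simp add: L2_integrable L2_mult_integrable_norm L2_norm_power2)
  also have "\<dots> \<le> (L2_norm f + L2_norm g)\<^sup>2"
    using L2_Cauchy_Schwarz_norm[OF assms] by (simp add: power2_sum)
  finally show "(L2_norm (\<lambda>x. f x + g x))\<^sup>2 \<le> (L2_norm f + L2_norm g)\<^sup>2" .
qed simp

lemma L2_triangle_diff:
  assumes "f \<in> L2" "g \<in> L2" "h \<in> L2"
  shows "L2_norm (\<lambda>x. f x - h x) \<le> L2_norm (\<lambda>x. f x - g x) + L2_norm (\<lambda>x. g x - h x)"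
  using L2_triangle[OF L2_diff[OF assms(1,2)] L2_diff[OF assms(2,3)]] by simp

lemma L2_triangle_sub:
  assumes "f \<in> L2" "g \<in> L2"
  shows "\<bar>L2_norm f - L2_norm g\<bar> \<le> L2_norm (\<lambda>x. f x - g x)"
  using L2_triangle[OF L2_diff[OF assms] assms(2)] L2_triangle[OF L2_diff[OF assms(2,1)] assms(1)]
  by (simp add: L2_norm_minus_commute[of g f])

lemma L2_norm_tendsto:
  fixes f :: "'i \<Rightarrow> real ^ 'd \<Rightarrow> complex"
  assumes "\<And>i. f i \<in> L2" "g \<in> L2" "((\<lambda>i. L2_norm (\<lambda>x. f i x - g x)) \<longlongrightarrow> 0) F"
  shows "((\<lambda>i. L2_norm (f i)) \<longlongrightarrow> L2_norm g) F"
proof -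
  have "((\<lambda>i. L2_norm (f i) - L2_norm g) \<longlongrightarrow> 0) F"
    by (rule tendsto_rabs_zero_cancel, rule tendsto_sandwich[OF _ _ tendsto_const assms(3)])
      (auto simp: L2_triangle_sub assms)
  then show ?thesis by (simp add: LIM_zero_iff)
qed

lemma L2_norm_tendsto_0_add:
  fixes f g :: "'i \<Rightarrow> real ^ 'd \<Rightarrow> complex"
  assumes "\<forall>\<^sub>F i in F. f i \<in> L2" "\<forall>\<^sub>F i in F. g i \<in> L2"
    and "((\<lambda>i. L2_norm (f i)) \<longlongrightarrow> 0) F" "((\<lambda>i. L2_norm (g i)) \<longlongrightarrow> 0) F"
  shows "((\<lambda>i. L2_norm (\<lambda>x. f i x + g i x)) \<longlongrightarrow> 0) F"
proof (rule tendsto_sandwich[OF _ _ tendsto_const tendsto_add_zero[OF assms(3,4)]])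
  show "\<forall>\<^sub>F i in F. L2_norm (\<lambda>x. f i x + g i x) \<le> L2_norm (f i) + L2_norm (g i)"
    using assms(1,2) by eventually_elim (rule L2_triangle)
qed auto

text \<open>Membership is required only eventually, since families in time are controlled at
  nonnegative times only. The pairing is bilinear, without conjugation, as in the multiplication
  formula for the Fourier transform.\<close>

lemma L2_mult_tendsto:
  fixes f g :: "'i \<Rightarrow> real ^ 'd \<Rightarrow> complex"
  assumes fL: "\<forall>\<^sub>F i in F. f i \<in> L2" "f0 \<in> L2" and gL: "\<forall>\<^sub>F i in F. g i \<in> L2" "g0 \<in> L2"
    and f: "((\<lambda>i. L2_norm (\<lambda>x. f i x - f0 x)) \<longlongrightarrow> 0) F"
    and g: "((\<lambda>i. L2_norm (\<lambda>x. g i x - g0 x)) \<longlongrightarrow> 0) F"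
  shows "((\<lambda>i. LINT x|lborel. f i x * g i x) \<longlongrightarrow> (LINT x|lborel. f0 x * g0 x)) F"
proof (rule Lim_null_comparison[THEN LIM_zero_cancel])
  let ?a = "\<lambda>i. L2_norm (\<lambda>x. f i x - f0 x)" and ?b = "\<lambda>i. L2_norm (\<lambda>x. g i x - g0 x)"
  show "\<forall>\<^sub>F i in F. norm ((LINT x|lborel. f i x * g i x) - (LINT x|lborel. f0 x * g0 x))
      \<le> ?a i * ?b i + ?a i * L2_norm g0 + L2_norm f0 * ?b i"
    using fL(1) gL(1)
  proof eventually_elim
    case (elim i)
    have d: "(\<lambda>x. f i x - f0 x) \<in> L2" "(\<lambda>x. g i x - g0 x) \<in> L2"
      using elim fL gL by (auto intro: L2_diff)
    have "(LINT x|lborel. f i x * g i x) - (LINT x|lborel. f0 x * g0 x)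
        = (LINT x|lborel. f i x * g i x - f0 x * g0 x)"
      using elim fL gL by (simp add: L2_mult_integrable)
    also have "\<dots> = (LINT x|lborel. (f i x - f0 x) * (g i x - g0 x) + (f i x - f0 x) * g0 x
          + f0 x * (g i x - g0 x))"
      by (rule Bochner_Integration.integral_cong) (auto simp: algebra_simps)
    also have "\<dots> = (LINT x|lborel. (f i x - f0 x) * (g i x - g0 x))
        + (LINT x|lborel. (f i x - f0 x) * g0 x) + (LINT x|lborel. f0 x * (g i x - g0 x))"
      using d fL gL by (simp add: L2_mult_integrable)
    finally have eq: "(LINT x|lborel. f i x * g i x) - (LINT x|lborel. f0 x * g0 x) = \<dots>" .
    show ?case
      unfolding eq using d fL gL
      by (intro norm_triangle_le[OF add_mono] norm_triangle_le[OF add_mono] L2_Cauchy_Schwarz)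
  qed
  have "((\<lambda>i. ?a i * ?b i + ?a i * L2_norm g0 + L2_norm f0 * ?b i) \<longlongrightarrow>
      0 * 0 + 0 * L2_norm g0 + L2_norm f0 * 0) F"
    by (intro tendsto_intros f g)
  then show "((\<lambda>i. ?a i * ?b i + ?a i * L2_norm g0 + L2_norm f0 * ?b i) \<longlongrightarrow> 0) F"
    by simp
qed

lemma L2_dominated_convergence:
  fixes f :: "nat \<Rightarrow> real ^ 'd \<Rightarrow> complex"
  assumes "\<And>n. f n \<in> borel_measurable lborel" "w \<in> L2"
    and "\<And>n. AE x in lborel. norm (f n x) \<le> norm (w x)"
    and "AE x in lborel. (\<lambda>n. f n x) \<longlonglongrightarrow> 0"
  shows "(\<lambda>n. L2_norm (f n)) \<longlonglongrightarrow> 0"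
proof -
  have "(\<lambda>n. LINT x|lborel. (norm (f n x))\<^sup>2) \<longlonglongrightarrow> (LINT x|(lborel :: (real ^ 'd) measure). (0::real))"
  proof (rule integral_dominated_convergence[where w="\<lambda>x. (norm (w x))\<^sup>2"])
    show "integrable lborel (\<lambda>x. (norm (w x))\<^sup>2)" by (rule L2_integrable) fact
    show "AE x in lborel. (\<lambda>n. (norm (f n x))\<^sup>2) \<longlonglongrightarrow> 0"
      using assms(4)
    proof eventually_elim
      case (elim x)
      from tendsto_power[OF tendsto_norm[OF elim], of 2] show ?case by simp
    qed
    show "AE x in lborel. norm ((norm (f n x))\<^sup>2) \<le> (norm (w x))\<^sup>2" for n
      using assms(3)[of n] by eventually_elim (auto intro: power_mono)
  qed (use assms(1) in measurable)
  then have "(\<lambda>n. sqrt (LINT x|lborel. (norm (f n x))\<^sup>2)) \<longlonglongrightarrow> sqrt 0"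
    by (intro tendsto_real_sqrt) simp
  then show ?thesis by (simp add: L2_norm_def)
qed

text \<open>Membership of \<open>g\<close> is a conclusion of its own: outside \<open>L2\<close> the
  integral, and hence \<open>L2_norm\<close>, is 0 by convention, so the norm bound alone would say
  nothing.\<close>

lemma L2_Fatou:
  assumes f: "\<And>n. f n \<in> L2" and g: "g \<in> borel_measurable lborel"
    and lim: "AE x in lborel. (\<lambda>n. f n x) \<longlonglongrightarrow> g x"
    and bd: "\<forall>\<^sub>F n in sequentially. L2_norm (f n) \<le> C"
  shows "g \<in> L2" "L2_norm g \<le> C"
proof -
  note [measurable] = L2_measurable[OF f] g
  have C: "C \<ge> 0" using bd by (auto simp: eventually_sequentially intro: order_trans[OF L2_norm_nonneg])
  have eq: "(\<integral>\<^sup>+x. ennreal ((norm (f n x))\<^sup>2) \<partial>lborel) = ennreal ((L2_norm (f n))\<^sup>2)" for n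
    unfolding L2_norm_power2 by (intro nn_integral_eq_integral L2_integrable f) auto
  have "(\<integral>\<^sup>+x. ennreal ((norm (g x))\<^sup>2) \<partial>lborel)
      = (\<integral>\<^sup>+x. liminf (\<lambda>n. ennreal ((norm (f n x))\<^sup>2)) \<partial>lborel)"
  proof (rule nn_integral_cong_AE)
    show "AE x in lborel. ennreal ((norm (g x))\<^sup>2) = liminf (\<lambda>n. ennreal ((norm (f n x))\<^sup>2))"
      using lim
    proof eventually_elim
      case (elim x)
      have "(\<lambda>n. ennreal ((norm (f n x))\<^sup>2)) \<longlonglongrightarrow> ennreal ((norm (g x))\<^sup>2)"
        by (intro tendsto_ennrealI tendsto_intros elim)
      then show ?case by (intro lim_imp_Liminf[symmetric]) simp_all
    qed
  qed
  also have "\<dots> \<le> liminf (\<lambda>n. (\<integral>\<^sup>+x. ennreal ((norm (f n x))\<^sup>2) \<partial>lborel))"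
    by (rule nn_integral_liminf) measurable
  also have "\<dots> \<le> liminf (\<lambda>n::nat. ennreal (C\<^sup>2))"
    using bd unfolding eq
    by (intro Liminf_mono) (auto elim!: eventually_mono intro!: ennreal_leI power_mono)
  also have "\<dots> = ennreal (C\<^sup>2)" by (simp add: Liminf_const)
  finally have le: "(\<integral>\<^sup>+x. ennreal ((norm (g x))\<^sup>2) \<partial>lborel) \<le> ennreal (C\<^sup>2)" .
  then have "(\<integral>\<^sup>+x. ennreal (norm ((norm (g x))\<^sup>2)) \<partial>lborel) < \<infinity>"
    by (auto simp: top_unique less_top[symmetric])
  then have int: "integrable lborel (\<lambda>x. (norm (g x))\<^sup>2)"
    by (intro integrableI_bounded) auto
  then show "g \<in> L2" using g by (rule L2I[rotated])
  have "ennreal ((L2_norm g)\<^sup>2) = (\<integral>\<^sup>+x. ennreal ((norm (g x))\<^sup>2) \<partial>lborel)"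
    unfolding L2_norm_power2 by (rule nn_integral_eq_integral[symmetric]) (use int in auto)
  with le have "ennreal ((L2_norm g)\<^sup>2) \<le> ennreal (C\<^sup>2)" by metis
  then have "(L2_norm g)\<^sup>2 \<le> C\<^sup>2" by (subst (asm) ennreal_le_iff) auto
  then show "L2_norm g \<le> C" using C by (rule power2_le_imp_le)
qed


text \<open>Riesz-Fischer: a subsequence whose consecutive differences have norm at most (1/2)^k
  converges almost everywhere, and Fatou's lemma in the second index turns the Cauchy property into
  a bound for the distance to the limit.\<close>

lemma L2_complete:
  assumes f: "\<And>n. f n \<in> L2"
    and Cau: "\<And>e. e > 0 \<Longrightarrow> \<exists>N. \<forall>m\<ge>N. \<forall>n\<ge>N. L2_norm (\<lambda>x. f m x - f n x) < e"
  shows "\<exists>g\<in>L2. (\<lambda>n. L2_norm (\<lambda>x. f n x - g x)) \<longlonglongrightarrow> 0"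
proof -
  note [measurable] = L2_measurable[OF f]
  have "\<forall>k. \<exists>N. \<forall>m\<ge>N. \<forall>n\<ge>N. L2_norm (\<lambda>x. f m x - f n x) < (1/2)^k"
    using Cau by simp
  then obtain N where N: "\<And>k m n. m \<ge> N k \<Longrightarrow> n \<ge> N k \<Longrightarrow> L2_norm (\<lambda>x. f m x - f n x) < (1/2)^k"
    by metis
  \<comment> \<open>The summand \<open>k\<close> makes \<open>r\<close> strictly increasing, the sum
    makes \<open>r k\<close> at least \<open>N k\<close>.\<close>
  define r where "r k = k + (\<Sum>i\<le>k. N i)" for k
  have rN: "r k \<ge> N k" for k
    using member_le_sum[of k "{..k}" N] by (simp add: r_def trans_le_add2)
  have r: "strict_mono r"
    by (rule strict_monoI_Suc) (simp add: r_def)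
  define d where "d k x = f (r (Suc k)) x - f (r k) x" for k x
  have dL: "d k \<in> L2" for k
    unfolding d_def by (intro L2_diff f)
  note [measurable] = L2_measurable[OF dL]
  have "r (Suc k) \<ge> N k" for k
    using rN[of k] strict_mono_less_eq[OF r, of k "Suc k"] by linarith
  then have dn: "L2_norm (d k) \<le> (1/2)^k" for k
    unfolding d_def using N[of k "r (Suc k)" "r k"] rN[of k] by (simp add: less_imp_le)
  \<comment> \<open>The weight \<open>(6/5)\<^sup>k\<close> is small enough for the weighted norms to be summable and makes the
    pointwise series converge, by \<open>\<bar>d\<bar> \<le> (6/5)\<^sup>k \<bar>d\<bar>\<^sup>2 + (5/6)\<^sup>k\<close>.\<close>
  let ?w = "\<lambda>k x. ennreal ((6/5)^k * (norm (d k x))\<^sup>2)"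
  have "(\<integral>\<^sup>+x. (\<Sum>k. ?w k x) \<partial>lborel) = (\<Sum>k. \<integral>\<^sup>+x. ?w k x \<partial>lborel)"
    by (rule nn_integral_suminf) measurable
  also have "\<dots> \<le> (\<Sum>k. ennreal ((3/10)^k))"
  proof (intro suminf_le)
    fix k
    have "(\<integral>\<^sup>+x. ?w k x \<partial>lborel) = ennreal ((6/5)^k * (L2_norm (d k))\<^sup>2)"
    proof -
      have "(\<integral>\<^sup>+x. ?w k x \<partial>lborel) = ennreal (LINT x|lborel. (6/5)^k * (norm (d k x))\<^sup>2)"
        by (rule nn_integral_eq_integral) (use L2_integrable[OF dL] in auto)
      then show ?thesis by (simp add: L2_norm_power2)
    qed
    also have "\<dots> \<le> ennreal ((6/5)^k * ((1/2)^k)\<^sup>2)"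
      by (intro ennreal_leI mult_left_mono power_mono dn) auto
    also have "(6/5)^k * ((1/2)^k)\<^sup>2 = ((6/5 * (1/2 * (1/2)))^k :: real)"
      by (simp only: power2_eq_square power_mult_distrib)
    also have "\<dots> = (3/10)^k" by simp
    finally show "(\<integral>\<^sup>+x. ?w k x \<partial>lborel) \<le> ennreal ((3/10)^k)" .
  qed auto
  also have "\<dots> < \<infinity>"
  proof -
    have "(\<Sum>k. ennreal ((3/10)^k)) = ennreal (\<Sum>k. (3/10)^k)"
      by (rule suminf_ennreal2) (auto intro: summable_geometric)
    then show ?thesis by simp
  qed
  finally have "AE x in lborel. (\<Sum>k. ?w k x) \<noteq> \<infinity>"
    by (intro nn_integral_PInf_AE) auto
  then have conv: "AE x in lborel. convergent (\<lambda>k. f (r k) x)"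
  proof eventually_elim
    case (elim x)
    have s1: "summable (\<lambda>k. (6/5)^k * (norm (d k x))\<^sup>2)"
      by (rule summable_suminf_not_top) (use elim in auto)
    have "summable (\<lambda>k. (6/5)^k * (norm (d k x))\<^sup>2 + (5/6)^k)"
      by (intro summable_add s1 summable_geometric) auto
    then have "summable (\<lambda>k. norm (d k x))"
    proof (rule summable_comparison_test'[where N=0])
      fix k
      let ?q = "(6/5::real)^k"
      have "0 \<le> (?q * norm (d k x) - 1)\<^sup>2 / ?q + norm (d k x)" by simp
      also have "\<dots> = ?q * (norm (d k x))\<^sup>2 + 1 / ?q - norm (d k x)"
        by (simp add: power2_eq_square field_simps)
      also have "1 / ?q = (5/6)^k"
        by (simp add: power_divide)
      finally show "norm (norm (d k x)) \<le> ?q * (norm (d k x))\<^sup>2 + (5/6)^k" by simp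
    qed
    then have "summable (\<lambda>k. d k x)" by (rule summable_norm_cancel)
    then have "convergent (\<lambda>n. \<Sum>k<n. d k x)" by (simp add: summable_iff_convergent)
    then have "convergent (\<lambda>n. (\<Sum>k<n. d k x) + f (r 0) x)"
      by (simp add: convergent_add_const_right_iff)
    also have "(\<lambda>n. (\<Sum>k<n. d k x) + f (r 0) x) = (\<lambda>n. f (r n) x)"
      using sum_lessThan_telescope[of "\<lambda>k. f (r k) x"] by (simp add: d_def)
    finally show ?case .
  qed
  define g where "g x = lim (\<lambda>k. f (r k) x)" for x
  have g[measurable]: "g \<in> borel_measurable lborel"
    unfolding g_def by measurable
  have lim: "AE x in lborel. (\<lambda>k. f (r k) x) \<longlonglongrightarrow> g x"
    using conv by eventually_elim (simp add: g_def convergent_LIMSEQ_iff)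
  have tail: "(\<lambda>x. f m x - g x) \<in> L2 \<and> L2_norm (\<lambda>x. f m x - g x) \<le> e"
    if e: "\<forall>m\<ge>n. \<forall>k\<ge>n. L2_norm (\<lambda>x. f m x - f k x) < e" and "m \<ge> n" for m n e
  proof (intro conjI; rule L2_Fatou[of "\<lambda>k x. f m x - f (r k) x"])
    show "AE x in lborel. (\<lambda>k. f m x - f (r k) x) \<longlonglongrightarrow> f m x - g x"
      using lim by eventually_elim (intro tendsto_intros)
    then show "AE x in lborel. (\<lambda>k. f m x - f (r k) x) \<longlonglongrightarrow> f m x - g x" .
    have "r k \<ge> n" if "k \<ge> n" for k
      using seq_suble[OF r, of k] that by linarith
    then show "\<forall>\<^sub>F k in sequentially. L2_norm (\<lambda>x. f m x - f (r k) x) \<le> e"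
      using e \<open>m \<ge> n\<close> unfolding eventually_sequentially by (blast intro: less_imp_le)
    then show "\<forall>\<^sub>F k in sequentially. L2_norm (\<lambda>x. f m x - f (r k) x) \<le> e" .
  qed (auto intro!: L2_diff f)
  show ?thesis
  proof (rule bexI[of _ g])
    obtain n where "\<forall>m\<ge>n. \<forall>k\<ge>n. L2_norm (\<lambda>x. f m x - f k x) < 1"
      using Cau[of 1] by auto
    with tail[of n 1 n] have "(\<lambda>x. f n x - g x) \<in> L2" by auto
    from L2_diff[OF f this, of n] show "g \<in> L2" by simp
    show "(\<lambda>n. L2_norm (\<lambda>x. f n x - g x)) \<longlonglongrightarrow> 0"
    proof (rule LIMSEQ_I)
      fix e :: real assume "e > 0"
      then obtain n where "\<forall>m\<ge>n. \<forall>k\<ge>n. L2_norm (\<lambda>x. f m x - f k x) < e/2"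
        using Cau[of "e/2"] by auto
      with tail[of n "e/2"] \<open>e > 0\<close>
      show "\<exists>n. \<forall>m\<ge>n. norm (L2_norm (\<lambda>x. f m x - g x) - 0) < e"
        by (intro exI[of _ n]) fastforce
    qed
  qed
qed

section \<open>Approximation by continuous functions of bounded support\<close>

definition clip :: "real \<Rightarrow> complex \<Rightarrow> complex" where
  "clip k z = of_real (k / max k (norm z)) * z"

lemma continuous_clip: "k > 0 \<Longrightarrow> continuous_on UNIV (clip k)"
  unfolding clip_def by (intro continuous_intros) (auto simp: max_def)

lemma norm_clip: "k > 0 \<Longrightarrow> norm (clip k z) \<le> k"
  by (auto simp: clip_def norm_mult norm_divide max_def field_simps)

lemma clip_eq: "k > 0 \<Longrightarrow> norm z \<le> k \<Longrightarrow> clip k z = z"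
  by (simp add: clip_def max_def)

lemma norm_clip_diff:
  assumes "k > 0"
  shows "norm (clip k z - z) \<le> norm z"
proof -
  have "clip k z - z = of_real (k / max k (norm z) - 1) * z"
    by (simp add: clip_def algebra_simps)
  moreover have "0 \<le> k / max k (norm z)" "k / max k (norm z) \<le> 1"
    using assms by (auto simp: divide_le_eq_1 max_def)
  then have "\<bar>k / max k (norm z) - 1\<bar> \<le> 1" by linarith
  ultimately show ?thesis
    by (simp only: norm_mult norm_of_real) (intro mult_left_le_one_le, auto)
qed

lemma L2_indicator_cball: "(\<lambda>x. c * indicator (cball 0 R) x) \<in> (L2 :: (real ^ 'd \<Rightarrow> complex) set)"
proof (rule L2I)
  have "integrable lborel (\<lambda>x::real ^ 'd. (norm c)\<^sup>2 * indicator (cball 0 R) x)"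
    by (auto intro!: integrable_real_indicator emeasure_bounded_finite)
  then show "integrable lborel (\<lambda>x::real ^ 'd. (norm (c * indicator (cball 0 R) x))\<^sup>2)"
    by (rule Bochner_Integration.integrable_cong[THEN iffD1, rotated -1])
      (auto simp: norm_mult power_mult_distrib indicator_def)
qed (auto intro!: borel_measurable_times borel_measurable_indicator)

text \<open>Measurability yields continuous functions that converge to \<open>f\<close> almost
  everywhere, but without a common bound. So \<open>f\<close> is first replaced by
  \<open>clip k (f x)\<close> for a large \<open>k\<close>; the approximants are then mapped by the
  same continuous retraction onto the disc of radius \<open>k\<close> and cut off in space, after
  which dominated convergence applies.\<close>

lemma L2_approx_continuous:
  fixes f :: "real ^ 'd \<Rightarrow> complex"
  assumes f: "f \<in> L2" and supp: "\<And>x. norm x > R \<Longrightarrow> f x = 0" and e: "e > 0"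
  shows "\<exists>g B. continuous_on UNIV g \<and> (\<forall>x. norm (g x) \<le> B) \<and> (\<forall>x. norm x > R + 1 \<longrightarrow> g x = 0)
    \<and> L2_norm (\<lambda>x. g x - f x) < e"
proof -
  note [measurable] = L2_measurable[OF f]
  have [measurable]: "clip k \<in> borel_measurable borel" if "k > 0" for k
    using continuous_clip[OF that] by (rule borel_measurable_continuous_onI)
  have cf[measurable]: "(\<lambda>x. clip k (f x)) \<in> borel_measurable lborel" if "k > 0" for k
    using that by measurable
  have "(\<lambda>n. L2_norm (\<lambda>x. clip (real (Suc n)) (f x) - f x)) \<longlonglongrightarrow> 0"
  proof (rule L2_dominated_convergence[OF _ f])
    show "AE x in lborel. (\<lambda>n. clip (real (Suc n)) (f x) - f x) \<longlonglongrightarrow> 0"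
    proof (rule AE_I2, rule tendsto_eventually)
      fix x
      obtain N :: nat where "norm (f x) \<le> N" using real_arch_simple by blast
      then show "\<forall>\<^sub>F n in sequentially. clip (real (Suc n)) (f x) - f x = 0"
        unfolding eventually_sequentially by (intro exI[of _ N]) (auto intro!: clip_eq)
    qed
  qed (use norm_clip_diff in auto)
  then have "\<forall>\<^sub>F n in sequentially. L2_norm (\<lambda>x. clip (real (Suc n)) (f x) - f x) < e / 2"
    using e by (intro order_tendstoD(2)) auto
  then obtain n where n: "L2_norm (\<lambda>x. clip (real (Suc n)) (f x) - f x) < e / 2"
    using eventually_happens'[OF sequentially_bot] by blast
  define k where "k = real (Suc n)"
  have k: "k > 0" by (simp add: k_def)
  have "f \<in> borel_measurable lebesgue"
    using L2_measurable[OF f] by (simp add: measurable_completion)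
  then have "f measurable_on UNIV"
    by (intro lebesgue_measurable_imp_measurable_on) auto
  then obtain N g where Ng: "negligible N" "\<forall>n. continuous_on UNIV (g n)"
      "\<forall>x. x \<notin> N \<longrightarrow> (\<lambda>n. g n x) \<longlonglongrightarrow> (if x \<in> UNIV then f x else 0)"
    unfolding measurable_on_def by - (elim exE conjE, rule that)
  then have N: "negligible N" and g: "\<And>n. continuous_on UNIV (g n)"
    and lim: "\<And>x. x \<notin> N \<Longrightarrow> (\<lambda>n. g n x) \<longlonglongrightarrow> f x"
    by auto
  \<comment> \<open>A continuous cut-off, 1 on the ball of radius \<open>R\<close> and 0 off the
    ball of radius \<open>R + 1\<close>; it is the reason for the enlarged support.\<close>
  define \<eta> where "\<eta> x = max 0 (min 1 (R + 1 - norm x))" for x :: "real ^ 'd"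
  have chi: "continuous_on UNIV \<eta>" "\<And>x. 0 \<le> \<eta> x" "\<And>x. \<eta> x \<le> 1"
    unfolding \<eta>_def by (auto intro!: continuous_intros)
  define h where "h n x = of_real (\<eta> x) * clip k (g n x)" for n x
  have h: "continuous_on UNIV (h n)" for n
    unfolding h_def using chi(1) continuous_on_compose2[OF continuous_clip[OF k] g]
    by (intro continuous_intros) auto
  have hk: "norm (h n x) \<le> k" for n x
    using chi(2,3)[of x] norm_clip[OF k, of "g n x"] k
    by (auto simp: h_def norm_mult intro!: mult_left_le_one_le[THEN order_trans])
  have h0: "h n x = 0" if "norm x > R + 1" for n x
    using that by (simp add: h_def \<eta>_def)
  have [measurable]: "h n \<in> borel_measurable borel" for n
    using h by (rule borel_measurable_continuous_onI)
  have "(\<lambda>n. L2_norm (\<lambda>x. h n x - clip k (f x))) \<longlonglongrightarrow> 0"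
  proof (rule L2_dominated_convergence)
    show "(\<lambda>x. of_real (2 * k) * indicator (cball 0 (R + 1)) x) \<in> (L2 :: (real ^ 'd \<Rightarrow> complex) set)"
      by (rule L2_indicator_cball)
    have "norm (h n x - clip k (f x)) \<le> norm (of_real (2 * k) * indicator (cball 0 (R + 1)) x :: complex)" for n x
    proof (cases "norm x > R + 1")
      case True
      then show ?thesis using supp[of x] by (simp add: h0 clip_def)
    next
      case False
      have "norm (h n x - clip k (f x)) \<le> k + k"
        by (intro norm_triangle_le_diff add_mono hk norm_clip k)
      also have "\<dots> = norm (of_real (2 * k) * indicator (cball 0 (R + 1)) x :: complex)"
        using False k by (simp add: norm_mult)
      finally show ?thesis .
    qed
    then show "AE x in lborel. norm (h n x - clip k (f x))
        \<le> norm (of_real (2 * k) * indicator (cball 0 (R + 1)) x :: complex)" for n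
      by simp
    have "N \<in> null_sets lebesgue" using N by (simp add: negligible_iff_null_sets)
    then have "AE x in lebesgue. x \<notin> N" by (rule AE_not_in)
    then have "AE x in lborel. x \<notin> N" by (simp add: AE_completion_iff)
    then show "AE x in lborel. (\<lambda>n. h n x - clip k (f x)) \<longlonglongrightarrow> 0"
    proof eventually_elim
      case (elim x)
      have "isCont (clip k) (f x)"
        using continuous_clip[OF k] by (simp add: continuous_on_eq_continuous_at)
      from isCont_tendsto_compose[OF this lim[OF elim]]
      have "(\<lambda>n. h n x) \<longlonglongrightarrow> of_real (\<eta> x) * clip k (f x)"
        unfolding h_def by (intro tendsto_intros)
      also have "of_real (\<eta> x) * clip k (f x) = clip k (f x)"
        using supp[of x] by (cases "norm x > R") (auto simp: clip_def \<eta>_def)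
      finally show ?case by (simp add: LIM_zero)
    qed
  qed (use k in measurable)
  then have "\<forall>\<^sub>F n in sequentially. L2_norm (\<lambda>x. h n x - clip k (f x)) < e / 2"
    using e by (intro order_tendstoD(2)) auto
  then obtain m where m: "L2_norm (\<lambda>x. h m x - clip k (f x)) < e / 2"
    using eventually_happens'[OF sequentially_bot] by blast
  have c2: "(\<lambda>x. clip k (f x)) \<in> L2"
  proof (intro L2_dominated[OF f, of _ 2] cf k AE_I2)
    show "norm (clip k (f x)) \<le> 2 * norm (f x)" for x
      using norm_clip_diff[OF k, of "f x"] norm_triangle_sub[of "clip k (f x)" "f x"] by linarith
  qed
  have h2: "h m \<in> L2"
    using h0[of _ m] hk[of m] k
    by (intro L2_dominated[OF L2_indicator_cball[of 1 "R + 1"], of _ k])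
      (auto simp: indicator_def intro!: AE_I2)
  have "L2_norm (\<lambda>x. h m x - f x) \<le> L2_norm (\<lambda>x. h m x - clip k (f x)) + L2_norm (\<lambda>x. clip k (f x) - f x)"
    by (intro L2_triangle_diff h2 c2 f)
  also have "\<dots> < e" using n m by (simp add: k_def)
  finally show ?thesis using h[of m] hk[of m] h0[of _ m] by blast
qed

subsection \<open>The Fourier transform of integrable functions\<close>

definition fourier_L1 :: "(real ^ 'd \<Rightarrow> complex) \<Rightarrow> real ^ 'd \<Rightarrow> complex" where
  "fourier_L1 f \<xi> = of_real ((2 * pi) powr (- real CARD('d) / 2)) *
     (LINT x|lborel. cis (- (x \<bullet> \<xi>)) * f x)"

lemma borel_measurable_cis [measurable]: "cis \<in> borel_measurable borel"
  by (intro borel_measurable_continuous_onI continuous_intros)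

lemma integrable_cis_mult:
  fixes f :: "real ^ 'd \<Rightarrow> complex"
  assumes "integrable lborel f" "u \<in> borel_measurable lborel"
  shows "integrable lborel (\<lambda>x. cis (u x) * f x)"
proof (rule Bochner_Integration.integrable_bound[OF assms(1)])
  note [measurable] = borel_measurable_integrable[OF assms(1)] assms(2)
  show "(\<lambda>x. cis (u x) * f x) \<in> borel_measurable lborel" by measurable
qed (simp add: norm_mult)

lemma borel_measurable_fourier_L1:
  assumes "f \<in> borel_measurable lborel"
  shows "fourier_L1 f \<in> borel_measurable lborel"
proof -
  note [measurable] = assms
  show ?thesis unfolding fourier_L1_def[abs_def] by measurable
qed

lemma norm_fourier_L1_le:
  fixes f :: "real ^ 'd \<Rightarrow> complex"
  shows "norm (fourier_L1 f \<xi>) \<le> (2 * pi) powr (- real CARD('d) / 2) * (LINT x|lborel. norm (f x))"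
proof -
  have "norm (LINT x|lborel. cis (- (x \<bullet> \<xi>)) * f x) \<le> (LINT x|lborel. norm (cis (- (x \<bullet> \<xi>)) * f x))"
    by (rule integral_norm_bound)
  then show ?thesis by (simp add: fourier_L1_def norm_mult)
qed

lemma fourier_L1_diff:
  assumes "integrable lborel f" "integrable lborel g"
  shows "fourier_L1 (\<lambda>x. f x - g x) \<xi> = fourier_L1 f \<xi> - fourier_L1 g \<xi>"
  using integrable_cis_mult[OF assms(1)] integrable_cis_mult[OF assms(2)]
  by (simp add: fourier_L1_def right_diff_distrib)

lemma fourier_L1_scale:
  "fourier_L1 (\<lambda>x. c * f x) \<xi> = c * fourier_L1 f \<xi>"
  by (simp add: fourier_L1_def mult.left_commute)

text \<open>The kernel is symmetric in the two variables, so Fubini's theorem moves the transform to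
  the other factor. Both the isometry and the surjectivity of the transform on \<open>L2\<close>
  rest on this identity.\<close>

lemma fourier_L1_multiplication:
  assumes f: "integrable lborel f" and g: "integrable lborel g"
  shows "(LINT \<xi>|lborel. fourier_L1 f \<xi> * g \<xi>) = (LINT x|lborel. f x * fourier_L1 g x)"
proof -
  note [measurable] = borel_measurable_integrable[OF f] borel_measurable_integrable[OF g]
  let ?k = "\<lambda>x \<xi>. cis (- (x \<bullet> \<xi>)) * f x * g \<xi>"
  have int: "integrable (lborel \<Otimes>\<^sub>M lborel) (case_prod ?k)"
  proof (rule lborel_pair.Fubini_integrable)
    show "integrable lborel (\<lambda>x. LINT \<xi>|lborel. norm (case_prod ?k (x, \<xi>)))"
      using f by (simp add: norm_mult)
    show "AE x in lborel. integrable lborel (\<lambda>\<xi>. case_prod ?k (x, \<xi>))"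
    proof (rule AE_I2)
      fix x
      have "integrable lborel (\<lambda>\<xi>. f x * (cis (- (x \<bullet> \<xi>)) * g \<xi>))"
        by (intro integrable_mult_right integrable_cis_mult g) measurable
      then show "integrable lborel (\<lambda>\<xi>. case_prod ?k (x, \<xi>))"
        by (simp add: mult_ac)
    qed
  qed measurable
  have "(LINT \<xi>|lborel. LINT x|lborel. ?k x \<xi>) = (LINT x|lborel. LINT \<xi>|lborel. ?k x \<xi>)"
    by (rule lborel_pair.Fubini_integral[OF int])
  moreover have "(LINT x|lborel. ?k x \<xi>) = (LINT x|lborel. cis (- (x \<bullet> \<xi>)) * f x) * g \<xi>" for \<xi>
    by simp
  moreover have "(LINT \<xi>|lborel. ?k x \<xi>) = f x * (LINT \<xi>|lborel. cis (- (\<xi> \<bullet> x)) * g \<xi>)" for x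
  proof -
    have "(LINT \<xi>|lborel. ?k x \<xi>) = (LINT \<xi>|lborel. f x * (cis (- (\<xi> \<bullet> x)) * g \<xi>))"
      by (intro Bochner_Integration.integral_cong) (auto simp: inner_commute mult_ac)
    then show ?thesis by simp
  qed
  ultimately have "(LINT \<xi>|lborel. (LINT x|lborel. cis (- (x \<bullet> \<xi>)) * f x) * g \<xi>)
      = (LINT x|lborel. f x * (LINT \<xi>|lborel. cis (- (\<xi> \<bullet> x)) * g \<xi>))"
    by simp
  then show ?thesis
    by (simp add: fourier_L1_def mult.assoc mult.left_commute[of "f _"])
qed

subsection \<open>Gaussians\<close>

text \<open>The oscillatory integral is the characteristic function of the standard normal
  distribution, rescaled by \<open>e\<close>.\<close>

lemma gaussian_real:
  assumes e: "e > 0"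
  shows "integrable lborel (\<lambda>x. exp (- (e * x)\<^sup>2 / 2))"
    and "(LINT x|lborel. cis (u * x) * of_real (exp (- (e * x)\<^sup>2 / 2)))
      = of_real (sqrt (2 * pi) / e * exp (- (u / e)\<^sup>2 / 2))"
proof -
  have dens: "std_normal_density x = exp (- x\<^sup>2 / 2) / sqrt (2 * pi)" for x
    by (simp add: std_normal_density_def)
  have "integrable lborel (\<lambda>x. sqrt (2 * pi) * std_normal_density x)"
    using integrable_std_normal_moment[of 0] by simp
  then have "integrable lborel (\<lambda>x::real. exp (- x\<^sup>2 / 2))"
    by (simp add: dens)
  from lborel_integrable_real_affine[OF this, of e 0]
  show "integrable lborel (\<lambda>x. exp (- (e * x)\<^sup>2 / 2))"
    using e by simp
  have std: "(LINT x|lborel. cis (v * x) * of_real (exp (- x\<^sup>2 / 2)))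
      = of_real (sqrt (2 * pi) * exp (- v\<^sup>2 / 2))" for v
  proof -
    have "of_real (exp (- v\<^sup>2 / 2)) = char std_normal_distribution v"
      by (simp add: char_std_normal_distribution)
    also have "\<dots> = (LINT x|lborel. std_normal_density x *\<^sub>R cis (v * x))"
      unfolding char_def by (subst integral_density) (auto simp: cis_conv_exp)
    also have "\<dots> = (LINT x|lborel. of_real (1 / sqrt (2 * pi)) * (cis (v * x) * of_real (exp (- x\<^sup>2 / 2))))"
      by (intro Bochner_Integration.integral_cong) (auto simp: dens scaleR_conv_of_real)
    also have "\<dots> = of_real (1 / sqrt (2 * pi)) * (LINT x|lborel. cis (v * x) * of_real (exp (- x\<^sup>2 / 2)))"
      by (rule integral_mult_right_zero)
    finally show ?thesis
      by (simp add: field_simps flip: of_real_mult)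
  qed
  have "(LINT x|lborel. cis (u * x) * of_real (exp (- (e * x)\<^sup>2 / 2)))
      = \<bar>1 / e\<bar> *\<^sub>R (LINT y|lborel. cis (u * (0 + 1 / e * y)) * of_real (exp (- (e * (0 + 1 / e * y))\<^sup>2 / 2)))"
    using e by (intro lborel_integral_real_affine) auto
  also have "\<dots> = (1 / e) *\<^sub>R (LINT y|lborel. cis (u / e * y) * of_real (exp (- y\<^sup>2 / 2)))"
    using e by simp
  finally show "(LINT x|lborel. cis (u * x) * of_real (exp (- (e * x)\<^sup>2 / 2)))
      = of_real (sqrt (2 * pi) / e * exp (- (u / e)\<^sup>2 / 2))"
    unfolding std by (simp add: scaleR_conv_of_real)
qed

lemma gaussian_vec:
  fixes \<xi> :: "real ^ 'd"
  assumes e: "e > 0"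
  shows "integrable lborel (\<lambda>x::real ^ 'd. exp (- (e * norm x)\<^sup>2 / 2))" (is ?int)
    and "(LINT x|lborel. cis (x \<bullet> \<xi>) * of_real (exp (- (e * norm x)\<^sup>2 / 2)))
      = of_real ((2 * pi) powr (real CARD('d) / 2) / e ^ CARD('d) * exp (- (norm \<xi> / e)\<^sup>2 / 2))" (is ?eq)
proof -
  interpret product_sigma_finite "\<lambda>b::real ^ 'd. lborel :: real measure" ..
  let ?B = "Basis :: (real ^ 'd) set"
  let ?s = "\<lambda>f. \<Sum>b\<in>?B. f b *\<^sub>R b"
  let ?g = "\<lambda>b t. cis (t * (\<xi> \<bullet> b)) * of_real (exp (- (e * t)\<^sup>2 / 2)) :: complex"
  let ?h = "\<lambda>x::real ^ 'd. cis (x \<bullet> \<xi>) * of_real (exp (- (e * norm x)\<^sup>2 / 2)) :: complex"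
  have nrm: "(norm x)\<^sup>2 = (\<Sum>b\<in>?B. (x \<bullet> b)\<^sup>2)" for x :: "real ^ 'd"
    unfolding power2_norm_eq_inner by (subst euclidean_inner) (simp add: power2_eq_square)
  have sb: "?s f \<bullet> b = f b" if "b \<in> ?B" for f b
    using that by (rule inner_sum_left_Basis)
  have prod: "?h (?s f) = (\<Prod>b\<in>?B. ?g b (f b))" for f
  proof -
    have "- (e * norm (?s f))\<^sup>2 / 2 = (\<Sum>b\<in>?B. - (e * f b)\<^sup>2 / 2)"
      by (simp add: power_mult_distrib nrm sb sum_distrib_left sum_divide_distrib sum_negf)
    moreover have "?s f \<bullet> \<xi> = (\<Sum>b\<in>?B. f b * (\<xi> \<bullet> b))"
      by (subst euclidean_inner) (simp add: sb)
    moreover have "cis (\<Sum>b\<in>?B. f b * (\<xi> \<bullet> b)) = (\<Prod>b\<in>?B. cis (f b * (\<xi> \<bullet> b)))"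
      by (simp add: cis_conv_exp sum_distrib_left exp_sum)
    ultimately show ?thesis
      by (simp add: exp_sum prod.distrib)
  qed
  have gi: "integrable lborel (?g b)" for b
  proof (rule Bochner_Integration.integrable_bound[OF gaussian_real(1)[OF e]])
    show "?g b \<in> borel_measurable lborel" by measurable
  qed (simp add: norm_mult)
  \<comment> \<open>In coordinates \<open>lborel\<close> is the image of a product measure, and the
    integrand is a product of one-dimensional Gaussians.\<close>
  have lb: "lborel = distr (\<Pi>\<^sub>M b\<in>?B. lborel) borel ?s"
    by (rule lborel_eq)
  have sm: "?s \<in> measurable (\<Pi>\<^sub>M b\<in>?B. lborel) borel"
    by measurable
  have hm: "?h \<in> borel_measurable borel"
    by measurable
  have "integrable lborel ?h"
    by (subst lb) (use product_integrable_prod[of ?B ?g] gi prod sm hm in \<open>simp add: integrable_distr_eq\<close>)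
  from integrable_norm[OF this] show ?int by (simp add: norm_mult)
  have "(LINT x|lborel. ?h x) = (LINT f|(\<Pi>\<^sub>M b\<in>?B. lborel). ?h (?s f))"
    by (subst lb, subst integral_distr[OF sm hm]) simp
  also have "\<dots> = (\<Prod>b\<in>?B. LINT t|lborel. ?g b t)"
    unfolding prod by (rule product_integral_prod) (use gi in auto)
  also have "\<dots> = (\<Prod>b\<in>?B. of_real (sqrt (2 * pi) / e * exp (- ((\<xi> \<bullet> b) / e)\<^sup>2 / 2)))"
    using gaussian_real(2)[OF e, of "\<xi> \<bullet> _"] by (intro prod.cong) (auto simp: mult.commute)
  also have "\<dots> = of_real ((sqrt (2 * pi) / e) ^ CARD('d) * (\<Prod>b\<in>?B. exp (- ((\<xi> \<bullet> b) / e)\<^sup>2 / 2)))"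
    unfolding of_real_prod[symmetric] by (simp only: prod.distrib prod_constant) simp
  also have "(\<Prod>b\<in>?B. exp (- ((\<xi> \<bullet> b) / e)\<^sup>2 / 2)) = exp (- (norm \<xi> / e)\<^sup>2 / 2)"
    by (simp add: exp_sum[symmetric] power_divide nrm sum_divide_distrib sum_negf)
  also have "(sqrt (2 * pi) / e) ^ CARD('d) = (2 * pi) powr (real CARD('d) / 2) / e ^ CARD('d)"
    by (simp add: power_divide powr_powr flip: powr_half_sqrt powr_realpow)
  finally show ?eq .
qed


lemma gaussian_mean:
  fixes x :: "real ^ 'd" and f :: "real ^ 'd \<Rightarrow> complex"
  assumes f: "f \<in> borel_measurable borel" and e: "e > 0"
  shows "(LINT y|lborel. of_real (exp (- (norm (x - y) / e)\<^sup>2 / 2)) * f y)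
    = of_real (e ^ CARD('d)) * (LINT z|lborel. of_real (exp (- (norm z)\<^sup>2 / 2)) * f (x + e *\<^sub>R z))"
proof -
  let ?h = "\<lambda>y. of_real (exp (- (norm (x - y) / e)\<^sup>2 / 2)) * f y"
  have [measurable]: "f \<in> borel_measurable borel" by (fact f)
  have h: "?h \<in> borel_measurable borel" by measurable
  have "(LINT y|lborel. ?h y) = (LINT y|density (distr lborel borel (\<lambda>z. x + e *\<^sub>R z)) (\<lambda>_. \<bar>e\<bar> ^ DIM(real ^ 'd)). ?h y)"
    using lborel_affine[of e x] e by simp
  also have "\<dots> = (LINT y|distr lborel borel (\<lambda>z. x + e *\<^sub>R z). (\<bar>e\<bar> ^ DIM(real ^ 'd)) *\<^sub>R ?h y)"
    using h by (subst integral_density) auto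
  also have "\<dots> = (LINT z|lborel. (\<bar>e\<bar> ^ DIM(real ^ 'd)) *\<^sub>R ?h (x + e *\<^sub>R z))"
    using h by (subst integral_distr) auto
  also have "\<dots> = (LINT z|lborel. of_real (e ^ CARD('d)) * (of_real (exp (- (norm z)\<^sup>2 / 2)) * f (x + e *\<^sub>R z)))"
  proof (intro Bochner_Integration.integral_cong refl)
    fix z
    have "norm (x - (x + e *\<^sub>R z)) / e = norm z" using e by simp
    then show "(\<bar>e\<bar> ^ DIM(real ^ 'd)) *\<^sub>R ?h (x + e *\<^sub>R z)
        = of_real (e ^ CARD('d)) * (of_real (exp (- (norm z)\<^sup>2 / 2)) * f (x + e *\<^sub>R z))"
      using e by (simp only: scaleR_conv_of_real[where 'a=complex]) simp
  qed
  finally show ?thesis by simp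
qed

text \<open>
  Both sides are tested against the Gaussian \<open>exp (-\<bar>e \<xi>\<bar>\<^sup>2 / 2)\<close>; its transform is an
  approximate identity, so that Fubini turns the energy of the transform into the pairing of \<open>f\<close>
  with a Gaussian average of \<open>f\<close>.
\<close>

lemma fourier_L1_gaussian_energy:
  fixes f :: "real ^ 'd \<Rightarrow> complex"
  assumes f: "integrable lborel f" and e: "e > 0"
  shows "integrable lborel (\<lambda>\<xi>. (norm (fourier_L1 f \<xi>))\<^sup>2 * exp (- (e * norm \<xi>)\<^sup>2 / 2))" (is ?int)
    and "of_real (LINT \<xi>|lborel. (norm (fourier_L1 f \<xi>))\<^sup>2 * exp (- (e * norm \<xi>)\<^sup>2 / 2))
      = (LINT x|lborel. f x * cnj (of_real ((2 * pi) powr (- real CARD('d) / 2)) *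
          (LINT z|lborel. of_real (exp (- (norm z)\<^sup>2 / 2)) * f (x + e *\<^sub>R z))))" (is ?eq)
proof -
  let ?c = "(2 * pi) powr (- real CARD('d) / 2)"
  let ?G = "\<lambda>\<xi>::real ^ 'd. exp (- (e * norm \<xi>)\<^sup>2 / 2)"
  have fm: "f \<in> borel_measurable borel" using borel_measurable_integrable[OF f] by simp
  note [measurable] = fm borel_measurable_fourier_L1[OF borel_measurable_integrable[OF f]]
  define M where "M = ?c * (LINT x|lborel. norm (f x))"
  have M: "norm (fourier_L1 f \<xi>) \<le> M" for \<xi>
    unfolding M_def by (rule norm_fourier_L1_le)
  then have M0: "M \<ge> 0" by (rule order_trans[OF norm_ge_zero])
  have Gi: "integrable lborel ?G" by (rule gaussian_vec(1)[OF e])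
  have MGi: "integrable lborel (\<lambda>\<xi>. C * ?G \<xi>)" for C
    using Gi by simp
  show ?int
  proof (rule Bochner_Integration.integrable_bound[OF MGi[of "M\<^sup>2"]])
    show "AE \<xi> in lborel. norm ((norm (fourier_L1 f \<xi>))\<^sup>2 * ?G \<xi>) \<le> norm (M\<^sup>2 * ?G \<xi>)"
      using M by (intro AE_I2) (auto simp: abs_mult intro!: power_mono)
  qed measurable
  \<comment> \<open>Chosen such that its product with the transform of \<open>f\<close> is the
    damped energy density.\<close>
  define h where "h \<xi> = cnj (fourier_L1 f \<xi>) * of_real (?G \<xi>)" for \<xi>
  have hi: "integrable lborel h"
  proof (rule Bochner_Integration.integrable_bound[OF MGi[of M]])
    show "AE \<xi> in lborel. norm (h \<xi>) \<le> norm (M * ?G \<xi>)"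
      using M M0 by (intro AE_I2) (auto simp: h_def norm_mult)
  qed (unfold h_def, measurable)
  \<comment> \<open>The transform of a modulated Gaussian is a Gaussian of width \<open>e\<close>
    centred at \<open>x\<close>, whose total mass does not depend on \<open>e\<close>.\<close>
  have trans: "fourier_L1 (\<lambda>\<xi>. cis (\<xi> \<bullet> x) * of_real (?G \<xi>)) y
      = of_real (exp (- (norm (x - y) / e)\<^sup>2 / 2) / e ^ CARD('d))" for x y
  proof -
    have "(LINT \<xi>|lborel. cis (- (\<xi> \<bullet> y)) * (cis (\<xi> \<bullet> x) * of_real (?G \<xi>)))
        = (LINT \<xi>|lborel. cis (\<xi> \<bullet> (x - y)) * of_real (?G \<xi>))"
      by (intro Bochner_Integration.integral_cong)
        (auto simp: mult.assoc[symmetric] cis_mult inner_diff_right)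
    also have "\<dots> = of_real ((2 * pi) powr (real CARD('d) / 2) / e ^ CARD('d) * exp (- (norm (x - y) / e)\<^sup>2 / 2))"
      by (rule gaussian_vec(2)[OF e])
    finally have "fourier_L1 (\<lambda>\<xi>. cis (\<xi> \<bullet> x) * of_real (?G \<xi>)) y = of_real (?c *
        ((2 * pi) powr (real CARD('d) / 2) / e ^ CARD('d) * exp (- (norm (x - y) / e)\<^sup>2 / 2)))"
      by (simp add: fourier_L1_def)
    moreover have "?c * (2 * pi) powr (real CARD('d) / 2) = 1"
      by (simp flip: powr_add)
    then have "?c * ((2 * pi) powr (real CARD('d) / 2) / e ^ CARD('d) * exp (- (norm (x - y) / e)\<^sup>2 / 2))
        = exp (- (norm (x - y) / e)\<^sup>2 / 2) / e ^ CARD('d)"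
      by (simp only: times_divide_eq_left times_divide_eq_right mult.assoc[symmetric] mult_1_left)
    ultimately show ?thesis by (simp only:)
  qed
  have Fh: "fourier_L1 h x = cnj (of_real ?c *
      (LINT z|lborel. of_real (exp (- (norm z)\<^sup>2 / 2)) * f (x + e *\<^sub>R z)))" for x
  proof -
    let ?k = "\<lambda>\<xi>. cis (\<xi> \<bullet> x) * of_real (?G \<xi>)"
    have ki: "integrable lborel ?k"
      using Gi by (intro integrable_cis_mult integrable_of_real) auto
    have "fourier_L1 h x = of_real ?c * (LINT \<xi>|lborel. cnj (fourier_L1 f \<xi> * ?k \<xi>))"
      unfolding fourier_L1_def[of h]
      by (intro arg_cong2[where f="(*)"] Bochner_Integration.integral_cong) (auto simp: h_def cis_cnj[symmetric])
    also have "\<dots> = cnj (of_real ?c * (LINT \<xi>|lborel. fourier_L1 f \<xi> * ?k \<xi>))"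
      unfolding complex_cnj_mult[of "of_real ?c"] complex_cnj_complex_of_real
      by (intro arg_cong2[where f="(*)"] refl Bochner_Integration.integral_cnj)
    also have "(LINT \<xi>|lborel. fourier_L1 f \<xi> * ?k \<xi>) = (LINT y|lborel. f y * fourier_L1 ?k y)"
      by (rule fourier_L1_multiplication[OF f ki])
    also have "\<dots> = (LINT y|lborel. (of_real (exp (- (norm (x - y) / e)\<^sup>2 / 2)) * f y) / of_real (e ^ CARD('d)))"
      unfolding trans by (intro Bochner_Integration.integral_cong) auto
    also have "\<dots> = (LINT z|lborel. of_real (exp (- (norm z)\<^sup>2 / 2)) * f (x + e *\<^sub>R z))"
      by (subst integral_divide_zero, subst gaussian_mean[OF fm e]) (use e in simp)
    finally show ?thesis .
  qed
  have "of_real (LINT \<xi>|lborel. (norm (fourier_L1 f \<xi>))\<^sup>2 * ?G \<xi>)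
      = (LINT \<xi>|lborel. complex_of_real ((norm (fourier_L1 f \<xi>))\<^sup>2 * ?G \<xi>))"
    by (rule integral_complex_of_real[symmetric])
  also have "\<dots> = (LINT \<xi>|lborel. fourier_L1 f \<xi> * h \<xi>)"
    by (intro Bochner_Integration.integral_cong)
      (auto simp: h_def complex_norm_square[symmetric] mult.assoc[symmetric])
  also have "\<dots> = (LINT x|lborel. f x * fourier_L1 h x)"
    by (rule fourier_L1_multiplication[OF f hi])
  finally show ?eq unfolding Fh .
qed

text \<open>The damping \<open>e n\<close> tends to 0 in the Gaussian energy identity. On the side
  of \<open>f\<close>, continuity gives convergence of the averages at each point, and boundedness
  gives domination. On the frequency side square-integrability is not known beforehand; there the
  damped energies increase, and monotone convergence yields it together with the value.\<close>

lemma fourier_L1_Plancherel_continuous: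
  fixes f :: "real ^ 'd \<Rightarrow> complex"
  assumes f: "integrable lborel f" and cont: "continuous_on UNIV f"
    and B: "\<And>x. norm (f x) \<le> B"
  shows "fourier_L1 f \<in> L2" "L2_norm (fourier_L1 f) = L2_norm f"
proof -
  let ?c = "(2 * pi) powr (- real CARD('d) / 2)"
  let ?N = "\<lambda>z::real ^ 'd. exp (- (norm z)\<^sup>2 / 2)"
  define e where "e n = 1 / real (Suc n)" for n
  have e: "e n > 0" for n by (simp add: e_def)
  have elim: "e \<longlonglongrightarrow> 0"
    unfolding e_def[abs_def] by (rule LIMSEQ_Suc[OF lim_1_over_n])
  have B0: "B \<ge> 0" using B by (rule order_trans[OF norm_ge_zero])
  have fm: "f \<in> borel_measurable borel" using borel_measurable_integrable[OF f] by simp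
  note [measurable] = fm borel_measurable_fourier_L1[OF borel_measurable_integrable[OF f]]
  have Ni: "integrable lborel ?N" using gaussian_vec(1)[of 1] by simp
  \<comment> \<open>The constant of the unitary transform is the reciprocal of the mass of the
    Gaussian, so the normalised averages tend to \<open>f\<close> itself.\<close>
  have Nint: "?c * (LINT z|lborel. ?N z) = 1"
  proof -
    have "complex_of_real (LINT z|lborel. ?N z) = of_real ((2 * pi) powr (real CARD('d) / 2))"
      using gaussian_vec(2)[of 1 "0 :: real ^ 'd"] by simp
    then have "(LINT z|lborel. ?N z) = (2 * pi) powr (real CARD('d) / 2)"
      using of_real_eq_iff by blast
    then show ?thesis by (simp flip: powr_add)
  qed
  define a where "a n x = (LINT z|lborel. of_real (?N z) * f (x + e n *\<^sub>R z))" for n x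
  have am[measurable]: "a n \<in> borel_measurable lborel" for n
    unfolding a_def[abs_def] by measurable
  have a_lim: "(\<lambda>n. a n x) \<longlonglongrightarrow> of_real (LINT z|lborel. ?N z) * f x" for x
  proof -
    have "(\<lambda>n. a n x) \<longlonglongrightarrow> (LINT z|lborel. of_real (?N z) * f x)"
      unfolding a_def
    proof (rule integral_dominated_convergence[where w="\<lambda>z. ?N z * B"])
      show "integrable lborel (\<lambda>z. ?N z * B)" using Ni by simp
      show "AE z in lborel. (\<lambda>n. of_real (?N z) * f (x + e n *\<^sub>R z)) \<longlonglongrightarrow> of_real (?N z) * f x"
      proof (rule AE_I2)
        fix z
        have "(\<lambda>n. x + e n *\<^sub>R z) \<longlonglongrightarrow> x + 0 *\<^sub>R z"
          by (intro tendsto_intros elim)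
        moreover have "isCont f x" using cont by (simp add: continuous_on_eq_continuous_at)
        ultimately have "(\<lambda>n. f (x + e n *\<^sub>R z)) \<longlonglongrightarrow> f x"
          using isCont_tendsto_compose[of x f "\<lambda>n. x + e n *\<^sub>R z"] by simp
        then show "(\<lambda>n. of_real (?N z) * f (x + e n *\<^sub>R z)) \<longlonglongrightarrow> of_real (?N z) * f x"
          by (intro tendsto_intros)
      qed
      show "AE z in lborel. norm (of_real (?N z) * f (x + e n *\<^sub>R z)) \<le> ?N z * B" for n
        using B by (simp add: norm_mult)
    qed measurable
    also have "(LINT z|lborel. of_real (?N z) * f x) = of_real (LINT z|lborel. ?N z) * f x"
      using integral_complex_of_real[of lborel ?N] by simp
    finally show ?thesis .
  qed
  have a_bd: "norm (a n x) \<le> (LINT z|lborel. ?N z) * B" for n x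
  proof -
    have "norm (a n x) \<le> (LINT z|lborel. norm (of_real (?N z) * f (x + e n *\<^sub>R z)))"
      unfolding a_def by (rule integral_norm_bound)
    also have "\<dots> \<le> (LINT z|lborel. ?N z * B)"
    proof (rule integral_mono)
      show "integrable lborel (\<lambda>z. ?N z * B)" using Ni by simp
      then show "integrable lborel (\<lambda>z. norm (of_real (?N z) * f (x + e n *\<^sub>R z)))"
        by (rule Bochner_Integration.integrable_bound) (use B B0 in \<open>auto simp: norm_mult\<close>)
    qed (use B in \<open>auto simp: norm_mult\<close>)
    finally show ?thesis by simp
  qed
  have lim: "(\<lambda>n. LINT x|lborel. f x * cnj (of_real ?c * a n x)) \<longlonglongrightarrow> (LINT x|lborel. f x * cnj (f x))"
  proof (rule integral_dominated_convergence[where w="\<lambda>x. norm (f x) * B"])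
    show "integrable lborel (\<lambda>x. norm (f x) * B)" using f by simp
    show "AE x in lborel. (\<lambda>n. f x * cnj (of_real ?c * a n x)) \<longlonglongrightarrow> f x * cnj (f x)"
    proof (rule AE_I2)
      fix x
      have "(\<lambda>n. f x * cnj (of_real ?c * a n x)) \<longlonglongrightarrow>
          f x * cnj (of_real ?c * (of_real (LINT z|lborel. ?N z) * f x))"
        by (intro tendsto_intros a_lim)
      also have "of_real ?c * (of_real (LINT z|lborel. ?N z) * f x) = f x"
        using Nint by (simp flip: mult.assoc of_real_mult)
      finally show "(\<lambda>n. f x * cnj (of_real ?c * a n x)) \<longlonglongrightarrow> f x * cnj (f x)" .
    qed
    show "AE x in lborel. norm (f x * cnj (of_real ?c * a n x)) \<le> norm (f x) * B" for n
    proof (rule AE_I2)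
      fix x
      have "?c * norm (a n x) \<le> ?c * ((LINT z|lborel. ?N z) * B)"
        by (intro mult_left_mono a_bd) auto
      also have "\<dots> = B" using Nint by (simp flip: mult.assoc)
      finally show "norm (f x * cnj (of_real ?c * a n x)) \<le> norm (f x) * B"
        by (simp add: norm_mult mult_left_mono)
    qed
  qed measurable
  have fi: "integrable lborel (\<lambda>x. (norm (f x))\<^sup>2)"
    by (rule Bochner_Integration.integrable_bound[of _ "\<lambda>x. B * norm (f x)"])
      (use f B B0 in \<open>auto simp: power2_eq_square intro!: mult_right_mono\<close>)
  have ff: "(LINT x|lborel. f x * cnj (f x)) = of_real (LINT x|lborel. (norm (f x))\<^sup>2)"
    unfolding integral_complex_of_real[symmetric]
    by (intro Bochner_Integration.integral_cong) (auto simp: complex_norm_square[symmetric])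
  define E where "E n \<xi> = (norm (fourier_L1 f \<xi>))\<^sup>2 * exp (- (e n * norm \<xi>)\<^sup>2 / 2)" for n \<xi>
  have "complex_of_real (LINT \<xi>|lborel. E n \<xi>) = (LINT x|lborel. f x * cnj (of_real ?c * a n x))" for n
    unfolding E_def a_def by (rule fourier_L1_gaussian_energy(2)[OF f e])
  with lim ff have "(\<lambda>n. complex_of_real (LINT \<xi>|lborel. E n \<xi>)) \<longlonglongrightarrow> of_real (LINT x|lborel. (norm (f x))\<^sup>2)"
    by simp
  then have Elim: "(\<lambda>n. LINT \<xi>|lborel. E n \<xi>) \<longlonglongrightarrow> (LINT x|lborel. (norm (f x))\<^sup>2)"
    by (simp only: tendsto_of_real_iff)
  have mono: "E n \<xi> \<le> E m \<xi>" if "n \<le> m" for n m \<xi>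
  proof -
    have "e m \<le> e n" using that by (auto simp: e_def intro!: divide_left_mono)
    then have "(e m * norm \<xi>)\<^sup>2 \<le> (e n * norm \<xi>)\<^sup>2"
      using e[of m] by (intro power_mono mult_right_mono) auto
    then show ?thesis unfolding E_def by (intro mult_left_mono) auto
  qed
  have Ept: "(\<lambda>n. E n \<xi>) \<longlonglongrightarrow> (norm (fourier_L1 f \<xi>))\<^sup>2" for \<xi>
  proof -
    have "(\<lambda>n. E n \<xi>) \<longlonglongrightarrow> (norm (fourier_L1 f \<xi>))\<^sup>2 * exp (- (0 * norm \<xi>)\<^sup>2 / 2)"
      unfolding E_def by (intro tendsto_intros elim) auto
    then show ?thesis by simp
  qed
  have conv: "integrable lborel (\<lambda>\<xi>. (norm (fourier_L1 f \<xi>))\<^sup>2)"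
    "(LINT \<xi>|lborel. (norm (fourier_L1 f \<xi>))\<^sup>2) = (LINT x|lborel. (norm (f x))\<^sup>2)"
  proof -
    have i: "integrable lborel (E n)" for n
      unfolding E_def[abs_def] by (rule fourier_L1_gaussian_energy(1)[OF f e])
    have m: "AE \<xi> in lborel. mono (\<lambda>n. E n \<xi>)" using mono by (auto simp: mono_def)
    have l: "AE \<xi> in lborel. (\<lambda>n. E n \<xi>) \<longlonglongrightarrow> (norm (fourier_L1 f \<xi>))\<^sup>2" using Ept by simp
    have bm: "(\<lambda>\<xi>. (norm (fourier_L1 f \<xi>))\<^sup>2) \<in> borel_measurable lborel" by measurable
    show "integrable lborel (\<lambda>\<xi>. (norm (fourier_L1 f \<xi>))\<^sup>2)"
      by (rule integrable_monotone_convergence[OF i m l Elim bm])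
    show "(LINT \<xi>|lborel. (norm (fourier_L1 f \<xi>))\<^sup>2) = (LINT x|lborel. (norm (f x))\<^sup>2)"
      by (rule integral_monotone_convergence[OF i m l Elim bm])
  qed
  show "fourier_L1 f \<in> L2" by (rule L2I[OF _ conv(1)]) measurable
  show "L2_norm (fourier_L1 f) = L2_norm f" by (simp add: L2_norm_def conv(2))
qed


subsection \<open>Plancherel's theorem\<close>

lemma L2_compact_support_integrable:
  fixes f :: "real ^ 'd \<Rightarrow> complex"
  assumes f: "f \<in> L2" and supp: "\<And>x. norm x > R \<Longrightarrow> f x = 0"
  shows "integrable lborel f"
    and "(LINT x|lborel. norm (f x)) \<le> L2_norm f * L2_norm (indicator (cball 0 R) :: real ^ 'd \<Rightarrow> complex)"
proof -
  let ?i = "indicator (cball 0 R) :: real ^ 'd \<Rightarrow> complex"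
  have i: "?i \<in> L2" using L2_indicator_cball[of 1 R] by simp
  have fi: "f x * ?i x = f x" for x using supp[of x] by (auto simp: indicator_def)
  show "integrable lborel f" using L2_mult_integrable[OF f i] by (simp only: fi)
  have "(\<lambda>x. norm (f x) * norm (?i x)) = (\<lambda>x. norm (f x))"
    by (simp only: fi norm_mult[symmetric])
  then show "(LINT x|lborel. norm (f x)) \<le> L2_norm f * L2_norm ?i"
    using L2_Cauchy_Schwarz_norm[OF f i] by (simp only:)
qed

text \<open>A density argument. The approximants vanish off a common ball, on which the L2 norm
  controls the L1 norm; hence their transforms converge at every point. By the isometry these
  transforms are also Cauchy in L2, and Fatou's lemma shows that the pointwise limit is the L2
  limit.\<close>

lemma fourier_L1_Plancherel:
  fixes f :: "real ^ 'd \<Rightarrow> complex"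
  assumes f: "f \<in> L2" and supp: "\<And>x. norm x > R \<Longrightarrow> f x = 0"
  shows "fourier_L1 f \<in> L2" "L2_norm (fourier_L1 f) = L2_norm f"
proof -
  let ?K = "L2_norm (indicator (cball 0 (R + 1)) :: real ^ 'd \<Rightarrow> complex)"
  define e where "e n = 1 / real (Suc n)" for n
  have e: "e n > 0" for n by (simp add: e_def)
  have elim: "e \<longlonglongrightarrow> 0"
    unfolding e_def[abs_def] by (rule LIMSEQ_Suc[OF lim_1_over_n])
  have "\<exists>g B. continuous_on UNIV g \<and> (\<forall>x. norm (g x) \<le> B) \<and> (\<forall>x. norm x > R + 1 \<longrightarrow> g x = 0)
      \<and> L2_norm (\<lambda>x. g x - f x) < e n" for n
    by (rule L2_approx_continuous[OF f supp e])
  then obtain g B where cont: "\<And>n. continuous_on UNIV (g n)" and B: "\<And>n x. norm (g n x) \<le> B n"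
    and g0: "\<And>n x. norm x > R + 1 \<Longrightarrow> g n x = 0" and gf: "\<And>n. L2_norm (\<lambda>x. g n x - f x) < e n"
    by metis
  have gL: "g n \<in> L2" for n
  proof (rule L2_dominated[OF L2_indicator_cball[of 1 "R + 1"], of _ "B n"])
    show "g n \<in> borel_measurable lborel"
      using borel_measurable_continuous_onI[OF cont] by simp
    show "AE x in lborel. norm (g n x) \<le> B n * norm (1 * indicator (cball 0 (R + 1)) x :: complex)"
      using B[of n] g0[of _ n] by (intro AE_I2) (auto simp: indicator_def)
  qed
  have dL: "(\<lambda>x. g n x - f x) \<in> L2" for n by (rule L2_diff[OF gL f])
  have gi: "integrable lborel (g n)" for n
    by (rule L2_compact_support_integrable(1)[OF gL g0])
  have fi: "integrable lborel f"
    by (rule L2_compact_support_integrable(1)[OF f supp])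
  have P: "fourier_L1 (g n) \<in> L2" "L2_norm (fourier_L1 (g n)) = L2_norm (g n)" for n
    using fourier_L1_Plancherel_continuous[OF gi cont B] by auto
  have Pd: "L2_norm (\<lambda>\<xi>. fourier_L1 (g m) \<xi> - fourier_L1 (g n) \<xi>) = L2_norm (\<lambda>x. g m x - g n x)" for m n
  proof -
    have "norm (g m x - g n x) \<le> B m + B n" for x
      by (rule order_trans[OF norm_triangle_ineq4]) (intro add_mono B)
    then have "L2_norm (fourier_L1 (\<lambda>x. g m x - g n x)) = L2_norm (\<lambda>x. g m x - g n x)"
      by (intro fourier_L1_Plancherel_continuous(2) Bochner_Integration.integrable_diff gi
          continuous_intros cont)
    also have "fourier_L1 (\<lambda>x. g m x - g n x) = (\<lambda>\<xi>. fourier_L1 (g m) \<xi> - fourier_L1 (g n) \<xi>)"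
      by (intro ext fourier_L1_diff gi)
    finally show ?thesis .
  qed
  have lim: "(\<lambda>n. fourier_L1 (g n) \<xi>) \<longlonglongrightarrow> fourier_L1 f \<xi>" for \<xi>
  proof (rule LIM_zero_cancel, rule Lim_null_comparison)
    let ?c = "(2 * pi) powr (- real CARD('d) / 2)"
    have "norm (fourier_L1 (g n) \<xi> - fourier_L1 f \<xi>) \<le> ?c * (e n * ?K)" for n
    proof -
      have "norm (fourier_L1 (g n) \<xi> - fourier_L1 f \<xi>) \<le> ?c * (LINT x|lborel. norm (g n x - f x))"
        unfolding fourier_L1_diff[OF gi fi, symmetric] by (rule norm_fourier_L1_le)
      also have "\<dots> \<le> ?c * (L2_norm (\<lambda>x. g n x - f x) * ?K)"
        using g0[of _ n] supp
        by (intro mult_left_mono L2_compact_support_integrable(2) dL) auto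
      also have "\<dots> \<le> ?c * (e n * ?K)"
        using gf[of n] by (intro mult_left_mono mult_right_mono) auto
      finally show ?thesis .
    qed
    then show "\<forall>\<^sub>F n in sequentially. norm (fourier_L1 (g n) \<xi> - fourier_L1 f \<xi>) \<le> ?c * (e n * ?K)"
      by simp
    have "(\<lambda>n. ?c * (e n * ?K)) \<longlonglongrightarrow> ?c * (0 * ?K)" by (intro tendsto_intros elim)
    then show "(\<lambda>n. ?c * (e n * ?K)) \<longlonglongrightarrow> 0" by simp
  qed
  have Fm: "fourier_L1 f \<in> borel_measurable lborel"
    by (rule borel_measurable_fourier_L1[OF L2_measurable[OF f]])
  have F: "(\<lambda>\<xi>. fourier_L1 (g n) \<xi> - fourier_L1 f \<xi>) \<in> L2
      \<and> L2_norm (\<lambda>\<xi>. fourier_L1 (g n) \<xi> - fourier_L1 f \<xi>) \<le> 2 * e n" for n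
  proof (intro conjI; rule L2_Fatou[of "\<lambda>m \<xi>. fourier_L1 (g n) \<xi> - fourier_L1 (g m) \<xi>"])
    show "AE \<xi> in lborel. (\<lambda>m. fourier_L1 (g n) \<xi> - fourier_L1 (g m) \<xi>) \<longlonglongrightarrow> fourier_L1 (g n) \<xi> - fourier_L1 f \<xi>"
      by (intro AE_I2 tendsto_intros lim)
    then show "AE \<xi> in lborel. (\<lambda>m. fourier_L1 (g n) \<xi> - fourier_L1 (g m) \<xi>) \<longlonglongrightarrow> fourier_L1 (g n) \<xi> - fourier_L1 f \<xi>" .
    \<comment> \<open>For \<open>m\<close> beyond \<open>n\<close>, both \<open>g m\<close> and
      \<open>g n\<close> are within \<open>e n\<close> of \<open>f\<close>; hence the factor
      2.\<close>
    show *: "\<forall>\<^sub>F m in sequentially. L2_norm (\<lambda>\<xi>. fourier_L1 (g n) \<xi> - fourier_L1 (g m) \<xi>) \<le> 2 * e n"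
      unfolding eventually_sequentially Pd
    proof (intro exI[of _ n] allI impI)
      fix m assume "n \<le> m"
      then have "e m \<le> e n" by (auto simp: e_def intro!: divide_left_mono)
      moreover have "L2_norm (\<lambda>x. g n x - g m x) \<le> L2_norm (\<lambda>x. g n x - f x) + L2_norm (\<lambda>x. f x - g m x)"
        by (rule L2_triangle_diff[OF gL f gL])
      ultimately show "L2_norm (\<lambda>x. g n x - g m x) \<le> 2 * e n"
        using gf[of n] gf[of m] L2_norm_minus_commute[of f "g m"] by linarith
    qed
    show "\<forall>\<^sub>F m in sequentially. L2_norm (\<lambda>\<xi>. fourier_L1 (g n) \<xi> - fourier_L1 (g m) \<xi>) \<le> 2 * e n"
      by (rule *)
  qed (rule L2_diff borel_measurable_diff P(1) Fm L2_measurable)+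
  show FL: "fourier_L1 f \<in> L2"
    using L2_diff[OF P(1)[of 0] conjunct1[OF F[of 0]]] by simp
  have e2: "(\<lambda>n. 2 * e n) \<longlonglongrightarrow> 0" using tendsto_mult_right_zero[OF elim] by simp
  have "(\<lambda>n. L2_norm (\<lambda>\<xi>. fourier_L1 (g n) \<xi> - fourier_L1 f \<xi>)) \<longlonglongrightarrow> 0"
    by (rule tendsto_sandwich[OF _ _ tendsto_const e2]) (use F in auto)
  then have 1: "(\<lambda>n. L2_norm (fourier_L1 (g n))) \<longlonglongrightarrow> L2_norm (fourier_L1 f)"
    by (rule L2_norm_tendsto[OF P(1) FL])
  have "(\<lambda>n. L2_norm (\<lambda>x. g n x - f x)) \<longlonglongrightarrow> 0"
    by (rule tendsto_sandwich[OF _ _ tendsto_const elim]) (use gf in \<open>auto intro!: always_eventually less_imp_le\<close>)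
  then have 2: "(\<lambda>n. L2_norm (g n)) \<longlonglongrightarrow> L2_norm f"
    by (rule L2_norm_tendsto[OF gL f])
  show "L2_norm (fourier_L1 f) = L2_norm f"
    by (rule LIMSEQ_unique[OF 1]) (simp add: P(2) 2)
qed

section \<open>From the truncated Fourier integrals to the transform on L2\<close>

definition cutoff :: "real \<Rightarrow> (real ^ 'd \<Rightarrow> complex) \<Rightarrow> real ^ 'd \<Rightarrow> complex" where
  "cutoff R f x = indicator (cball 0 R) x *\<^sub>R f x"

text \<open>The scalar multiple by a real indicator in \<open>cutoff\<close> is what a set integral
  unfolds to, so the truncated Fourier integral is literally the transform of an integrable
  function.\<close>

lemma fourier_integral_eq: "fourier_integral R f = fourier_L1 (cutoff R f)"
  by (rule ext) (simp add: fourier_integral_def fourier_L1_def cutoff_def set_lebesgue_integral_def)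

lemma cutoff_eq_0: "norm x > R \<Longrightarrow> cutoff R f x = 0"
  by (simp add: cutoff_def)

lemma cutoff_L2:
  assumes "f \<in> L2"
  shows "cutoff R f \<in> L2"
proof (rule L2_dominated[OF assms, of _ 1])
  have [measurable]: "f \<in> borel_measurable borel" using L2_measurable[OF assms] by simp
  show "cutoff R f \<in> borel_measurable lborel"
    unfolding cutoff_def[abs_def] by (auto intro!: borel_measurable_scaleR borel_measurable_indicator)
qed (auto simp: cutoff_def indicator_def)

lemma cutoff_integrable: "f \<in> L2 \<Longrightarrow> integrable lborel (cutoff R f)"
  by (rule L2_compact_support_integrable(1)[OF cutoff_L2 cutoff_eq_0])

lemma cutoff_tendsto:
  fixes f :: "real ^ 'd \<Rightarrow> complex"
  assumes f: "f \<in> L2"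
  shows "((\<lambda>R. L2_norm (\<lambda>x. cutoff R f x - f x)) \<longlongrightarrow> 0) at_top"
proof (rule tendstoI)
  fix e :: real assume e: "e > 0"
  have "(\<lambda>n. L2_norm (\<lambda>x. cutoff (real n) f x - f x)) \<longlonglongrightarrow> 0"
  proof (rule L2_dominated_convergence[OF _ f])
    show "AE x in lborel. (\<lambda>n. cutoff (real n) f x - f x) \<longlonglongrightarrow> 0"
    proof (rule AE_I2, rule tendsto_eventually)
      fix x :: "real ^ 'd"
      obtain N :: nat where "norm x \<le> N" using real_arch_simple by blast
      then show "\<forall>\<^sub>F n in sequentially. cutoff (real n) f x - f x = 0"
        unfolding eventually_sequentially by (intro exI[of _ N]) (auto simp: cutoff_def)
    qed
    show "(\<lambda>x. cutoff (real n) f x - f x) \<in> borel_measurable lborel" for n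
      by (intro L2_measurable L2_diff cutoff_L2 f)
  qed (auto simp: cutoff_def indicator_def)
  then have "\<forall>\<^sub>F n in sequentially. L2_norm (\<lambda>x. cutoff (real n) f x - f x) < e"
    using e by (intro order_tendstoD(2)) auto
  then obtain n where n: "L2_norm (\<lambda>x. cutoff (real n) f x - f x) < e"
    using eventually_happens'[OF sequentially_bot] by blast
  \<comment> \<open>The error does not increase with the radius, so one integer radius settles all
    larger real ones.\<close>
  have "dist (L2_norm (\<lambda>x. cutoff R f x - f x)) 0 < e" if "R \<ge> n" for R :: real
  proof -
    have "L2_norm (\<lambda>x. cutoff R f x - f x) \<le> L2_norm (\<lambda>x. cutoff (real n) f x - f x)"
      using that by (intro L2_norm_mono L2_diff L2_measurable cutoff_L2 f AE_I2)
        (auto simp: cutoff_def indicator_def)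
    with n show ?thesis by simp
  qed
  then show "\<forall>\<^sub>F R in at_top. dist (L2_norm (\<lambda>x. cutoff R f x - f x)) 0 < e"
    unfolding eventually_at_top_linorder by blast
qed

lemma fourier_integral_L2:
  assumes "f \<in> L2"
  shows "fourier_integral R f \<in> L2" "L2_norm (fourier_integral R f) = L2_norm (cutoff R f)"
  unfolding fourier_integral_eq
  by (rule fourier_L1_Plancherel[OF cutoff_L2[OF assms] cutoff_eq_0], assumption)+

lemma fourier_integral_diff:
  assumes "f \<in> L2" "g \<in> L2"
  shows "fourier_integral R (\<lambda>x. f x - g x) \<xi> = fourier_integral R f \<xi> - fourier_integral R g \<xi>"
  unfolding fourier_integral_eq fourier_L1_diff[OF cutoff_integrable cutoff_integrable, OF assms, symmetric]
  by (simp add: cutoff_def[abs_def] scaleR_diff_right)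

lemma fourier_integral_L2_diff:
  assumes f: "f \<in> L2"
  shows "L2_norm (\<lambda>\<xi>. fourier_integral R f \<xi> - fourier_integral S f \<xi>) = L2_norm (\<lambda>x. cutoff R f x - cutoff S f x)"
proof -
  have "L2_norm (fourier_L1 (\<lambda>x. cutoff R f x - cutoff S f x)) = L2_norm (\<lambda>x. cutoff R f x - cutoff S f x)"
    by (rule fourier_L1_Plancherel(2)[where R="max R S"])
      (auto intro!: L2_diff cutoff_L2 f simp: cutoff_eq_0)
  moreover have "fourier_L1 (\<lambda>x. cutoff R f x - cutoff S f x)
      = (\<lambda>\<xi>. fourier_integral R f \<xi> - fourier_integral S f \<xi>)"
    unfolding fourier_integral_eq by (intro ext fourier_L1_diff cutoff_integrable f)
  ultimately show ?thesis by simp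
qed

lemma is_fourier_exists:
  assumes f: "f \<in> L2"
  shows "\<exists>g. is_fourier f g"
proof -
  \<comment> \<open>Stated for all real radii: completeness is applied along the integers, and the
    same estimate then carries the limit over to the whole family.\<close>
  have close: "\<exists>N::nat. \<forall>R\<ge>real N. \<forall>S\<ge>real N. L2_norm (\<lambda>\<xi>. fourier_integral R f \<xi> - fourier_integral S f \<xi>) < e"
    if e: "e > 0" for e
  proof -
    have "\<forall>\<^sub>F R in at_top. L2_norm (\<lambda>x. cutoff R f x - f x) < e / 2"
      using e by (intro order_tendstoD(2)[OF cutoff_tendsto[OF f]]) auto
    then obtain M where M: "\<And>R. R \<ge> M \<Longrightarrow> L2_norm (\<lambda>x. cutoff R f x - f x) < e / 2"
      by (auto simp: eventually_at_top_linorder)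
    obtain N :: nat where N: "M \<le> N" using real_arch_simple by blast
    have "L2_norm (\<lambda>\<xi>. fourier_integral R f \<xi> - fourier_integral S f \<xi>) < e"
      if "R \<ge> N" "S \<ge> N" for R S :: real
      unfolding fourier_integral_L2_diff[OF f]
      using L2_triangle_diff[OF cutoff_L2[OF f] f cutoff_L2[OF f], of R S]
        M[of R] M[of S] that N L2_norm_minus_commute[of f "cutoff S f"] by linarith
    then show ?thesis by blast
  qed
  obtain g where g: "g \<in> L2" "(\<lambda>n. L2_norm (\<lambda>\<xi>. fourier_integral (real n) f \<xi> - g \<xi>)) \<longlonglongrightarrow> 0"
  proof -
    have "\<exists>g\<in>L2. (\<lambda>n. L2_norm (\<lambda>\<xi>. fourier_integral (real n) f \<xi> - g \<xi>)) \<longlonglongrightarrow> 0"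
    proof (rule L2_complete)
      fix e :: real assume "e > 0"
      from close[OF this]
      show "\<exists>N. \<forall>m\<ge>N. \<forall>n\<ge>N. L2_norm (\<lambda>\<xi>. fourier_integral (real m) f \<xi> - fourier_integral (real n) f \<xi>) < e"
        by (meson of_nat_mono)
    qed (rule fourier_integral_L2[OF f])
    then show ?thesis using that by blast
  qed
  have "((\<lambda>R. L2_norm (fourier_integral R f - g)) \<longlongrightarrow> 0) at_top"
  proof (rule tendstoI)
    fix e :: real assume e: "e > 0"
    obtain N :: nat where N: "\<And>(R::real) (S::real). R \<ge> N \<Longrightarrow> S \<ge> N \<Longrightarrow>
        L2_norm (\<lambda>\<xi>. fourier_integral R f \<xi> - fourier_integral S f \<xi>) < e / 2"
      using close[of "e / 2"] e by auto
    have "\<forall>\<^sub>F n in sequentially. L2_norm (\<lambda>\<xi>. fourier_integral (real n) f \<xi> - g \<xi>) < e / 2 \<and> n \<ge> N"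
      using e by (intro eventually_conj order_tendstoD(2)[OF g(2)] eventually_ge_at_top) auto
    then obtain n where n: "L2_norm (\<lambda>\<xi>. fourier_integral (real n) f \<xi> - g \<xi>) < e / 2" "n \<ge> N"
      using eventually_happens'[OF sequentially_bot] by blast
    have "dist (L2_norm (fourier_integral R f - g)) 0 < e" if "R \<ge> N" for R :: real
      using L2_triangle_diff[OF fourier_integral_L2(1)[OF f] fourier_integral_L2(1)[OF f] g(1), of R "real n"]
        N[of R n] that n by (simp add: fun_diff_def)
    then show "\<forall>\<^sub>F R in at_top. dist (L2_norm (fourier_integral R f - g)) 0 < e"
      unfolding eventually_at_top_linorder by blast
  qed
  with f g(1) show ?thesis by (auto simp: is_fourier_def)
qed

lemma is_fourierD:
  assumes "is_fourier f g"
  shows "f \<in> L2" "g \<in> L2" "((\<lambda>R. L2_norm (\<lambda>\<xi>. fourier_integral R f \<xi> - g \<xi>)) \<longlongrightarrow> 0) at_top"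
  using assms by (auto simp: is_fourier_def fun_diff_def)

lemma is_fourier_isometry:
  assumes "is_fourier f g"
  shows "L2_norm g = L2_norm f"
proof (rule tendsto_unique[of "at_top :: real filter"])
  note D = is_fourierD[OF assms]
  show "((\<lambda>R. L2_norm (fourier_integral R f)) \<longlongrightarrow> L2_norm g) at_top"
    by (rule L2_norm_tendsto[OF fourier_integral_L2(1)[OF D(1)] D(2,3)])
  show "((\<lambda>R. L2_norm (fourier_integral R f)) \<longlongrightarrow> L2_norm f) at_top"
    unfolding fourier_integral_L2(2)[OF D(1)]
    by (rule L2_norm_tendsto[OF cutoff_L2[OF D(1)] D(1) cutoff_tendsto[OF D(1)]])
qed simp

lemma is_fourier_scale:
  assumes "is_fourier f g"
  shows "is_fourier (\<lambda>x. c * f x) (\<lambda>x. c * g x)"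
proof -
  note D = is_fourierD[OF assms]
  have "cutoff R (\<lambda>x. c * f x) = (\<lambda>x. c * cutoff R f x)" for R
    by (rule ext) (simp add: cutoff_def)
  then have "fourier_integral R (\<lambda>x. c * f x) = (\<lambda>\<xi>. c * fourier_integral R f \<xi>)" for R
    by (auto simp: fourier_integral_eq fourier_L1_scale)
  then have "L2_norm (fourier_integral R (\<lambda>x. c * f x) - (\<lambda>x. c * g x))
      = norm c * L2_norm (\<lambda>\<xi>. fourier_integral R f \<xi> - g \<xi>)" for R
    using L2_norm_scale[of c "\<lambda>\<xi>. fourier_integral R f \<xi> - g \<xi>"]
    by (simp add: fun_diff_def right_diff_distrib)
  then show ?thesis
    using D tendsto_mult_right_zero[OF D(3)] by (auto simp: is_fourier_def L2_scale)
qed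

lemma is_fourier_diff:
  assumes "is_fourier f f'" "is_fourier g g'"
  shows "is_fourier (\<lambda>x. f x - g x) (\<lambda>x. f' x - g' x)"
proof -
  note D = is_fourierD[OF assms(1)] is_fourierD[OF assms(2)]
  have "((\<lambda>R. L2_norm (\<lambda>\<xi>. (fourier_integral R f \<xi> - f' \<xi>) + (g' \<xi> - fourier_integral R g \<xi>))) \<longlongrightarrow> 0) at_top"
    using D L2_norm_minus_commute[of g']
    by (intro L2_norm_tendsto_0_add) (auto intro!: always_eventually L2_diff fourier_integral_L2(1))
  also have "(\<lambda>R. L2_norm (\<lambda>\<xi>. (fourier_integral R f \<xi> - f' \<xi>) + (g' \<xi> - fourier_integral R g \<xi>)))
      = (\<lambda>R. L2_norm (fourier_integral R (\<lambda>x. f x - g x) - (\<lambda>x. f' x - g' x)))"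
    using D by (simp add: fun_diff_def fourier_integral_diff algebra_simps)
  finally show ?thesis using D by (simp add: is_fourier_def L2_diff)
qed

text \<open>\<open>FT\<close> and \<open>FT_inv\<close> choose representatives; by this lemma the
  choice of a transform matters only on null sets.\<close>

lemma is_fourier_unique:
  fixes f g :: "real ^ 'd \<Rightarrow> complex"
  assumes "is_fourier f g" "is_fourier f' g'" "AE x in lborel. f x = f' x"
  shows "AE \<xi> in lborel. g \<xi> = g' \<xi>"
proof -
  note D = is_fourierD[OF assms(1)] is_fourierD[OF assms(2)]
  have "L2_norm (\<lambda>\<xi>. g \<xi> - g' \<xi>) = L2_norm (\<lambda>x. f x - f' x)"
    by (rule is_fourier_isometry[OF is_fourier_diff[OF assms(1,2)]])
  also have "\<dots> = L2_norm (\<lambda>x::real ^ 'd. 0)"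
    using assms(3) D by (intro L2_norm_cong_AE L2_measurable L2_diff) auto
  also have "\<dots> = 0" by (simp add: L2_norm_def)
  finally have "AE \<xi> in lborel. g \<xi> - g' \<xi> = 0"
    using D by (intro L2_norm_eq_0_AE L2_diff)
  then show ?thesis by simp
qed

lemma is_fourier_multiplication:
  fixes f g :: "real ^ 'd \<Rightarrow> complex"
  assumes "is_fourier f f'" "is_fourier g g'"
  shows "(LINT x|lborel. f' x * g x) = (LINT x|lborel. f x * g' x)"
proof (rule tendsto_unique[of "at_top :: real filter"])
  note D = is_fourierD[OF assms(1)] is_fourierD[OF assms(2)]
  have ev: "\<forall>\<^sub>F R in at_top. u R \<in> L2" if "\<And>R. u R \<in> L2" for u :: "real \<Rightarrow> real ^ 'd \<Rightarrow> complex"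
    using that by simp
  show "((\<lambda>R. LINT x|lborel. fourier_integral R f x * cutoff R g x) \<longlongrightarrow> (LINT x|lborel. f' x * g x)) at_top"
    by (intro L2_mult_tendsto ev fourier_integral_L2(1) cutoff_L2 cutoff_tendsto D)
  have "((\<lambda>R. LINT x|lborel. cutoff R f x * fourier_integral R g x) \<longlongrightarrow> (LINT x|lborel. f x * g' x)) at_top"
    by (intro L2_mult_tendsto ev fourier_integral_L2(1) cutoff_L2 cutoff_tendsto D)
  then show "((\<lambda>R. LINT x|lborel. fourier_integral R f x * cutoff R g x) \<longlongrightarrow> (LINT x|lborel. f x * g' x)) at_top"
    unfolding fourier_integral_eq using D
    by (simp add: fourier_L1_multiplication cutoff_integrable)
qed simp

text \<open>
  \<open>T (cnj (T f)) = cnj f\<close>: expanding \<open>\<parallel>T u - cnj f\<parallel>\<^sup>2\<close> with \<open>u = cnj (T f)\<close>, the cross term is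
  \<open>\<integral> T u f = \<integral> u T f = \<parallel>T f\<parallel>\<^sup>2 = \<parallel>f\<parallel>\<^sup>2\<close>, so everything cancels.  With \<open>f = cnj h\<close> this makes the
  isometry \<open>T\<close> onto.
\<close>

lemma is_fourier_surj:
  assumes h: "h \<in> L2"
  shows "\<exists>f. is_fourier f h"
proof -
  define f where "f x = cnj (h x)" for x
  have f: "f \<in> L2" unfolding f_def by (rule L2_cnj[OF h])
  obtain g where g: "is_fourier f g" using is_fourier_exists[OF f] by blast
  define u where "u x = cnj (g x)" for x
  have u: "u \<in> L2" unfolding u_def by (rule L2_cnj[OF is_fourierD(2)[OF g]])
  obtain w where w: "is_fourier u w" using is_fourier_exists[OF u] by blast
  have wL: "w \<in> L2" by (rule is_fourierD(2)[OF w])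
  have "L2_norm u = L2_norm g" by (simp add: u_def[abs_def] L2_norm_cnj)
  then have n: "L2_norm w = L2_norm f" "L2_norm g = L2_norm f"
    using is_fourier_isometry[OF w] is_fourier_isometry[OF g] by auto
  have "(LINT x|lborel. w x * f x) = (LINT x|lborel. u x * g x)"
    by (rule is_fourier_multiplication[OF w g])
  also have "\<dots> = (LINT x|lborel. complex_of_real ((norm (g x))\<^sup>2))"
    by (intro Bochner_Integration.integral_cong) (auto simp: u_def complex_norm_square[symmetric] mult.commute)
  also have "\<dots> = of_real ((L2_norm g)\<^sup>2)"
    unfolding L2_norm_power2 by (rule integral_complex_of_real)
  finally have cross: "(LINT x|lborel. w x * f x) = of_real ((L2_norm f)\<^sup>2)" by (simp add: n)
  have i: "integrable lborel (\<lambda>x. w x * f x)" by (rule L2_mult_integrable[OF wL f])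
  have "(L2_norm (\<lambda>x. w x - h x))\<^sup>2 = (LINT x|lborel. (norm (w x))\<^sup>2 + (norm (h x))\<^sup>2 - 2 * Re (w x * f x))"
    unfolding L2_norm_power2
  proof (intro Bochner_Integration.integral_cong refl)
    fix x
    show "(norm (w x - h x))\<^sup>2 = (norm (w x))\<^sup>2 + (norm (h x))\<^sup>2 - 2 * Re (w x * f x)"
      unfolding cmod_power2 by (simp add: f_def power2_eq_square algebra_simps)
  qed
  also have "\<dots> = (L2_norm w)\<^sup>2 + (L2_norm h)\<^sup>2 - 2 * Re (LINT x|lborel. w x * f x)"
    using L2_integrable[OF wL] L2_integrable[OF h] i
    by (simp add: L2_norm_power2 integral_Re del: times_complex.sel)
  also have "\<dots> = 0"
    using n cross by (simp add: f_def[abs_def] L2_norm_cnj)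
  finally have "L2_norm (\<lambda>x. w x - h x) = 0" by simp
  then have AE: "AE x in lborel. w x - h x = 0"
    by (intro L2_norm_eq_0_AE L2_diff wL h)
  have "L2_norm (\<lambda>\<xi>. fourier_integral R u \<xi> - h \<xi>) = L2_norm (\<lambda>\<xi>. fourier_integral R u \<xi> - w \<xi>)" for R
    using AE by (intro L2_norm_cong_AE L2_measurable L2_diff fourier_integral_L2(1) u wL h) auto
  then have "is_fourier u h"
    using is_fourierD(3)[OF w] u h by (simp add: is_fourier_def fun_diff_def)
  then show ?thesis by blast
qed

lemma is_fourier_FT: "f \<in> L2 \<Longrightarrow> is_fourier f (FT f)"
  unfolding FT_def by (rule someI_ex[OF is_fourier_exists])

lemma is_fourier_FT_inv: "h \<in> L2 \<Longrightarrow> is_fourier (FT_inv h) h"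
  unfolding FT_inv_def by (rule someI_ex[OF is_fourier_surj])

lemma FT_L2: "f \<in> L2 \<Longrightarrow> FT f \<in> L2"
  by (rule is_fourierD(2)[OF is_fourier_FT])

lemma FT_inv_L2: "h \<in> L2 \<Longrightarrow> FT_inv h \<in> L2"
  by (rule is_fourierD(1)[OF is_fourier_FT_inv])

lemma FT_FT_inv:
  assumes "h \<in> L2"
  shows "AE \<xi> in lborel. FT (FT_inv h) \<xi> = h \<xi>"
  using is_fourier_unique[OF is_fourier_FT[OF FT_inv_L2[OF assms]] is_fourier_FT_inv[OF assms]] by simp

subsection \<open>The Fourier modes\<close>

text \<open>Derivatives are taken within the half-line, so the equation includes the one-sided
  derivatives at time 0. The values lie in a general normed space because the fundamental modes are
  real while those of the solution are complex.\<close>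

definition mode_ode :: "real \<Rightarrow> real \<Rightarrow> (real \<Rightarrow> 'a::real_normed_vector) \<Rightarrow> (real \<Rightarrow> 'a) \<Rightarrow> bool" where
  "mode_ode \<mu> \<rho> w w' \<longleftrightarrow> (\<forall>t\<ge>0. (w has_vector_derivative w' t) (at t within {0..}) \<and>
     (w' has_vector_derivative - (\<rho>\<^sup>2 + \<mu> / (1 + t)\<^sup>2) *\<^sub>R w t) (at t within {0..}))"

section \<open>Existence of modes, measurable in the frequency\<close>

text \<open>
  The \<open>n\<close>-th term of the Picard series of a mode and its time derivative.  The frequency \<open>\<rho>\<close> is an
  argument because the sum has to be measurable in \<open>\<rho>\<close>.
\<close>

primrec picard :: "real \<Rightarrow> real \<Rightarrow> real \<Rightarrow> nat \<Rightarrow> real \<times> real \<Rightarrow> real \<times> real" where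
  "picard \<mu> a b 0 = (\<lambda>(t, \<rho>). (a + b * t, b))"
| "picard \<mu> a b (Suc n) = (\<lambda>(t, \<rho>).
     let d = \<lambda>s. - (LINT r:{0..s}|lborel. (\<rho>\<^sup>2 + \<mu> / (1 + r)\<^sup>2) * fst (picard \<mu> a b n (r, \<rho>)))
     in (LINT s:{0..t}|lborel. d s, d t))"

lemma borel_measurable_interval_integral:
  fixes g :: "real \<times> real \<Rightarrow> real"
  assumes [measurable]: "g \<in> borel_measurable (borel \<Otimes>\<^sub>M borel)"
  shows "(\<lambda>(t, \<rho>). LINT r:{0..t}|lborel. g (r, \<rho>)) \<in> borel_measurable (borel \<Otimes>\<^sub>M borel)"
proof -
  have "(\<lambda>(t, \<rho>). LINT r:{0..t}|lborel. g (r, \<rho>))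
      = (\<lambda>x. LINT r|lborel. (if 0 \<le> r \<and> r \<le> fst x then g (r, snd x) else 0))"
    unfolding set_lebesgue_integral_def
    by (auto intro!: ext Bochner_Integration.integral_cong simp: indicator_def)
  also have "\<dots> \<in> borel_measurable (borel \<Otimes>\<^sub>M borel)"
    by measurable
  finally show ?thesis .
qed

text \<open>Joint measurability in time and frequency is what the induction needs: the next term
  integrates in time with the frequency as a parameter.\<close>

lemma borel_measurable_picard:
  "picard \<mu> a b n \<in> measurable (borel \<Otimes>\<^sub>M borel) (borel \<Otimes>\<^sub>M borel)"
proof (induction n)
  case 0
  have "(\<lambda>x::real \<times> real. (a + b * fst x, b)) \<in> measurable (borel \<Otimes>\<^sub>M borel) (borel \<Otimes>\<^sub>M borel)"
    by measurable
  then show ?case by (simp add: case_prod_beta')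
next
  case (Suc n)
  note [measurable] = Suc
  let ?d = "\<lambda>x. - (LINT r:{0..fst x}|lborel. ((snd x)\<^sup>2 + \<mu> / (1 + r)\<^sup>2) * fst (picard \<mu> a b n (r, snd x)))"
  have "(\<lambda>(r, \<rho>). (\<rho>\<^sup>2 + \<mu> / (1 + r)\<^sup>2) * fst (picard \<mu> a b n (r, \<rho>))) \<in> borel_measurable (borel \<Otimes>\<^sub>M borel)"
  proof -
    have "(\<lambda>x. ((snd x)\<^sup>2 + \<mu> / (1 + fst x)\<^sup>2) * fst (picard \<mu> a b n (fst x, snd x))) \<in> borel_measurable (borel \<Otimes>\<^sub>M borel)"
      by measurable
    then show ?thesis by (simp add: case_prod_beta')
  qed
  from borel_measurable_interval_integral[OF this]
  have d[measurable]: "?d \<in> borel_measurable (borel \<Otimes>\<^sub>M borel)"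
    by (simp add: case_prod_beta')
  from borel_measurable_interval_integral[OF this]
  have u[measurable]: "(\<lambda>x. LINT s:{0..fst x}|lborel. ?d (s, snd x)) \<in> borel_measurable (borel \<Otimes>\<^sub>M borel)"
    by (simp add: case_prod_beta')
  have "(\<lambda>x. (LINT s:{0..fst x}|lborel. ?d (s, snd x), ?d x)) \<in> measurable (borel \<Otimes>\<^sub>M borel) (borel \<Otimes>\<^sub>M borel)"
    by (intro measurable_Pair u d)
  then show ?case by (simp add: case_prod_beta' Let_def)
qed

lemma set_integral_point:
  fixes g :: "real \<Rightarrow> real"
  shows "(LINT r:{0}|lborel. g r) = 0"
  unfolding set_lebesgue_integral_def
  by (intro integral_eq_zero_AE eventually_mono[OF AE_lborel_singleton[of "0 :: real"]]) simp

lemma set_integral_has_derivative: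
  fixes g :: "real \<Rightarrow> real"
  assumes "continuous_on {0..T} g" "t \<in> {0..T}"
  shows "((\<lambda>t. LINT s:{0..t}|lborel. g s) has_real_derivative g t) (at t within {0..T})"
proof -
  have "((\<lambda>u. integral {0..u} g) has_vector_derivative g t) (at t within {0..T})"
    by (rule integral_has_vector_derivative[OF assms])
  then have "((\<lambda>u. integral {0..u} g) has_real_derivative g t) (at t within {0..T})"
    by (simp add: has_real_derivative_iff_has_vector_derivative)
  moreover have "(LINT s:{0..u}|lborel. g s) = integral {0..u} g" if "u \<in> {0..T}" for u
    using that
    by (intro set_borel_integral_eq_integral(2) borel_integrable_atLeastAtMost')
      (auto intro: continuous_on_subset[OF assms(1)])
  ultimately show ?thesis
    using assms(2) by (subst has_field_derivative_cong_eventually[where g="\<lambda>u. integral {0..u} g"])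
      (auto simp: eventually_at_filter)
qed

lemma real_derivative_bound:
  fixes f \<phi> :: "real \<Rightarrow> real"
  assumes "0 \<le> t"
    and f: "\<And>s. s \<in> {0..t} \<Longrightarrow> (f has_real_derivative f' s) (at s within {0..t})"
    and p: "\<And>s. s \<in> {0..t} \<Longrightarrow> (\<phi> has_real_derivative \<phi>' s) (at s within {0..t})"
    and le: "\<And>s. s \<in> {0..t} \<Longrightarrow> \<bar>f' s\<bar> \<le> \<phi>' s"
  shows "\<bar>f t - f 0\<bar> \<le> \<phi> t - \<phi> 0"
proof (cases "t = 0")
  case False
  then have t: "0 < t" using assms(1) by simp
  have i: "at s within {0..t} = at s" if "0 < s" "s < t" for s
    using that by (intro at_within_interior) auto
  have "norm (f t - f 0) \<le> \<phi> t - \<phi> 0"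
  proof (rule differentiable_bound_general[OF t])
    show "continuous_on {0..t} f" "continuous_on {0..t} \<phi>"
      by (rule DERIV_continuous_on, erule f) (rule DERIV_continuous_on, erule p)
    show "(f has_vector_derivative f' s) (at s)" "(\<phi> has_vector_derivative \<phi>' s) (at s)"
      if "0 < s" "s < t" for s
      using f[of s] p[of s] that i[OF that]
      by (auto simp: has_real_derivative_iff_has_vector_derivative)
    show "norm (f' s) \<le> \<phi>' s" if "0 < s" "s < t" for s
      using le[of s] that by simp
  qed
  then show ?thesis by simp
qed simp

text \<open>Each Picard step integrates twice in time. One integration is carried out exactly and
  produces the factorial, the other is estimated by a factor \<open>T\<close>. The bound for
  \<open>u n\<close> gives that for \<open>d (Suc n)\<close>, which gives that for
  \<open>u (Suc n)\<close>; so the two conclusions are proved together, in alternation.\<close>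

lemma picard_bound:
  fixes \<mu> a b \<rho> T :: real
  assumes \<mu>: "\<mu> \<ge> 0" and T: "T \<ge> 0"
  defines "u \<equiv> \<lambda>n t. fst (picard \<mu> a b n (t, \<rho>))"
    and "d \<equiv> \<lambda>n t. snd (picard \<mu> a b n (t, \<rho>))"
    and "C \<equiv> \<rho>\<^sup>2 + \<mu>" and "K \<equiv> \<bar>a\<bar> + \<bar>b\<bar> * T + \<bar>b\<bar>"
  shows "(\<forall>t\<in>{0..T}. (u n has_real_derivative d n t) (at t within {0..T})) \<and>
    (\<forall>t\<in>{0..T}. \<bar>u n t\<bar> \<le> K * (C * T * t) ^ n / fact n)"
    and "\<forall>t\<in>{0..T}. (d (Suc n) has_real_derivative - ((\<rho>\<^sup>2 + \<mu> / (1 + t)\<^sup>2) * u n t)) (at t within {0..T}) \<and>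
      \<bar>d (Suc n) t\<bar> \<le> C * K * (C * T) ^ n * t ^ Suc n / fact (Suc n)"
proof -
  have C: "C \<ge> 0" using \<mu> by (simp add: C_def)
  have K: "K \<ge> 0" using T by (simp add: K_def)
  let ?P = "\<lambda>n. (\<forall>t\<in>{0..T}. (u n has_real_derivative d n t) (at t within {0..T})) \<and>
    (\<forall>t\<in>{0..T}. \<bar>u n t\<bar> \<le> K * (C * T * t) ^ n / fact n)"
  let ?Q = "\<lambda>n. \<forall>t\<in>{0..T}. (d (Suc n) has_real_derivative - ((\<rho>\<^sup>2 + \<mu> / (1 + t)\<^sup>2) * u n t)) (at t within {0..T}) \<and>
      \<bar>d (Suc n) t\<bar> \<le> C * K * (C * T) ^ n * t ^ Suc n / fact (Suc n)"
  have c: "\<bar>\<rho>\<^sup>2 + \<mu> / (1 + t)\<^sup>2\<bar> \<le> C" if "t \<ge> 0" for t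
  proof -
    have "\<mu> / (1 + t)\<^sup>2 \<le> \<mu> / 1"
      using that \<mu> by (intro divide_left_mono) auto
    then show ?thesis using \<mu> by (simp add: C_def)
  qed
  have dS: "d (Suc n) t = - (LINT r:{0..t}|lborel. (\<rho>\<^sup>2 + \<mu> / (1 + r)\<^sup>2) * u n r)" for n t
    by (simp add: d_def u_def)
  have uS: "u (Suc n) t = (LINT r:{0..t}|lborel. d (Suc n) r)" for n t
    by (simp add: d_def u_def)
  have sub: "(f has_real_derivative D) (at s within {0..t})"
    if "(f has_real_derivative D) (at s within {0..T})" "t \<le> T" for f D s t
    using that by (auto intro: has_field_derivative_subset)
  have PQ: "?Q n" if P: "?P n" for n
  proof
    fix t assume t: "t \<in> {0..T}"
    have un: "continuous_on {0..T} (u n)"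
      using P by (intro DERIV_continuous_on[of _ _ "d n"]) auto
    have der: "(d (Suc n) has_real_derivative - ((\<rho>\<^sup>2 + \<mu> / (1 + t)\<^sup>2) * u n t)) (at t within {0..T})"
      if "t \<in> {0..T}" for t
      unfolding dS[abs_def]
      by (intro DERIV_minus set_integral_has_derivative[where g="\<lambda>t. (\<rho>\<^sup>2 + \<mu> / (1 + t)\<^sup>2) * u n t"] that)
        (auto intro!: continuous_intros un)
    have "\<bar>d (Suc n) t - d (Suc n) 0\<bar> \<le> C * K * (C * T) ^ n * t ^ Suc n / fact (Suc n) - C * K * (C * T) ^ n * 0 ^ Suc n / fact (Suc n)"
    proof (rule real_derivative_bound[where \<phi>="\<lambda>t. C * K * (C * T) ^ n * t ^ Suc n / fact (Suc n)"])
      fix s assume s: "s \<in> {0..t}"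
      show "(d (Suc n) has_real_derivative - ((\<rho>\<^sup>2 + \<mu> / (1 + s)\<^sup>2) * u n s)) (at s within {0..t})"
        using s t by (intro sub[OF der]) auto
      show "((\<lambda>t. C * K * (C * T) ^ n * t ^ Suc n / fact (Suc n)) has_real_derivative
          C * (K * (C * T * s) ^ n / fact n)) (at s within {0..t})"
      proof -
        have "((\<lambda>t. t ^ Suc n / fact (Suc n)) has_real_derivative real (Suc n) * s ^ n / fact (Suc n)) (at s within {0..t})"
          using DERIV_cdivide[OF DERIV_pow[of "Suc n" s "{0..t}"], of "fact (Suc n)"]
          by (simp only: diff_Suc_Suc diff_zero)
        then have "((\<lambda>t. t ^ Suc n / fact (Suc n)) has_real_derivative s ^ n / fact n) (at s within {0..t})"
          by (simp del: power_Suc of_nat_Suc add: fact_Suc)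
        from DERIV_cmult[OF this, of "C * K * (C * T) ^ n"] show ?thesis
          by (simp only: times_divide_eq_right power_mult_distrib mult_ac)
      qed
      show "\<bar>- ((\<rho>\<^sup>2 + \<mu> / (1 + s)\<^sup>2) * u n s)\<bar> \<le> C * (K * (C * T * s) ^ n / fact n)"
        unfolding abs_minus_cancel abs_mult using s t P c[of s] C by (intro mult_mono) auto
    qed (use t in auto)
    moreover have "d (Suc n) 0 = 0"
      unfolding dS by (simp add: set_integral_point)
    ultimately have "\<bar>d (Suc n) t\<bar> \<le> C * K * (C * T) ^ n * t ^ Suc n / fact (Suc n)"
      by simp
    with der[OF t] show "(d (Suc n) has_real_derivative - ((\<rho>\<^sup>2 + \<mu> / (1 + t)\<^sup>2) * u n t)) (at t within {0..T}) \<and>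
      \<bar>d (Suc n) t\<bar> \<le> C * K * (C * T) ^ n * t ^ Suc n / fact (Suc n)" by blast
  qed
  have P: "?P n" for n
  proof (induction n)
    case 0
    have "(u 0 has_real_derivative d 0 t) (at t within {0..T})" for t
      unfolding u_def d_def by (auto intro!: derivative_eq_intros)
    moreover have "\<bar>u 0 t\<bar> \<le> K" if "t \<in> {0..T}" for t
    proof -
      have "\<bar>b * t\<bar> \<le> \<bar>b\<bar> * T" using that by (simp add: abs_mult mult_left_mono)
      then show ?thesis by (simp add: u_def K_def)
    qed
    ultimately show ?case by simp
  next
    case (Suc n)
    note Q = PQ[OF Suc]
    have dn: "continuous_on {0..T} (d (Suc n))"
      using Q by (intro DERIV_continuous_on[of _ _ "\<lambda>t. - ((\<rho>\<^sup>2 + \<mu> / (1 + t)\<^sup>2) * u n t)"]) auto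
    have der: "(u (Suc n) has_real_derivative d (Suc n) t) (at t within {0..T})" if "t \<in> {0..T}" for t
      unfolding uS[abs_def] by (rule set_integral_has_derivative[OF dn that])
    have "\<bar>u (Suc n) t\<bar> \<le> K * (C * T * t) ^ Suc n / fact (Suc n)" if t: "t \<in> {0..T}" for t
    proof -
      \<comment> \<open>The bound of the derivative at the endpoint \<open>t\<close> is used on all
        of \<open>{0..t}\<close>; this integration therefore costs only a factor of at most
        \<open>T\<close>.\<close>
      let ?B = "C * K * (C * T) ^ n * t ^ Suc n / fact (Suc n)"
      have "\<bar>u (Suc n) t - u (Suc n) 0\<bar> \<le> ?B * t - ?B * 0"
      proof (rule real_derivative_bound[where \<phi>="\<lambda>s. ?B * s" and \<phi>'="\<lambda>s. ?B"])
        fix s assume s: "s \<in> {0..t}"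
        show "(u (Suc n) has_real_derivative d (Suc n) s) (at s within {0..t})"
          using s t by (intro sub[OF der]) auto
        show "((\<lambda>s. ?B * s) has_real_derivative ?B) (at s within {0..t})"
          by (auto intro!: derivative_eq_intros)
        have "\<bar>d (Suc n) s\<bar> \<le> C * K * (C * T) ^ n * s ^ Suc n / fact (Suc n)"
          using Q s t by auto
        also have "\<dots> \<le> ?B"
          using s t C K by (intro divide_right_mono mult_left_mono power_mono) auto
        finally show "\<bar>d (Suc n) s\<bar> \<le> ?B" .
      qed (use t in auto)
      moreover have "u (Suc n) 0 = 0"
        unfolding uS by (simp add: set_integral_point)
      ultimately have "\<bar>u (Suc n) t\<bar> \<le> ?B * t" by simp
      also have "\<dots> \<le> ?B * T"
        using t C K by (intro mult_left_mono divide_nonneg_nonneg mult_nonneg_nonneg) auto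
      also have "\<dots> = K * (C * T * t) ^ Suc n / fact (Suc n)"
        by (simp add: power_mult_distrib)
      finally show ?thesis .
    qed
    with der show ?case by blast
  qed
  show "?P n" by (rule P)
  show "?Q n" by (rule PQ[OF P])
qed

lemma at_within_atLeast_Icc: "0 \<le> t \<Longrightarrow> t < T \<Longrightarrow> at t within {0..} = at t within {0..T::real}"
  by (rule at_within_nhd[of t "{..<T}"]) auto

text \<open>The modes are sums of explicit terms, so that measurability in the frequency comes with
  them; existence for each \<rho> separately would not provide it. Termwise differentiation is
  justified on every bounded interval by the factorial bounds.\<close>

lemma mode_ode_exists:
  fixes \<mu> a b :: real
  assumes \<mu>: "\<mu> \<ge> 0"
  shows "\<exists>W W' :: real \<Rightarrow> real \<Rightarrow> real. (\<forall>t. W t \<in> borel_measurable borel \<and> W' t \<in> borel_measurable borel) \<and>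
    (\<forall>\<rho>. mode_ode \<mu> \<rho> (\<lambda>t. W t \<rho>) (\<lambda>t. W' t \<rho>) \<and> W 0 \<rho> = a \<and> W' 0 \<rho> = b)"
proof -
  define u where "u \<rho> n t = fst (picard \<mu> a b n (t, \<rho>))" for \<rho> n t
  define d where "d \<rho> n t = snd (picard \<mu> a b n (t, \<rho>))" for \<rho> n t
  define W where "W t \<rho> = (\<Sum>n. u \<rho> n t)" for t \<rho>
  define W' where "W' t \<rho> = (\<Sum>n. d \<rho> n t)" for t \<rho>
  note [measurable] = borel_measurable_picard
  have meas: "W t \<in> borel_measurable borel \<and> W' t \<in> borel_measurable borel" for t
    unfolding W_def[abs_def] W'_def[abs_def] u_def d_def by measurable
  have d0: "d \<rho> 0 t = b" for \<rho> t by (simp add: d_def)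
  have der: "(\<forall>s\<in>{0..T}. ((\<lambda>t. W t \<rho>) has_real_derivative W' s \<rho>) (at s within {0..T})) \<and>
      (\<forall>s\<in>{0..T}. ((\<lambda>t. W' t \<rho>) has_real_derivative - (\<rho>\<^sup>2 + \<mu> / (1 + s)\<^sup>2) * W s \<rho>) (at s within {0..T}))"
    if T: "T > 0" for \<rho> T
  proof -
    define C where "C = \<rho>\<^sup>2 + \<mu>"
    define K where "K = \<bar>a\<bar> + \<bar>b\<bar> * T + \<bar>b\<bar>"
    have C: "C \<ge> 0" using \<mu> by (simp add: C_def)
    have K: "K \<ge> 0" using T by (simp add: K_def)
    have u: "(u \<rho> n has_real_derivative d \<rho> n t) (at t within {0..T})"
      and ub: "\<bar>u \<rho> n t\<bar> \<le> K * (C * T * t) ^ n / fact n" if "t \<in> {0..T}" for n t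
      using picard_bound(1)[OF \<mu>, where T=T and \<rho>=\<rho> and a=a and b=b and n=n] T that
      by (auto simp: u_def[abs_def] d_def[abs_def] C_def K_def)
    have d: "(d \<rho> (Suc n) has_real_derivative - ((\<rho>\<^sup>2 + \<mu> / (1 + t)\<^sup>2) * u \<rho> n t)) (at t within {0..T})"
      and db: "\<bar>d \<rho> (Suc n) t\<bar> \<le> C * K * (C * T) ^ n * t ^ Suc n / fact (Suc n)" if "t \<in> {0..T}" for n t
      using picard_bound(2)[OF \<mu>, where T=T and \<rho>=\<rho> and a=a and b=b and n=n] T that
      by (auto simp: u_def[abs_def] d_def[abs_def] C_def K_def)
    define M where "M n = (C * T * T) ^ n /\<^sub>R fact n" for n
    have M: "summable M" unfolding M_def by (rule summable_exp_generic)
    have ub': "\<bar>u \<rho> n t\<bar> \<le> K * M n" if "t \<in> {0..T}" for n t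
    proof -
      have "K * (C * T * t) ^ n / fact n \<le> K * (C * T * T) ^ n / fact n"
        using that C K by (intro divide_right_mono mult_left_mono power_mono) auto
      with ub[OF that, of n] show ?thesis by (simp add: M_def divide_inverse mult_ac)
    qed
    have db': "\<bar>d \<rho> (Suc n) t\<bar> \<le> C * K * T * M n" if t: "t \<in> {0..T}" for n t
    proof -
      have "C * K * (C * T) ^ n * t ^ Suc n / fact (Suc n) \<le> C * K * (C * T) ^ n * T ^ Suc n / fact n"
        using t C K by (intro frac_le mult_left_mono power_mono mult_nonneg_nonneg fact_mono) auto
      with db[OF t, of n] show ?thesis by (simp add: M_def divide_inverse power_mult_distrib mult_ac)
    qed
    have c: "\<bar>\<rho>\<^sup>2 + \<mu> / (1 + t)\<^sup>2\<bar> \<le> C" if "t \<in> {0..T}" for t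
    proof -
      have "\<mu> / (1 + t)\<^sup>2 \<le> \<mu> / 1"
        using that \<mu> by (intro divide_left_mono) auto
      then show ?thesis using \<mu> by (simp add: C_def)
    qed
    have ul1: "uniform_limit {0..T} (\<lambda>n x. \<Sum>i<n. d \<rho> (Suc i) x) (\<lambda>x. \<Sum>i. d \<rho> (Suc i) x) sequentially"
      by (rule Weierstrass_m_test[where M="\<lambda>n. C * K * T * M n"]) (use db' M in auto)
    have sd: "summable (\<lambda>i. d \<rho> (Suc i) t)" if "t \<in> {0..T}" for t
      by (rule summable_comparison_test'[OF summable_mult[OF M], of 0 _ "C * K * T"]) (use db' that in auto)
    have su: "summable (\<lambda>i. u \<rho> i t)" if "t \<in> {0..T}" for t
      by (rule summable_comparison_test'[OF summable_mult[OF M], of 0 _ K]) (use ub' that in auto)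
    have ul2: "uniform_limit {0..T} (\<lambda>n x. \<Sum>i<n. - ((\<rho>\<^sup>2 + \<mu> / (1 + x)\<^sup>2) * u \<rho> i x))
        (\<lambda>x. \<Sum>i. - ((\<rho>\<^sup>2 + \<mu> / (1 + x)\<^sup>2) * u \<rho> i x)) sequentially"
    proof (rule Weierstrass_m_test[where M="\<lambda>n. C * (K * M n)"])
      show "norm (- ((\<rho>\<^sup>2 + \<mu> / (1 + x)\<^sup>2) * u \<rho> n x)) \<le> C * (K * M n)" if "x \<in> {0..T}" for n x
        using ub'[OF that, of n] c[OF that] C by (auto simp: abs_mult intro!: mult_mono)
    qed (intro summable_mult M)
    have W': "W' t \<rho> = b + (\<Sum>i. d \<rho> (Suc i) t)" if "t \<in> {0..T}" for t
      unfolding W'_def using suminf_split_head[of "\<lambda>n. d \<rho> n t"] sd[OF that]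
      by (simp add: d0 summable_Suc_iff[of "\<lambda>n. d \<rho> n t"])
    \<comment> \<open>The factorial estimate for \<open>d\<close> starts at \<open>Suc n\<close>, so
      the zeroth term, the constant \<open>b\<close>, receives its own majorant.\<close>
    have ul1': "uniform_limit {0..T} (\<lambda>n x. \<Sum>i<n. d \<rho> i x) (\<lambda>x. W' x \<rho>) sequentially"
      unfolding W'_def
    proof (rule Weierstrass_m_test)
      show "norm (d \<rho> n x) \<le> (case n of 0 \<Rightarrow> \<bar>b\<bar> | Suc n \<Rightarrow> C * K * T * M n)" if "x \<in> {0..T}" for n x
        using db' that by (auto simp: d0 split: nat.split)
      show "summable (\<lambda>n. case n of 0 \<Rightarrow> \<bar>b\<bar> | Suc n \<Rightarrow> C * K * T * M n)"
        by (subst summable_Suc_iff[symmetric]) (simp add: summable_mult M)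
    qed
    have "\<exists>g. \<forall>x\<in>{0..T}. (\<lambda>n. u \<rho> n x) sums g x \<and> (g has_real_derivative W' x \<rho>) (at x within {0..T})"
      by (rule has_field_derivative_series[OF _ u ul1', of 0]) (use su[of 0] T in auto)
    then obtain g where g: "\<And>x. x \<in> {0..T} \<Longrightarrow> (\<lambda>n. u \<rho> n x) sums g x \<and> (g has_real_derivative W' x \<rho>) (at x within {0..T})"
      by blast
    then have gW: "g x = W x \<rho>" if "x \<in> {0..T}" for x
      using that by (simp add: W_def sums_iff)
    have "\<exists>k. \<forall>x\<in>{0..T}. (\<lambda>n. d \<rho> (Suc n) x) sums k x \<and>
        (k has_real_derivative (\<Sum>i. - ((\<rho>\<^sup>2 + \<mu> / (1 + x)\<^sup>2) * u \<rho> i x))) (at x within {0..T})"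
      by (rule has_field_derivative_series[OF _ d ul2, of 0]) (use sd[of 0] T in auto)
    then obtain k where k: "\<And>x. x \<in> {0..T} \<Longrightarrow> (\<lambda>n. d \<rho> (Suc n) x) sums k x \<and>
        (k has_real_derivative (\<Sum>i. - ((\<rho>\<^sup>2 + \<mu> / (1 + x)\<^sup>2) * u \<rho> i x))) (at x within {0..T})"
      by blast
    then have kW: "b + k x = W' x \<rho>" if "x \<in> {0..T}" for x
      using that W' by (simp add: sums_iff)
    have cu: "(\<Sum>i. - ((\<rho>\<^sup>2 + \<mu> / (1 + x)\<^sup>2) * u \<rho> i x)) = - (\<rho>\<^sup>2 + \<mu> / (1 + x)\<^sup>2) * W x \<rho>"
      if "x \<in> {0..T}" for x
      using suminf_mult[OF su[OF that], of "- (\<rho>\<^sup>2 + \<mu> / (1 + x)\<^sup>2)"]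
      by (simp only: W_def mult_minus_left)
    show ?thesis
    proof (intro conjI ballI)
      fix s assume s: "s \<in> {0..T}"
      show "((\<lambda>t. W t \<rho>) has_real_derivative W' s \<rho>) (at s within {0..T})"
        by (rule has_field_derivative_transform_within[of g _ _ _ 1]) (use g s gW in auto)
      have "((\<lambda>x. b + k x) has_real_derivative - (\<rho>\<^sup>2 + \<mu> / (1 + s)\<^sup>2) * W s \<rho>) (at s within {0..T})"
        using k[OF s] unfolding cu[OF s] by (auto intro!: derivative_eq_intros)
      then show "((\<lambda>t. W' t \<rho>) has_real_derivative - (\<rho>\<^sup>2 + \<mu> / (1 + s)\<^sup>2) * W s \<rho>) (at s within {0..T})"
        by (rule has_field_derivative_transform_within[of _ _ _ _ 1]) (use kW s in auto)
    qed
  qed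
  have "mode_ode \<mu> \<rho> (\<lambda>t. W t \<rho>) (\<lambda>t. W' t \<rho>)" for \<rho>
    unfolding mode_ode_def
  proof (intro allI impI)
    fix t :: real assume "t \<ge> 0"
    \<comment> \<open>At the right endpoint of \<open>{0..T}\<close> the derivative would be
      one-sided; with T = t + 1 the two restricted filters at \<open>t\<close> agree.\<close>
    with der[of "t + 1" \<rho>] at_within_atLeast_Icc[of t "t + 1"]
    show "((\<lambda>t. W t \<rho>) has_vector_derivative W' t \<rho>) (at t within {0..}) \<and>
        ((\<lambda>t. W' t \<rho>) has_vector_derivative - (\<rho>\<^sup>2 + \<mu> / (1 + t)\<^sup>2) *\<^sub>R W t \<rho>) (at t within {0..})"
      by (simp add: has_real_derivative_iff_has_vector_derivative)
  qed
  moreover have "W 0 \<rho> = a \<and> W' 0 \<rho> = b" for \<rho>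
  proof -
    have "u \<rho> n 0 = (if n = 0 then a else 0)" for n
      by (cases n) (auto simp: u_def set_integral_point Let_def)
    moreover have "d \<rho> n 0 = (if n = 0 then b else 0)" for n
      by (cases n) (auto simp: d_def set_integral_point Let_def)
    ultimately show ?thesis
      using suminf_finite[of "{0}" "\<lambda>n. u \<rho> n 0"] suminf_finite[of "{0}" "\<lambda>n. d \<rho> n 0"]
      by (simp add: W_def W'_def)
  qed
  ultimately show ?thesis using meas by blast
qed


section \<open>The energy of a mode and its growth at low frequencies\<close>

lemma DERIV_norm_power2:
  fixes f :: "real \<Rightarrow> 'a::real_inner"
  assumes "(f has_vector_derivative f') (at x within S)"
  shows "((\<lambda>x. (norm (f x))\<^sup>2) has_real_derivative 2 * (f x \<bullet> f')) (at x within S)"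
  using bounded_bilinear.has_vector_derivative[OF bounded_bilinear_inner assms assms]
  by (simp add: power2_norm_eq_inner has_real_derivative_iff_has_vector_derivative inner_commute)

lemma mode_odeD:
  assumes "mode_ode \<mu> \<rho> w w'" "t > 0"
  shows "(w has_vector_derivative w' t) (at t)"
    and "(w' has_vector_derivative - (\<rho>\<^sup>2 + \<mu> / (1 + t)\<^sup>2) *\<^sub>R w t) (at t)"
proof -
  have "at t within {0..} = at t" using assms(2) by (intro at_within_interior) auto
  then show "(w has_vector_derivative w' t) (at t)"
    "(w' has_vector_derivative - (\<rho>\<^sup>2 + \<mu> / (1 + t)\<^sup>2) *\<^sub>R w t) (at t)"
    using assms by (auto simp: mode_ode_def dest!: spec[of _ t])
qed

lemma mode_ode_continuous:
  assumes "mode_ode \<mu> \<rho> w w'"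
  shows "continuous_on {0..} w" "continuous_on {0..} w'"
  using assms has_vector_derivative_continuous
  by (auto simp: mode_ode_def continuous_on_eq_continuous_within; blast)+

text \<open>By the equation the mixed terms cancel. What remains is |w|^2 times the time derivative
  of the potential, and the potential does not increase.\<close>

lemma mode_energy_decreasing:
  fixes w :: "real \<Rightarrow> 'a::real_inner"
  assumes ode: "mode_ode \<mu> \<rho> w w'" and "\<mu> \<ge> 0" "0 \<le> s" "s \<le> t"
  shows "(norm (w' t))\<^sup>2 + (\<rho>\<^sup>2 + \<mu> / (1 + t)\<^sup>2) * (norm (w t))\<^sup>2
    \<le> (norm (w' s))\<^sup>2 + (\<rho>\<^sup>2 + \<mu> / (1 + s)\<^sup>2) * (norm (w s))\<^sup>2"
proof -
  let ?c = "\<lambda>t. \<rho>\<^sup>2 + \<mu> / (1 + t)\<^sup>2"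
  let ?E = "\<lambda>t. (norm (w' t))\<^sup>2 + ?c t * (norm (w t))\<^sup>2"
  have "?E t \<le> ?E s"
  proof (rule DERIV_nonpos_imp_decreasing_open[OF \<open>s \<le> t\<close>])
    fix x assume x: "s < x" "x < t"
    then have x0: "x > 0" using \<open>0 \<le> s\<close> by simp
    define c' where "c' = - (\<mu> * (2 * (1 + x))) / ((1 + x)\<^sup>2 * (1 + x)\<^sup>2)"
    have c: "(?c has_real_derivative c') (at x)"
      unfolding c'_def using x0 by (auto intro!: derivative_eq_intros)
    have "(?E has_real_derivative (2 * (w' x \<bullet> (- ?c x *\<^sub>R w x)) +
        (c' * (norm (w x))\<^sup>2 + 2 * (w x \<bullet> w' x) * ?c x))) (at x)"
      by (intro DERIV_add DERIV_mult c DERIV_norm_power2 mode_odeD[OF ode x0])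
    moreover have "2 * (w' x \<bullet> (- ?c x *\<^sub>R w x)) +
        (c' * (norm (w x))\<^sup>2 + 2 * (w x \<bullet> w' x) * ?c x) = c' * (norm (w x))\<^sup>2"
      by (simp add: inner_commute[of "w x"] algebra_simps)
    moreover have "\<dots> \<le> 0"
    proof (rule mult_nonpos_nonneg)
      have "0 \<le> \<mu> * (2 * (1 + x)) / ((1 + x)\<^sup>2 * (1 + x)\<^sup>2)"
        using \<open>\<mu> \<ge> 0\<close> x0 by (intro divide_nonneg_nonneg mult_nonneg_nonneg) auto
      then show "c' \<le> 0" by (simp add: c'_def)
    qed simp
    ultimately have "(?E has_real_derivative c' * (norm (w x))\<^sup>2) (at x) \<and> c' * (norm (w x))\<^sup>2 \<le> 0"
      by (simp only: simp_thms)
    then show "\<exists>y. (?E has_real_derivative y) (at x) \<and> y \<le> 0" by (rule exI)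
  next
    have sub: "{s..t} \<subseteq> {0..}" using \<open>0 \<le> s\<close> by auto
    show "continuous_on {s..t} ?E"
      using \<open>0 \<le> s\<close> continuous_on_subset[OF mode_ode_continuous(1)[OF ode] sub]
        continuous_on_subset[OF mode_ode_continuous(2)[OF ode] sub]
      by (intro continuous_intros) auto
  qed
  then show ?thesis .
qed

text \<open>In the variable s = ln (1 + t), a mode of zero frequency multiplied by exp (- s / 2)
  solves y'' = (1/4 - \<mu>) y, with exponents \<plusminus>\<nu>. This is the larger of the two
  growth rates; the double root at \<open>\<mu> = 1/4\<close> brings in a linear solution.\<close>

definition growth :: "real \<Rightarrow> real \<Rightarrow> real" where
  "growth \<mu> s = (if \<mu> = 1/4 then 1 + s else exp (Re (nu \<mu>) * s))"

lemma Re_nu: "Re (nu \<mu>) = (if \<mu> < 1/4 then sqrt (1/4 - \<mu>) else 0)"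
proof (cases "\<mu> < 1/4")
  case True
  have "sqrt (1 - 4 * \<mu>) = sqrt (4 * (1/4 - \<mu>))" by simp
  also have "\<dots> = 2 * sqrt (1/4 - \<mu>)" by (simp only: real_sqrt_mult real_sqrt_four)
  finally show ?thesis using True by (simp add: nu_def)
qed (auto simp: nu_def)

text \<open>
  If \<open>w\<close> is a mode, then \<open>y s = exp (- s / 2) * w (exp s - 1)\<close> satisfies
  \<open>y'' = (1/4 - \<mu> - \<rho>\<^sup>2 exp (2 s)) y\<close>, and \<open>\<rho>\<^sup>2 exp (2 s)\<close> has bounded integral as long as \<open>\<rho> exp s \<le> 1\<close>.  For \<open>\<mu> \<noteq> 1/4\<close>, Gronwall's inequality applies to
  \<open>\<bar>y'\<bar>\<^sup>2 + \<bar>1/4 - \<mu>\<bar> \<bar>y\<bar>\<^sup>2\<close>; for \<open>\<mu> = 1/4\<close> one maximises \<open>\<bar>y\<bar> / (1 + s)\<close> instead.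
\<close>

lemma low_frequency_gronwall:
  fixes y :: "real \<Rightarrow> 'a::real_inner"
  assumes q: "q \<noteq> 0" and S: "0 \<le> S" and \<rho>: "0 \<le> \<rho>" "\<rho> * exp S \<le> 1"
    and cont: "continuous_on {0..S} y" "continuous_on {0..S} y'"
    and y: "\<And>s. 0 < s \<Longrightarrow> s < S \<Longrightarrow> (y has_vector_derivative y' s) (at s)"
    and y': "\<And>s. 0 < s \<Longrightarrow> s < S \<Longrightarrow> (y' has_vector_derivative (q - \<rho>\<^sup>2 * exp (2 * s)) *\<^sub>R y s) (at s)"
  defines "\<kappa> \<equiv> sqrt \<bar>q\<bar>" and "n \<equiv> (if q > 0 then sqrt q else 0)"
  shows "(norm (y' S))\<^sup>2 + \<kappa>\<^sup>2 * (norm (y S))\<^sup>2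
    \<le> ((norm (y' 0))\<^sup>2 + \<kappa>\<^sup>2 * (norm (y 0))\<^sup>2) * (exp (2 * n * S) * exp (1 / (2 * \<kappa>)))"
proof -
  have \<kappa>: "\<kappa> > 0" using q by (simp add: \<kappa>_def)
  \<comment> \<open>For \<open>q > 0\<close> both sides equal 2 \<kappa>^2, for \<open>q < 0\<close>
    both vanish: only a positive \<open>q\<close> causes exponential growth.\<close>
  have qn: "q + \<kappa>\<^sup>2 = 2 * \<kappa> * n" and n0: "n \<ge> 0"
    using q by (auto simp: \<kappa>_def n_def abs_if mult.assoc)
  define E where "E s = (norm (y' s))\<^sup>2 + \<kappa>\<^sup>2 * (norm (y s))\<^sup>2" for s
  have E0: "E s \<ge> 0" for s by (simp add: E_def)
  \<comment> \<open>A primitive of 2 n + \<rho>^2 exp (2 s) / \<kappa>, which bounds the logarithmic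
    derivative of \<open>E\<close>; exp (- A) serves as integrating factor.\<close>
  define A where "A s = 2 * n * s + \<rho>\<^sup>2 * exp (2 * s) / (2 * \<kappa>)" for s
  have "E S * exp (- A S) \<le> E 0 * exp (- A 0)"
  proof (rule DERIV_nonpos_imp_decreasing_open[OF S])
    show "continuous_on {0..S} (\<lambda>s. E s * exp (- A s))"
      unfolding E_def A_def using \<kappa> by (intro continuous_intros cont) auto
    fix s assume s: "0 < s" "s < S"
    let ?k = "\<rho>\<^sup>2 * exp (2 * s)"
    let ?D = "2 * (y' s \<bullet> ((q - ?k) *\<^sub>R y s)) + \<kappa>\<^sup>2 * (2 * (y s \<bullet> y' s))"
    have "(E has_real_derivative ?D) (at s)"
      unfolding E_def by (intro DERIV_add DERIV_cmult DERIV_norm_power2 y y' s)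
    moreover have "(A has_real_derivative 2 * n + ?k / \<kappa>) (at s)"
      unfolding A_def using \<kappa> by (auto intro!: derivative_eq_intros simp: field_simps)
    ultimately have "((\<lambda>s. E s * exp (- A s)) has_real_derivative
        ?D * exp (- A s) + exp (- A s) * (- (2 * n + ?k / \<kappa>)) * E s) (at s)"
      by (intro DERIV_mult DERIV_fun_exp DERIV_minus)
    moreover have "?D * exp (- A s) + exp (- A s) * (- (2 * n + ?k / \<kappa>)) * E s \<le> 0"
    proof -
      have "?D = 2 * (2 * \<kappa> * n - ?k) * (y' s \<bullet> y s)"
        unfolding qn[symmetric] by (simp add: inner_commute[of "y s"] algebra_simps)
      also have "\<dots> \<le> 2 * ((2 * \<kappa> * n + ?k) * (norm (y' s) * norm (y s)))"
      proof -
        have "(2 * \<kappa> * n - ?k) * (y' s \<bullet> y s) \<le> \<bar>2 * \<kappa> * n - ?k\<bar> * \<bar>y' s \<bullet> y s\<bar>"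
          by (metis abs_ge_self abs_mult)
        also have "\<dots> \<le> (2 * \<kappa> * n + ?k) * (norm (y' s) * norm (y s))"
          using \<kappa> n0 by (intro mult_mono Cauchy_Schwarz_ineq2) (auto simp: abs_le_iff)
        finally have "2 * ((2 * \<kappa> * n - ?k) * (y' s \<bullet> y s))
            \<le> 2 * ((2 * \<kappa> * n + ?k) * (norm (y' s) * norm (y s)))"
          by (rule mult_left_mono) simp
        then show ?thesis by (simp only: mult.assoc)
      qed
      also have "\<dots> = (2 * n + ?k / \<kappa>) * (2 * norm (y' s) * (\<kappa> * norm (y s)))"
        using \<kappa> by (simp add: field_simps)
      also have "\<dots> \<le> (2 * n + ?k / \<kappa>) * E s"
        unfolding E_def power_mult_distrib[symmetric]
        using \<kappa> n0 by (intro mult_left_mono sum_squares_bound) auto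
      finally have "(?D - (2 * n + ?k / \<kappa>) * E s) * exp (- A s) \<le> 0"
        by (intro mult_nonpos_nonneg) auto
      then show ?thesis by (simp add: algebra_simps)
    qed
    ultimately show "\<exists>z. ((\<lambda>s. E s * exp (- A s)) has_real_derivative z) (at s) \<and> z \<le> 0" by blast
  qed
  then have "E S * exp (- A S) * exp (A S) \<le> E 0 * exp (- A 0) * exp (A S)"
    by (intro mult_right_mono) auto
  then have "E S \<le> E 0 * exp (A S - A 0)"
    by (simp add: mult.assoc flip: exp_add)
  also have "\<dots> \<le> E 0 * exp (2 * n * S + 1 / (2 * \<kappa>))"
  proof (intro mult_left_mono E0, subst exp_le_cancel_iff)
    have "(\<rho> * exp S)\<^sup>2 \<le> 1" using \<rho> by (intro power_le_one) auto
    then have "\<rho>\<^sup>2 * exp (2 * S) \<le> 1" by (simp add: power_mult_distrib exp_double)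
    then have "(\<rho>\<^sup>2 * exp (2 * S) - \<rho>\<^sup>2) / (2 * \<kappa>) \<le> 1 / (2 * \<kappa>)"
      using \<kappa> by (intro divide_right_mono) (auto intro: order_trans[of _ "\<rho>\<^sup>2 * exp (2 * S)"])
    then show "A S - A 0 \<le> 2 * n * S + 1 / (2 * \<kappa>)"
      by (simp add: A_def diff_divide_distrib)
  qed
  finally show ?thesis by (simp add: E_def exp_add)
qed

text \<open>Here the energy used for \<open>\<mu> \<noteq> 1/4\<close> would have \<kappa> = 0 and
  lose control of \<open>y\<close>. The maximum \<open>M\<close> of |y| / (1 + s) is inserted into
  the equation instead and absorbed after two integrations.\<close>

lemma low_frequency_critical:
  fixes y :: "real \<Rightarrow> 'a::real_inner"
  assumes S: "0 \<le> S" and \<rho>: "0 \<le> \<rho>" "\<rho> * exp S \<le> 1"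
    and cont: "continuous_on {0..S} y" "continuous_on {0..S} y'"
    and y: "\<And>s. 0 < s \<Longrightarrow> s < S \<Longrightarrow> (y has_vector_derivative y' s) (at s)"
    and y': "\<And>s. 0 < s \<Longrightarrow> s < S \<Longrightarrow> (y' has_vector_derivative - (\<rho>\<^sup>2 * exp (2 * s)) *\<^sub>R y s) (at s)"
  shows "norm (y S) \<le> 2 * (norm (y 0) + norm (y' 0)) * (1 + S)"
    and "norm (y' S) \<le> 2 * (norm (y 0) + norm (y' 0)) * (1 + S)"
proof -
  let ?D = "norm (y 0) + norm (y' 0)"
  let ?k = "\<lambda>s. \<rho>\<^sup>2 * exp (2 * s)"
  have k1: "?k s \<le> 1" if "s \<le> S" for s
  proof -
    have "(\<rho> * exp s)\<^sup>2 \<le> (\<rho> * exp S)\<^sup>2"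
      using \<rho> that by (intro power_mono mult_left_mono) auto
    also have "\<dots> \<le> 1" using \<rho> by (intro power_le_one) auto
    finally show ?thesis by (simp add: power_mult_distrib exp_double)
  qed
  have contg: "continuous_on {0..S} (\<lambda>s. norm (y s) / (1 + s))"
    by (intro continuous_intros cont) auto
  obtain x where x: "x \<in> {0..S}" and max: "\<And>s. s \<in> {0..S} \<Longrightarrow> norm (y s) / (1 + s) \<le> norm (y x) / (1 + x)"
    using continuous_attains_sup[OF compact_Icc _ contg] S by auto
  define M where "M = norm (y x) / (1 + x)"
  have M0: "M \<ge> 0" using x by (simp add: M_def)
  have M: "norm (y s) \<le> M * (1 + s)" if "s \<in> {0..S}" for s
    using max[OF that] that by (simp add: M_def field_simps)
  \<comment> \<open>The factor 1 + s in the bound of \<open>y\<close> is replaced by its endpoint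
    value 1 + t, so that only exp (2 s) has to be integrated.\<close>
  have d': "norm (y' t) \<le> norm (y' 0) + M * (1 + t) * ?k t / 2" if t: "t \<in> {0..S}" for t
  proof (cases "t = 0")
    case False
    have "norm (y' t - y' 0) \<le> M * (1 + t) * ?k t / 2 - M * (1 + t) * ?k 0 / 2"
    proof (rule differentiable_bound_general[where f'="\<lambda>s. - ?k s *\<^sub>R y s" and \<phi>'="\<lambda>s. M * (1 + t) * ?k s"])
      show "continuous_on {0..t} y'" using t by (intro continuous_on_subset[OF cont(2)]) auto
      show "((\<lambda>s. M * (1 + t) * ?k s / 2) has_vector_derivative M * (1 + t) * ?k s) (at s)" for s
        unfolding has_real_derivative_iff_has_vector_derivative[symmetric]
        by (auto intro!: derivative_eq_intros)
      fix s assume s: "0 < s" "s < t"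
      show "(y' has_vector_derivative - ?k s *\<^sub>R y s) (at s)" using s t by (intro y') auto
      have "norm (y s) \<le> M * (1 + t)"
        using M[of s] s t M0 mult_left_mono[of "1 + s" "1 + t" M] by auto
      then have "?k s * norm (y s) \<le> ?k s * (M * (1 + t))" by (intro mult_left_mono) auto
      then show "norm (- ?k s *\<^sub>R y s) \<le> M * (1 + t) * ?k s" by (simp add: mult_ac)
    qed (use t False in \<open>auto intro!: continuous_intros\<close>)
    moreover have "0 \<le> M * (1 + t) * ?k 0 / 2" using M0 t by simp
    ultimately show ?thesis using norm_triangle_sub[of "y' t" "y' 0"] by linarith
  qed (use M0 in simp)
  \<comment> \<open>Integrating exp (2 s) twice gives the factor 1/4, and \<open>?k x\<close> is at
    most 1. So the term with \<open>M\<close> is at most a quarter of the left-hand side, which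
    equals M (1 + x), and can be absorbed.\<close>
  have "norm (y x) \<le> norm (y 0) + norm (y' 0) * x + M * (1 + x) * ?k x / 4"
  proof (cases "x = 0")
    case False
    let ?p = "\<lambda>s. norm (y' 0) * s + M * (1 + x) * ?k s / 4"
    have "norm (y x - y 0) \<le> ?p x - ?p 0"
    proof (rule differentiable_bound_general[where f'=y' and \<phi>'="\<lambda>s. norm (y' 0) + M * (1 + x) * ?k s / 2"])
      show "continuous_on {0..x} y" using x by (intro continuous_on_subset[OF cont(1)]) auto
      show "(?p has_vector_derivative norm (y' 0) + M * (1 + x) * ?k s / 2) (at s)" for s
        unfolding has_real_derivative_iff_has_vector_derivative[symmetric]
        by (auto intro!: derivative_eq_intros)
      fix s assume s: "0 < s" "s < x"
      show "(y has_vector_derivative y' s) (at s)" using s x by (intro y) auto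
      have "M * (1 + s) * ?k s / 2 \<le> M * (1 + x) * ?k s / 2"
        using s M0 by (intro divide_right_mono mult_right_mono mult_left_mono) auto
      then show "norm (y' s) \<le> norm (y' 0) + M * (1 + x) * ?k s / 2"
        using d'[of s] s x by auto
    qed (use x False in \<open>auto intro!: continuous_intros\<close>)
    moreover have "0 \<le> M * (1 + x) * ?k 0 / 4" using M0 x by simp
    ultimately show ?thesis using norm_triangle_sub[of "y x" "y 0"] by simp
  qed (use M0 in simp)
  also have "\<dots> \<le> ?D * (1 + x) + M * (1 + x) / 4"
  proof -
    have "M * (1 + x) * ?k x \<le> M * (1 + x) * 1"
      using k1[of x] x M0 by (intro mult_left_mono) auto
    moreover have "norm (y 0) + norm (y' 0) * x \<le> ?D * (1 + x)"
      using x by (simp add: algebra_simps)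
    ultimately show ?thesis by linarith
  qed
  also have "norm (y x) = M * (1 + x)" using x by (simp add: M_def)
  finally have "M * (1 + x) \<le> (?D + M / 4) * (1 + x)" by (simp add: algebra_simps)
  then have "M \<le> ?D + M / 4" using x by (simp add: mult_le_cancel_right)
  then have MD0: "M \<le> 4 / 3 * ?D" by simp
  also have "\<dots> \<le> 2 * ?D" by (rule mult_right_mono) auto
  finally have MD: "M \<le> 2 * ?D" .
  have MD': "norm (y' 0) + M / 2 \<le> 2 * ?D"
    using MD by (auto intro: order_trans)
  have SS: "S \<in> {0..S}" using S by simp
  have "norm (y S) \<le> M * (1 + S)" by (rule M[OF SS])
  also have "\<dots> \<le> 2 * ?D * (1 + S)"
    using MD S by (intro mult_right_mono) auto
  finally show "norm (y S) \<le> 2 * ?D * (1 + S)" .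
  have "norm (y' S) \<le> norm (y' 0) + M * (1 + S) * ?k S / 2" by (rule d'[OF SS])
  also have "\<dots> \<le> norm (y' 0) * (1 + S) + M * (1 + S) * 1 / 2"
    using k1[of S] S M0 by (intro add_mono divide_right_mono mult_left_mono) (auto simp: mult_le_cancel_left1)
  also have "\<dots> = (norm (y' 0) + M / 2) * (1 + S)" by (simp add: algebra_simps)
  also have "\<dots> \<le> 2 * ?D * (1 + S)"
    using MD' S by (intro mult_right_mono) auto
  finally show "norm (y' S) \<le> 2 * ?D * (1 + S)" .
qed

text \<open>The constant depends on \<mu> alone. Uniformity in \<open>\<rho>\<close> and
  \<open>S\<close> matters because the bound is later used up to the frequency-dependent time S = ln
  (1 / \<rho>).\<close>

lemma low_frequency_bound:
  fixes \<mu> :: real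
  assumes \<mu>: "\<mu> > 0"
  shows "\<exists>C\<ge>0. \<forall>\<rho> S. \<forall>y y' :: real \<Rightarrow> complex. 0 \<le> S \<longrightarrow> 0 \<le> \<rho> \<longrightarrow> \<rho> * exp S \<le> 1 \<longrightarrow>
    continuous_on {0..S} y \<longrightarrow> continuous_on {0..S} y' \<longrightarrow>
    (\<forall>s. 0 < s \<longrightarrow> s < S \<longrightarrow> (y has_vector_derivative y' s) (at s)) \<longrightarrow>
    (\<forall>s. 0 < s \<longrightarrow> s < S \<longrightarrow> (y' has_vector_derivative (1/4 - \<mu> - \<rho>\<^sup>2 * exp (2 * s)) *\<^sub>R y s) (at s)) \<longrightarrow>
    norm (y S) \<le> C * growth \<mu> S * (norm (y 0) + norm (y' 0)) \<and>
    norm (y' S) \<le> C * growth \<mu> S * (norm (y 0) + norm (y' 0))"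
proof (cases "\<mu> = 1/4")
  case True
  show ?thesis
  proof (rule exI[of _ 2], intro conjI allI impI)
    fix \<rho> S :: real and y y' :: "real \<Rightarrow> complex"
    assume a: "0 \<le> S" "0 \<le> \<rho>" "\<rho> * exp S \<le> 1" "continuous_on {0..S} y" "continuous_on {0..S} y'"
      "\<forall>s. 0 < s \<longrightarrow> s < S \<longrightarrow> (y has_vector_derivative y' s) (at s)"
      "\<forall>s. 0 < s \<longrightarrow> s < S \<longrightarrow> (y' has_vector_derivative (1/4 - \<mu> - \<rho>\<^sup>2 * exp (2 * s)) *\<^sub>R y s) (at s)"
    have "norm (y S) \<le> 2 * (norm (y 0) + norm (y' 0)) * (1 + S) \<and>
        norm (y' S) \<le> 2 * (norm (y 0) + norm (y' 0)) * (1 + S)"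
      using low_frequency_critical[of S \<rho> y y'] a True by simp
    moreover have "2 * growth \<mu> S * (norm (y 0) + norm (y' 0)) = 2 * (norm (y 0) + norm (y' 0)) * (1 + S)"
      using True by (simp add: growth_def algebra_simps)
    ultimately show "norm (y S) \<le> 2 * growth \<mu> S * (norm (y 0) + norm (y' 0))"
      "norm (y' S) \<le> 2 * growth \<mu> S * (norm (y 0) + norm (y' 0))"
      by simp_all
  qed simp
next
  case False
  define q where "q = 1/4 - \<mu>"
  define \<kappa> where "\<kappa> = sqrt \<bar>q\<bar>"
  define n where "n = (if q > 0 then sqrt q else 0)"
  have q: "q \<noteq> 0" using False by (simp add: q_def)
  have \<kappa>: "\<kappa> > 0" using q by (simp add: \<kappa>_def)
  have g: "growth \<mu> S = exp (n * S)" for S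
    using False by (simp add: growth_def Re_nu n_def q_def)
  \<comment> \<open>\<open>B\<close> is the square root of the Gronwall factor exp (1 / (2
    \<kappa>)). In \<open>C\<close>, the factor 1 + \<kappa> bounds the initial energy by the data,
    and 1 + 1 / \<kappa> recovers both norms from the final energy.\<close>
  define B where "B = exp (1 / (4 * \<kappa>))"
  define C where "C = (1 + 1 / \<kappa>) * ((1 + \<kappa>) * B)"
  show ?thesis
  proof (intro exI[of _ C] conjI allI impI)
    show "C \<ge> 0" using \<kappa> by (simp add: C_def B_def)
    fix \<rho> S :: real and y y' :: "real \<Rightarrow> complex"
    assume a: "0 \<le> S" "0 \<le> \<rho>" "\<rho> * exp S \<le> 1" "continuous_on {0..S} y" "continuous_on {0..S} y'"
      "\<forall>s. 0 < s \<longrightarrow> s < S \<longrightarrow> (y has_vector_derivative y' s) (at s)"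
      "\<forall>s. 0 < s \<longrightarrow> s < S \<longrightarrow> (y' has_vector_derivative (1/4 - \<mu> - \<rho>\<^sup>2 * exp (2 * s)) *\<^sub>R y s) (at s)"
    let ?D = "norm (y 0) + norm (y' 0)"
    let ?X = "(1 + \<kappa>) * ?D * (exp (n * S) * B)"
    have X0: "?X \<ge> 0" using \<kappa> by (simp add: B_def)
    have "(norm (y' S))\<^sup>2 + \<kappa>\<^sup>2 * (norm (y S))\<^sup>2
        \<le> ((norm (y' 0))\<^sup>2 + \<kappa>\<^sup>2 * (norm (y 0))\<^sup>2) * (exp (2 * n * S) * exp (1 / (2 * \<kappa>)))"
      using low_frequency_gronwall[OF q a(1-5)] a(6,7) unfolding q_def[symmetric] \<kappa>_def n_def by blast
    also have "\<dots> \<le> ((1 + \<kappa>) * ?D)\<^sup>2 * (exp (2 * n * S) * exp (1 / (2 * \<kappa>)))"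
    proof (intro mult_right_mono)
      have "(norm (y' 0))\<^sup>2 + (\<kappa> * norm (y 0))\<^sup>2 \<le> (norm (y' 0) + \<kappa> * norm (y 0))\<^sup>2"
        using \<kappa> by (simp add: power2_sum)
      also have "\<dots> \<le> ((1 + \<kappa>) * ?D)\<^sup>2"
        using \<kappa> by (intro power_mono) (auto simp: algebra_simps)
      finally show "(norm (y' 0))\<^sup>2 + \<kappa>\<^sup>2 * (norm (y 0))\<^sup>2 \<le> ((1 + \<kappa>) * ?D)\<^sup>2"
        by (simp add: power_mult_distrib)
    qed auto
    also have "\<dots> = ?X\<^sup>2"
      using \<kappa> by (simp add: power_mult_distrib B_def exp_double[symmetric])
    finally have le: "(norm (y' S))\<^sup>2 + (\<kappa> * norm (y S))\<^sup>2 \<le> ?X\<^sup>2"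
      by (simp add: power_mult_distrib)
    have CX: "C * growth \<mu> S * ?D = (1 + 1 / \<kappa>) * ?X"
      by (simp add: C_def g mult_ac)
    have "norm (y' S) \<le> ?X"
      using le zero_le_power2[of "\<kappa> * norm (y S)"] by (intro power2_le_imp_le[OF _ X0]) linarith
    also have "\<dots> \<le> (1 + 1 / \<kappa>) * ?X"
      using X0 \<kappa> by (intro mult_right_mono[of 1 "1 + 1 / \<kappa>" ?X, simplified mult_1]) auto
    finally show "norm (y' S) \<le> C * growth \<mu> S * ?D" unfolding CX .
    have "\<kappa> * norm (y S) \<le> ?X"
      using le zero_le_power2[of "norm (y' S)"] by (intro power2_le_imp_le[OF _ X0]) linarith
    then have "norm (y S) \<le> 1 / \<kappa> * ?X" using \<kappa> by (simp add: field_simps)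
    also have "\<dots> \<le> (1 + 1 / \<kappa>) * ?X"
      using X0 by (intro mult_right_mono) auto
    finally show "norm (y S) \<le> C * growth \<mu> S * ?D" unfolding CX .
  qed
qed


text \<open>With \<tau> = 1 + t this is the order of the low-frequency bound for w' and for w / (1 +
  t). Its reciprocal is the weight of the theorem, see \<open>decay_inverse\<close>.\<close>

definition decay :: "real \<Rightarrow> real \<Rightarrow> real" where
  "decay \<mu> \<tau> = growth \<mu> (ln \<tau>) / sqrt \<tau>"

lemma growth_mono:
  assumes "0 \<le> s" "s \<le> r"
  shows "1 \<le> growth \<mu> s" "growth \<mu> s \<le> growth \<mu> r"
proof -
  have "Re (nu \<mu>) \<ge> 0" by (simp add: Re_nu)
  then show "1 \<le> growth \<mu> s" "growth \<mu> s \<le> growth \<mu> r"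
    using assms by (auto simp: growth_def intro!: mult_left_mono)
qed

lemma decay_pos: "\<tau> \<ge> 1 \<Longrightarrow> decay \<mu> \<tau> > 0"
  using growth_mono(1)[of "ln \<tau>" "ln \<tau>" \<mu>] by (auto simp: decay_def)

lemma decay_one [simp]: "decay \<mu> 1 = 1"
  by (simp add: decay_def growth_def)

lemma mult_decay:
  assumes "\<tau> \<ge> 1"
  shows "\<tau> * decay \<mu> \<tau> = sqrt \<tau> * growth \<mu> (ln \<tau>)"
proof -
  have "\<tau> * decay \<mu> \<tau> = \<tau> / sqrt \<tau> * growth \<mu> (ln \<tau>)" by (simp add: decay_def)
  then show ?thesis using assms by (simp only: real_div_sqrt)
qed

lemma sqrt_le_mult_decay: "\<tau> \<ge> 1 \<Longrightarrow> sqrt \<tau> \<le> \<tau> * decay \<mu> \<tau>"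
  using growth_mono(1)[of "ln \<tau>" "ln \<tau>" \<mu>] by (simp add: mult_decay)

text \<open>Turns the error \<open>decay \<mu> x / (\<rho> * \<tau>)\<close> of a mode handed over
  at \<open>x\<close> = 1 / \<rho> into one of order \<open>decay \<mu> \<tau>\<close>.\<close>

lemma mult_decay_mono:
  assumes "1 \<le> x" "x \<le> \<tau>"
  shows "x * decay \<mu> x \<le> \<tau> * decay \<mu> \<tau>"
proof -
  have "sqrt x * growth \<mu> (ln x) \<le> sqrt \<tau> * growth \<mu> (ln \<tau>)"
    using assms growth_mono[of "ln x" "ln \<tau>" \<mu>] by (intro mult_mono) auto
  then show ?thesis using assms by (simp add: mult_decay)
qed

text \<open>For \<open>\<mu> = 1/4\<close> the function (1 + ln \<tau>) / sqrt \<tau> still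
  increases up to \<tau> = exp 1, so it is decreasing only up to a constant, and 2 suffices.
  Otherwise \<mu> > 0 gives Re \<nu> \<le> 1/2, and the function does not increase.\<close>

lemma decay_le:
  assumes \<mu>: "\<mu> > 0" and "1 \<le> \<tau>" "\<tau> \<le> x"
  shows "decay \<mu> x \<le> 2 * decay \<mu> \<tau>"
proof -
  have sq: "growth \<mu> (ln z) / sqrt z = growth \<mu> (ln z) * exp (- ln z / 2)" if "z \<ge> 1" for z
  proof -
    have "exp (- ln z / 2) = exp (- ln (sqrt z))" using that by (simp add: ln_sqrt)
    also have "\<dots> = 1 / sqrt z" using that by (simp add: exp_minus inverse_eq_divide)
    finally show ?thesis by simp
  qed
  define s r where "s = ln \<tau>" and "r = ln x"
  have sr: "0 \<le> s" "s \<le> r" using assms by (auto simp: s_def r_def)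
  have "growth \<mu> r * exp (- r / 2) \<le> 2 * (growth \<mu> s * exp (- s / 2))"
  proof (cases "\<mu> = 1/4")
    case True
    have "1 + r \<le> (1 + s) * (1 + (r - s))"
    proof -
      have "0 \<le> s * (r - s)" using sr by (intro mult_nonneg_nonneg) auto
      then show ?thesis by (simp add: algebra_simps)
    qed
    also have "\<dots> \<le> (1 + s) * (2 * exp ((r - s) / 2))"
    proof (intro mult_left_mono)
      define q where "q = (r - s) / 2"
      have "r - s = 2 * q" by (simp add: q_def)
      moreover have "1 + q \<le> exp q" by (rule exp_ge_add_one_self)
      ultimately have "1 + (r - s) \<le> 2 * exp q" by linarith
      then show "1 + (r - s) \<le> 2 * exp ((r - s) / 2)" by (simp only: q_def)
    qed (use sr in auto)
    finally have "(1 + r) * exp (- r / 2) \<le> (1 + s) * (2 * exp ((r - s) / 2)) * exp (- r / 2)"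
      by (rule mult_right_mono) simp
    also have "\<dots> = 2 * ((1 + s) * (exp ((r - s) / 2) * exp (- r / 2)))" by simp
    also have "exp ((r - s) / 2) * exp (- r / 2) = exp (- s / 2)"
      by (simp add: exp_add[symmetric] diff_divide_distrib)
    finally show ?thesis using True by (simp add: growth_def)
  next
    case False
    have "sqrt (1/4 - \<mu>) \<le> sqrt ((1/2)\<^sup>2)" using \<mu> by (intro real_sqrt_le_mono) (simp add: power2_eq_square)
    then have n: "Re (nu \<mu>) \<le> 1/2" by (simp add: Re_nu)
    have "growth \<mu> r * exp (- r / 2) = exp ((Re (nu \<mu>) - 1/2) * r)"
      using False by (simp add: growth_def exp_add[symmetric] algebra_simps)
    also have "\<dots> \<le> exp ((Re (nu \<mu>) - 1/2) * s)"
      using n sr by (simp add: mult_left_mono_neg)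
    also have "\<dots> = growth \<mu> s * exp (- s / 2)"
      using False by (simp add: growth_def exp_add[symmetric] algebra_simps)
    also have "\<dots> \<le> 2 * (growth \<mu> s * exp (- s / 2))"
      using growth_mono(1)[of s s \<mu>] sr by simp
    finally show ?thesis .
  qed
  then show ?thesis using assms by (simp add: decay_def sq s_def r_def)
qed

text \<open>The summand \<open>norm (w t) / (1 + t)\<close> is included for the potential part of
  the energy, which is needed when the decreasing energy takes over.\<close>

lemma mode_low_frequency:
  assumes \<mu>: "\<mu> > 0"
  shows "\<exists>C\<ge>0. \<forall>\<rho> t. \<forall>w w' :: real \<Rightarrow> complex. mode_ode \<mu> \<rho> w w' \<longrightarrow> 0 \<le> \<rho> \<longrightarrow> 0 \<le> t \<longrightarrow> \<rho> * (1 + t) \<le> 1 \<longrightarrow>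
    \<rho> * norm (w t) + norm (w' t) + norm (w t) / (1 + t) \<le> C * decay \<mu> (1 + t) * (norm (w 0) + norm (w' 0))"
proof -
  obtain C where C0: "C \<ge> 0" and C: "\<And>\<rho> S. \<And>y y' :: real \<Rightarrow> complex. 0 \<le> S \<Longrightarrow> 0 \<le> \<rho> \<Longrightarrow> \<rho> * exp S \<le> 1 \<Longrightarrow>
    continuous_on {0..S} y \<Longrightarrow> continuous_on {0..S} y' \<Longrightarrow>
    (\<forall>s. 0 < s \<longrightarrow> s < S \<longrightarrow> (y has_vector_derivative y' s) (at s)) \<Longrightarrow>
    (\<forall>s. 0 < s \<longrightarrow> s < S \<longrightarrow> (y' has_vector_derivative (1/4 - \<mu> - \<rho>\<^sup>2 * exp (2 * s)) *\<^sub>R y s) (at s)) \<Longrightarrow>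
    norm (y S) \<le> C * growth \<mu> S * (norm (y 0) + norm (y' 0)) \<and>
    norm (y' S) \<le> C * growth \<mu> S * (norm (y 0) + norm (y' 0))"
    using low_frequency_bound[OF \<mu>] by blast
  have "\<rho> * norm (w t) + norm (w' t) + norm (w t) / (1 + t)
      \<le> (8 * C) * decay \<mu> (1 + t) * (norm (w 0) + norm (w' 0))"
    if ode: "mode_ode \<mu> \<rho> w w'" and \<rho>: "0 \<le> \<rho>" "\<rho> * (1 + t) \<le> 1" and t: "0 \<le> t"
    for \<rho> t and w w' :: "real \<Rightarrow> complex"
  proof -
    define S where "S = ln (1 + t)"
    have S: "0 \<le> S" "exp S = 1 + t" using t by (auto simp: S_def)
    define y where "y s = exp (- s / 2) *\<^sub>R w (exp s - 1)" for s
    \<comment> \<open>The derivative of \<open>y\<close> in \<open>s\<close>, expressed by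
      \<open>w\<close> and \<open>w'\<close>. Solved for w', it gives w' = (y' + y / 2) / sqrt (1 +
      t).\<close>
    define y' where "y' s = exp (s / 2) *\<^sub>R w' (exp s - 1) - (exp (- s / 2) / 2) *\<^sub>R w (exp s - 1)" for s
    have cw: "continuous_on {0..S} (\<lambda>s. w (exp s - 1))" "continuous_on {0..S} (\<lambda>s. w' (exp s - 1))"
      by (auto intro!: continuous_on_compose2[OF mode_ode_continuous(1)[OF ode]]
          continuous_on_compose2[OF mode_ode_continuous(2)[OF ode]] continuous_intros)
    have dw: "((\<lambda>s. w (exp s - 1)) has_vector_derivative exp s *\<^sub>R w' (exp s - 1)) (at s)"
      and dw': "((\<lambda>s. w' (exp s - 1)) has_vector_derivative
        exp s *\<^sub>R (- (\<rho>\<^sup>2 + \<mu> / (exp s)\<^sup>2) *\<^sub>R w (exp s - 1))) (at s)" if s: "s > 0" for s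
    proof -
      have e: "((\<lambda>s. exp s - 1) has_vector_derivative exp s) (at s)"
        unfolding has_real_derivative_iff_has_vector_derivative[symmetric]
        by (auto intro!: derivative_eq_intros)
      have "exp s - 1 > 0" using s by simp
      note d = mode_odeD[OF ode this]
      show "((\<lambda>s. w (exp s - 1)) has_vector_derivative exp s *\<^sub>R w' (exp s - 1)) (at s)"
        using vector_diff_chain_at[OF e d(1)] by (simp add: o_def)
      show "((\<lambda>s. w' (exp s - 1)) has_vector_derivative
        exp s *\<^sub>R (- (\<rho>\<^sup>2 + \<mu> / (exp s)\<^sup>2) *\<^sub>R w (exp s - 1))) (at s)"
        using vector_diff_chain_at[OF e d(2)] by (simp add: o_def)
    qed
    have e1: "((\<lambda>s. exp (s / 2)) has_real_derivative exp (s / 2) / 2) (at s)"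
      and e2: "((\<lambda>s. exp (- s / 2)) has_real_derivative - exp (- s / 2) / 2) (at s)"
      and e3: "((\<lambda>s. exp (- s / 2) / 2) has_real_derivative - (exp (- s / 2) / 4)) (at s)" for s :: real
      by (auto intro!: derivative_eq_intros)
    have ee: "exp (- s / 2) * exp s = exp (s / 2)" for s :: real
      by (simp flip: exp_add)
    have y1: "(y has_vector_derivative y' s) (at s)" if "s > 0" for s
    proof -
      have "(y has_vector_derivative exp (- s / 2) *\<^sub>R (exp s *\<^sub>R w' (exp s - 1)) +
          (- exp (- s / 2) / 2) *\<^sub>R w (exp s - 1)) (at s)"
        unfolding y_def by (intro has_vector_derivative_scaleR e2 dw that)
      also have "exp (- s / 2) *\<^sub>R (exp s *\<^sub>R w' (exp s - 1)) + (- exp (- s / 2) / 2) *\<^sub>R w (exp s - 1) = y' s"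
        by (simp only: scaleR_scaleR ee y'_def) simp
      finally show ?thesis .
    qed
    have y2: "(y' has_vector_derivative (1/4 - \<mu> - \<rho>\<^sup>2 * exp (2 * s)) *\<^sub>R y s) (at s)" if "s > 0" for s
    proof -
      let ?W = "w (exp s - 1)" and ?W' = "w' (exp s - 1)"
      have "(y' has_vector_derivative
          (exp (s / 2) *\<^sub>R (exp s *\<^sub>R (- (\<rho>\<^sup>2 + \<mu> / (exp s)\<^sup>2) *\<^sub>R ?W)) + (exp (s / 2) / 2) *\<^sub>R ?W') -
          ((exp (- s / 2) / 2) *\<^sub>R (exp s *\<^sub>R ?W') + (- (exp (- s / 2) / 4)) *\<^sub>R ?W)) (at s)"
        unfolding y'_def by (intro has_vector_derivative_diff has_vector_derivative_scaleR e1 e3 dw dw' that)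
      also have "(exp (s / 2) *\<^sub>R (exp s *\<^sub>R (- (\<rho>\<^sup>2 + \<mu> / (exp s)\<^sup>2) *\<^sub>R ?W)) + (exp (s / 2) / 2) *\<^sub>R ?W') -
          ((exp (- s / 2) / 2) *\<^sub>R (exp s *\<^sub>R ?W') + (- (exp (- s / 2) / 4)) *\<^sub>R ?W)
          = (exp (- s / 2) / 4 - exp (s / 2) * exp s * (\<rho>\<^sup>2 + \<mu> / (exp s)\<^sup>2)) *\<^sub>R ?W"
      proof -
        have "(exp (- s / 2) / 2) *\<^sub>R (exp s *\<^sub>R ?W') = (exp (s / 2) / 2) *\<^sub>R ?W'"
          by (simp only: scaleR_scaleR times_divide_eq_left ee)
        moreover have "(a *\<^sub>R (b *\<^sub>R (- c *\<^sub>R W)) + X) - (X + (- d) *\<^sub>R W) = (d - a * b * c) *\<^sub>R W"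
          for a b c d :: real and W X :: complex
          by (simp add: algebra_simps)
        ultimately show ?thesis by (simp only:)
      qed
      also have "exp (- s / 2) / 4 - exp (s / 2) * exp s * (\<rho>\<^sup>2 + \<mu> / (exp s)\<^sup>2)
          = (1/4 - \<mu> - \<rho>\<^sup>2 * exp (2 * s)) * exp (- s / 2)"
      proof -
        have "exp (s / 2) * exp s * (\<mu> / (exp s)\<^sup>2) = \<mu> * exp (- s / 2)"
          by (subst ee[of s, symmetric]) (simp add: power2_eq_square)
        moreover have "exp (s / 2) * exp s = exp (2 * s) * exp (- s / 2)"
          by (simp flip: exp_add)
        ultimately show ?thesis by (simp add: algebra_simps)
      qed
      finally show ?thesis by (simp add: y_def)
    qed
    let ?D = "norm (w 0) + norm (w' 0)"
    have D: "norm (y 0) + norm (y' 0) \<le> 2 * ?D"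
    proof -
      have "norm ((1/2) *\<^sub>R w 0) \<le> norm (w 0)" by simp
      moreover have "norm (y' 0) \<le> norm (w' 0) + norm ((1/2) *\<^sub>R w 0)"
        using norm_triangle_ineq4[of "w' 0" "(1/2) *\<^sub>R w 0"] by (simp add: y'_def)
      moreover have "norm (y 0) = norm (w 0)" by (simp add: y_def)
      ultimately show ?thesis using norm_ge_zero[of "w' 0"] unfolding distrib_left by linarith
    qed
    have "norm (y S) \<le> C * growth \<mu> S * (norm (y 0) + norm (y' 0)) \<and>
        norm (y' S) \<le> C * growth \<mu> S * (norm (y 0) + norm (y' 0))"
      using S \<rho> cw y1 y2
      by (intro C[of S \<rho>]) (auto simp: y_def[abs_def] y'_def[abs_def] intro!: continuous_intros)
    moreover have "C * growth \<mu> S * (norm (y 0) + norm (y' 0)) \<le> C * growth \<mu> S * (2 * ?D)"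
      using C0 growth_mono(1)[of S S \<mu>] S D by (intro mult_left_mono) auto
    ultimately have yb: "norm (y S) \<le> C * growth \<mu> S * (2 * ?D)" "norm (y' S) \<le> C * growth \<mu> S * (2 * ?D)"
      by auto
    have es: "exp (S / 2) = sqrt (1 + t)" "exp (- S / 2) = 1 / sqrt (1 + t)"
    proof -
      show "exp (S / 2) = sqrt (1 + t)"
        using t by (simp add: S_def powr_half_sqrt[symmetric] powr_def)
      then show "exp (- S / 2) = 1 / sqrt (1 + t)" by (simp add: exp_minus inverse_eq_divide)
    qed
    have wt: "norm (w t) / (1 + t) = norm (y S) / sqrt (1 + t)"
    proof -
      have "norm (y S) = norm (w t) / sqrt (1 + t)" using t es(2) by (simp add: y_def S)
      then show ?thesis using t by simp
    qed
    have w't: "norm (w' t) \<le> (norm (y' S) + norm (y S)) / sqrt (1 + t)"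
    proof -
      have "y' S + (1/2) *\<^sub>R y S = sqrt (1 + t) *\<^sub>R w' t"
        by (simp add: y_def y'_def es S)
      then have "sqrt (1 + t) * norm (w' t) = norm (y' S + (1/2) *\<^sub>R y S)" using t by simp
      also have "\<dots> \<le> norm (y' S) + norm (y S)"
      proof (rule norm_triangle_le)
        have "norm ((1/2) *\<^sub>R y S) \<le> norm (y S)" by simp
        then show "norm (y' S) + norm ((1/2) *\<^sub>R y S) \<le> norm (y' S) + norm (y S)" by linarith
      qed
      finally show ?thesis using t by (simp add: field_simps)
    qed
    have "\<rho> \<le> 1 / (1 + t)" using \<rho> t by (simp add: field_simps)
    then have "\<rho> * norm (w t) \<le> 1 / (1 + t) * norm (w t)" by (intro mult_right_mono) auto
    also have "\<dots> = norm (y S) / sqrt (1 + t)" using wt by simp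
    finally have "\<rho> * norm (w t) + norm (w' t) + norm (w t) / (1 + t)
        \<le> (norm (y' S) + 3 * norm (y S)) / sqrt (1 + t)"
      using w't wt by (simp add: add_divide_distrib)
    \<comment> \<open>The constant 8 is 4 * 2: the three summands cost one norm of y' and three of
      y, and the passage from \<open>y\<close> to \<open>w\<close> at time 0 costs a factor
      2.\<close>
    also have "\<dots> \<le> (4 * (C * growth \<mu> S * (2 * ?D))) / sqrt (1 + t)"
      using yb t by (intro divide_right_mono) auto
    also have "\<dots> = (8 * C) * decay \<mu> (1 + t) * ?D"
      by (simp add: decay_def S_def)
    finally show ?thesis .
  qed
  then show ?thesis using C0 by (intro exI[of _ "8 * C"]) auto
qed

section \<open>High frequencies: convergence of the profiles\<close>

text \<open>
  The phase undoes the free evolution (\<open>\<sigma> = \<plusminus>1\<close>), so that only the potential term remains in the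
  time derivative.
\<close>

definition profile :: "real \<Rightarrow> real \<Rightarrow> (real \<Rightarrow> complex) \<Rightarrow> (real \<Rightarrow> complex) \<Rightarrow> real \<Rightarrow> complex" where
  "profile \<sigma> \<rho> w w' t = cis (- (\<sigma> * \<rho>) * t) * (w' t + \<i> * of_real (\<sigma> * \<rho>) * w t)"

lemma profile_derivative:
  assumes ode: "mode_ode \<mu> \<rho> w w'" and t: "t > 0" and \<sigma>: "\<sigma>\<^sup>2 = 1"
  shows "(profile \<sigma> \<rho> w w' has_vector_derivative - of_real (\<mu> / (1 + t)\<^sup>2) * (cis (- (\<sigma> * \<rho>) * t) * w t)) (at t)"
proof -
  let ?a = "\<sigma> * \<rho>"
  have a2: "?a * ?a = \<rho>\<^sup>2" using \<sigma> by (simp add: power2_eq_square algebra_simps)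
  have "((\<lambda>t. cis (- ?a * t)) has_vector_derivative - ?a *\<^sub>R (\<i> * cis (- ?a * t))) (at t)"
    unfolding has_vector_derivative_def
    by (auto intro!: derivative_eq_intros)
  then have "(profile \<sigma> \<rho> w w' has_vector_derivative
      cis (- ?a * t) * (- (\<rho>\<^sup>2 + \<mu> / (1 + t)\<^sup>2) *\<^sub>R w t + \<i> * of_real ?a * w' t)
      + (- ?a *\<^sub>R (\<i> * cis (- ?a * t))) * (w' t + \<i> * of_real ?a * w t)) (at t)"
    unfolding profile_def
    by (intro has_vector_derivative_mult has_vector_derivative_add mode_odeD[OF ode t]
        bounded_linear.has_vector_derivative[OF bounded_linear_mult_right])
  also have "cis (- ?a * t) * (- (\<rho>\<^sup>2 + \<mu> / (1 + t)\<^sup>2) *\<^sub>R w t + \<i> * of_real ?a * w' t)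
      + (- ?a *\<^sub>R (\<i> * cis (- ?a * t))) * (w' t + \<i> * of_real ?a * w t)
      = cis (- ?a * t) * (of_real (?a * ?a) - of_real (\<rho>\<^sup>2 + \<mu> / (1 + t)\<^sup>2)) * w t"
    by (simp add: scaleR_conv_of_real algebra_simps)
  also have "\<dots> = - of_real (\<mu> / (1 + t)\<^sup>2) * (cis (- ?a * t) * w t)"
    unfolding a2 by (simp add: algebra_simps)
  finally show ?thesis .
qed

text \<open>\<open>N\<close> bounds the square root of the energy at time \<open>T\<close>, and the
  energy decreases. Hence |w| \<le> N / \<rho> from then on, the derivative of the profile is at
  most \<mu> N / (\<rho> (1 + t)^2), and the error is the integral of this tail.\<close>

lemma profile_limit:
  assumes ode: "mode_ode \<mu> \<rho> w w'" and \<mu>: "\<mu> > 0" and \<rho>: "\<rho> > 0" and \<sigma>: "\<sigma>\<^sup>2 = 1" and T: "T \<ge> 0"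
    and N: "norm (w' T) + \<rho> * norm (w T) + sqrt \<mu> * norm (w T) / (1 + T) \<le> N"
  shows "\<exists>r. (profile \<sigma> \<rho> w w' \<longlongrightarrow> r) at_top \<and> norm r \<le> 2 * N \<and>
    (\<forall>t\<ge>T. norm (profile \<sigma> \<rho> w w' t - r) \<le> \<mu> * N / (\<rho> * (1 + t)))"
proof -
  let ?p = "profile \<sigma> \<rho> w w'"
  have \<sigma>1: "\<bar>\<sigma>\<bar> = 1" using \<sigma> by (simp add: abs_square_eq_1)
  have N0: "N \<ge> 0"
    using N T \<rho> \<mu> by (intro order_trans[OF _ N] add_nonneg_nonneg) auto
  have E: "norm (w' t) \<le> N" "\<rho> * norm (w t) \<le> N" if t: "t \<ge> T" for t
  proof -
    let ?a = "norm (w' T)" and ?b = "\<rho> * norm (w T)" and ?c = "sqrt \<mu> * norm (w T) / (1 + T)"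
    have "(norm (w' t))\<^sup>2 + (\<rho>\<^sup>2 + \<mu> / (1 + t)\<^sup>2) * (norm (w t))\<^sup>2
        \<le> (norm (w' T))\<^sup>2 + (\<rho>\<^sup>2 + \<mu> / (1 + T)\<^sup>2) * (norm (w T))\<^sup>2"
      by (rule mode_energy_decreasing[OF ode _ T t]) (use \<mu> in simp)
    also have "\<dots> = ?a\<^sup>2 + ?b\<^sup>2 + ?c\<^sup>2"
      using \<mu> by (simp add: power_mult_distrib power_divide algebra_simps)
    also have "\<dots> \<le> (?a + ?b + ?c)\<^sup>2"
    proof -
      have "a\<^sup>2 + b\<^sup>2 + c\<^sup>2 \<le> (a + b + c)\<^sup>2" if "a \<ge> 0" "b \<ge> 0" "c \<ge> 0" for a b c :: real
        using that by (simp add: power2_sum algebra_simps)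
      then show ?thesis using \<rho> \<mu> T by simp
    qed
    also have "\<dots> \<le> N\<^sup>2"
      using N \<rho> \<mu> T by (intro power_mono) auto
    finally have le: "(norm (w' t))\<^sup>2 + (\<rho>\<^sup>2 + \<mu> / (1 + t)\<^sup>2) * (norm (w t))\<^sup>2 \<le> N\<^sup>2" .
    moreover have "(\<rho> * norm (w t))\<^sup>2 \<le> (\<rho>\<^sup>2 + \<mu> / (1 + t)\<^sup>2) * (norm (w t))\<^sup>2"
      unfolding power_mult_distrib using \<mu> by (intro mult_right_mono) auto
    ultimately have "(norm (w' t))\<^sup>2 \<le> N\<^sup>2" "(\<rho> * norm (w t))\<^sup>2 \<le> N\<^sup>2"
      using zero_le_power2[of "norm (w' t)"] zero_le_power2[of "\<rho> * norm (w t)"] by linarith+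
    then show "norm (w' t) \<le> N" "\<rho> * norm (w t) \<le> N" using N0 by (auto intro: power2_le_imp_le)
  qed
  have pb: "norm (?p t) \<le> 2 * N" if "t \<ge> T" for t
  proof -
    have "norm (?p t) \<le> norm (w' t) + \<rho> * norm (w t)"
      using norm_triangle_ineq[of "w' t" "\<i> * of_real (\<sigma> * \<rho>) * w t"] \<sigma>1 \<rho>
      by (simp add: profile_def norm_mult abs_mult)
    with E[OF that] show ?thesis by linarith
  qed
  let ?g = "\<lambda>t. - (\<mu> * N / (\<rho> * (1 + t)))"
  have pd: "norm (?p b - ?p a) \<le> \<mu> * N / (\<rho> * (1 + a)) - \<mu> * N / (\<rho> * (1 + b))" if ab: "T \<le> a" "a \<le> b" for a b
  proof (cases "a = b")
    case False
    have "norm (?p b - ?p a) \<le> ?g b - ?g a"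
    proof (rule differentiable_bound_general[where \<phi>'="\<lambda>t. \<mu> * N / (\<rho> * (1 + t)\<^sup>2)"])
      show "a < b" using ab False by simp
      have sub: "{a..b} \<subseteq> {0..}" using ab T by auto
      show "continuous_on {a..b} ?p"
        unfolding profile_def
        by (intro continuous_intros continuous_on_subset[OF mode_ode_continuous(1)[OF ode] sub]
            continuous_on_subset[OF mode_ode_continuous(2)[OF ode] sub])
      show "continuous_on {a..b} ?g"
        using ab T \<rho> by (intro continuous_intros) auto
      fix t assume t: "a < t" "t < b"
      then have t0: "t > 0" "t \<ge> T" using ab T by auto
      show "(?p has_vector_derivative - of_real (\<mu> / (1 + t)\<^sup>2) * (cis (- (\<sigma> * \<rho>) * t) * w t)) (at t)"
        by (rule profile_derivative[OF ode t0(1) \<sigma>])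
      have "(?g has_real_derivative \<mu> * N / (\<rho> * (1 + t)\<^sup>2)) (at t)"
      proof -
        have "((\<lambda>t. - (\<mu> * N / \<rho>) * inverse (1 + t)) has_real_derivative
            - (\<mu> * N / \<rho>) * (- (inverse (1 + t) * 1 * inverse (1 + t)))) (at t)"
          using t0 by (intro DERIV_cmult DERIV_inverse') (auto intro!: derivative_eq_intros)
        then show ?thesis by (simp add: field_simps power2_eq_square)
      qed
      then show "(?g has_vector_derivative \<mu> * N / (\<rho> * (1 + t)\<^sup>2)) (at t)"
        by (simp add: has_real_derivative_iff_has_vector_derivative)
      have "norm (- of_real (\<mu> / (1 + t)\<^sup>2) * (cis (- (\<sigma> * \<rho>) * t) * w t)) = \<mu> / (1 + t)\<^sup>2 * norm (w t)"
        using \<mu> by (simp only: norm_mult norm_minus_cancel norm_of_real norm_cis) simp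
      also have "\<dots> \<le> \<mu> / (1 + t)\<^sup>2 * (N / \<rho>)"
        using E(2)[OF t0(2)] \<mu> \<rho> by (intro mult_left_mono) (auto simp: field_simps)
      finally show "norm (- of_real (\<mu> / (1 + t)\<^sup>2) * (cis (- (\<sigma> * \<rho>) * t) * w t)) \<le> \<mu> * N / (\<rho> * (1 + t)\<^sup>2)"
        by (simp add: mult_ac)
    qed
    then show ?thesis by simp
  qed simp
  have pd': "norm (?p b - ?p a) \<le> \<mu> * N / (\<rho> * (1 + a))" if "T \<le> a" "a \<le> b" for a b
  proof -
    have "0 \<le> \<mu> * N / (\<rho> * (1 + b))" using that T \<mu> \<rho> N0 by simp
    with pd[OF that] show ?thesis by linarith
  qed
  have z: "((\<lambda>a. \<mu> * N / (\<rho> * (1 + a))) \<longlongrightarrow> 0) at_top"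
    using \<rho> by real_asymp
  have "\<exists>r. (?p \<longlongrightarrow> r) at_top"
  proof -
    have "Cauchy (\<lambda>n. ?p (real n))"
    proof (rule metric_CauchyI)
      fix e :: real assume "e > 0"
      then have "\<forall>\<^sub>F a in at_top. \<mu> * N / (\<rho> * (1 + a)) < e / 2"
        by (intro order_tendstoD(2)[OF z]) auto
      then obtain A where A: "\<And>a. a \<ge> A \<Longrightarrow> \<mu> * N / (\<rho> * (1 + a)) < e / 2"
        by (auto simp: eventually_at_top_linorder)
      obtain M :: nat where M: "max A T \<le> M" using real_arch_simple by blast
      have "dist (?p (real m)) (?p (real n)) < e" if "m \<ge> M" "n \<ge> M" for m n
      proof -
        have "dist (?p (real m)) (?p (real M)) < e / 2" "dist (?p (real n)) (?p (real M)) < e / 2"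
          using le_less_trans[OF pd'[of M m] A[of M]] le_less_trans[OF pd'[of M n] A[of M]] M that
          by (auto simp: dist_norm)
        then show ?thesis by (metis dist_triangle_half_l dist_commute)
      qed
      then show "\<exists>M. \<forall>m\<ge>M. \<forall>n\<ge>M. dist (?p (real m)) (?p (real n)) < e" by blast
    qed
    then obtain r where r: "(\<lambda>n. ?p (real n)) \<longlonglongrightarrow> r"
      using Cauchy_convergent convergent_def by blast
    \<comment> \<open>So far \<open>r\<close> is a limit along integer times; letting the later time
      run through the integers in \<open>pd'\<close> yields a bound at every real time.\<close>
    have "norm (?p t - r) \<le> \<mu> * N / (\<rho> * (1 + t))" if "t \<ge> T" for t
    proof (rule tendsto_upperbound[OF tendsto_norm[OF tendsto_diff[OF tendsto_const r]]])
      obtain M :: nat where "t \<le> M" using real_arch_simple by blast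
      then show "\<forall>\<^sub>F n in sequentially. norm (?p t - ?p (real n)) \<le> \<mu> * N / (\<rho> * (1 + t))"
        using pd'[OF that] unfolding eventually_sequentially
        by (intro exI[of _ M]) (auto simp: norm_minus_commute[of "?p t"])
    qed simp
    then have "\<forall>\<^sub>F t in at_top. norm (?p t - r) \<le> \<mu> * N / (\<rho> * (1 + t))"
      by (auto simp: eventually_at_top_linorder)
    then show ?thesis using LIM_zero_cancel[OF Lim_null_comparison[OF _ z]] by blast
  qed
  then obtain r where r: "(?p \<longlongrightarrow> r) at_top" by blast
  have "norm r \<le> 2 * N"
    using pb by (intro tendsto_upperbound[OF tendsto_norm[OF r]]) (auto simp: eventually_at_top_linorder)
  moreover have "norm (?p t - r) \<le> \<mu> * N / (\<rho> * (1 + t))" if "t \<ge> T" for t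
    using pd'[OF that] that
    by (intro tendsto_upperbound[OF tendsto_norm[OF tendsto_diff[OF tendsto_const r]]])
      (auto simp: eventually_at_top_linorder norm_minus_commute intro!: exI[of _ t])
  ultimately show ?thesis using r by blast
qed

text \<open>The two estimates of the error, uniform in \<rho> relative to the data and little-o for
  each single \<rho>, are the domination and the pointwise convergence needed for dominated
  convergence in \<xi>. The first joins the low-frequency bound to \<open>profile_limit\<close> at
  the time 1 / \<rho>.\<close>

lemma mode_scattering:
  assumes \<mu>: "\<mu> > 0"
  shows "\<exists>C\<ge>0. \<forall>\<sigma> \<rho>. \<forall>w w' :: real \<Rightarrow> complex. mode_ode \<mu> \<rho> w w' \<longrightarrow> 0 < \<rho> \<longrightarrow> \<sigma>\<^sup>2 = 1 \<longrightarrow>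
    (\<exists>r. (profile \<sigma> \<rho> w w' \<longlongrightarrow> r) at_top \<and>
      (\<forall>t\<ge>0. norm (profile \<sigma> \<rho> w w' t - r) \<le> C * decay \<mu> (1 + t) * (sqrt (1 + \<rho>\<^sup>2) * norm (w 0) + norm (w' 0))) \<and>
      ((\<lambda>t. norm (profile \<sigma> \<rho> w w' t - r) / decay \<mu> (1 + t)) \<longlongrightarrow> 0) at_top)"
proof -
  obtain C where C0: "C \<ge> 0" and C: "\<And>\<rho> t. \<And>w w' :: real \<Rightarrow> complex. mode_ode \<mu> \<rho> w w' \<Longrightarrow> 0 \<le> \<rho> \<Longrightarrow> 0 \<le> t \<Longrightarrow> \<rho> * (1 + t) \<le> 1 \<Longrightarrow>
    \<rho> * norm (w t) + norm (w' t) + norm (w t) / (1 + t) \<le> C * decay \<mu> (1 + t) * (norm (w 0) + norm (w' 0))"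
    using mode_low_frequency[OF \<mu>] by blast
  \<comment> \<open>The factor 1 + sqrt \<mu> pays for the potential term in \<open>N\<close>.
    Taking C + 1 instead of \<open>C\<close> also covers \<rho> \<ge> 1, where the data at time 0
    are used directly.\<close>
  define K where "K = (1 + sqrt \<mu>) * (C + 1)"
  have CK: "C \<le> K" "0 \<le> K"
    using C0 \<mu> by (auto simp: K_def algebra_simps intro!: add_nonneg_nonneg)
  have "\<exists>r. (profile \<sigma> \<rho> w w' \<longlongrightarrow> r) at_top \<and>
      (\<forall>t\<ge>0. norm (profile \<sigma> \<rho> w w' t - r) \<le> ((5 + \<mu>) * K) * decay \<mu> (1 + t) * (sqrt (1 + \<rho>\<^sup>2) * norm (w 0) + norm (w' 0))) \<and>
      ((\<lambda>t. norm (profile \<sigma> \<rho> w w' t - r) / decay \<mu> (1 + t)) \<longlongrightarrow> 0) at_top"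
    if ode: "mode_ode \<mu> \<rho> w w'" and \<rho>: "0 < \<rho>" and \<sigma>: "\<sigma>\<^sup>2 = 1" for \<sigma> \<rho> and w w' :: "real \<Rightarrow> complex"
  proof -
    let ?p = "profile \<sigma> \<rho> w w'"
    have \<sigma>1: "\<bar>\<sigma>\<bar> = 1" using \<sigma> by (simp add: abs_square_eq_1)
    define D where "D = sqrt (1 + \<rho>\<^sup>2) * norm (w 0) + norm (w' 0)"
    have D0: "D \<ge> 0" by (simp add: D_def)
    have DD: "norm (w 0) + norm (w' 0) \<le> D"
      using mult_right_mono[of 1 "sqrt (1 + \<rho>\<^sup>2)" "norm (w 0)"] by (simp add: D_def)
    \<comment> \<open>The handover takes place at time x - 1, which is 0 unless \<rho> < 1.\<close>
    define x where "x = max 1 (1 / \<rho>)"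
    have x: "x \<ge> 1" "1 / \<rho> \<le> x" by (auto simp: x_def)
    define N where "N = K * decay \<mu> x * D"
    have N: "norm (w' (x - 1)) + \<rho> * norm (w (x - 1)) + sqrt \<mu> * norm (w (x - 1)) / (1 + (x - 1)) \<le> N"
    proof (cases "\<rho> < 1")
      case True
      then have xr: "x = 1 / \<rho>" using \<rho> by (simp add: x_def)
      have "\<rho> * norm (w (x - 1)) + norm (w' (x - 1)) + norm (w (x - 1)) / (1 + (x - 1))
          \<le> C * decay \<mu> (1 + (x - 1)) * (norm (w 0) + norm (w' 0))"
        using \<rho> x(1) by (intro C[OF ode]) (auto simp: xr)
      also have "\<dots> \<le> C * decay \<mu> x * D"
        using C0 decay_pos[OF x(1), of \<mu>] DD by (simp add: mult_left_mono)
      also have "\<dots> \<le> (C + 1) * decay \<mu> x * D"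
        using decay_pos[OF x(1), of \<mu>] D0 by (intro mult_right_mono) auto
      finally have le: "\<rho> * norm (w (x - 1)) + norm (w' (x - 1)) + norm (w (x - 1)) / x \<le> (C + 1) * decay \<mu> x * D"
        by simp
      have "norm (w' (x - 1)) + \<rho> * norm (w (x - 1)) + sqrt \<mu> * norm (w (x - 1)) / x
          \<le> (1 + sqrt \<mu>) * (\<rho> * norm (w (x - 1)) + norm (w' (x - 1)) + norm (w (x - 1)) / x)"
      proof -
        have "a + b + s * c \<le> (1 + s) * (b + a + c)" if "a \<ge> 0" "b \<ge> 0" "c \<ge> 0" "s \<ge> 0" for a b c s :: real
          using that by (simp add: algebra_simps)
        from this[of "norm (w' (x - 1))" "\<rho> * norm (w (x - 1))" "norm (w (x - 1)) / x" "sqrt \<mu>"]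
        show ?thesis using \<mu> \<rho> x(1) by simp
      qed
      also have "\<dots> \<le> (1 + sqrt \<mu>) * ((C + 1) * decay \<mu> x * D)"
        using \<mu> by (intro mult_left_mono le) auto
      finally show ?thesis by (simp add: N_def K_def mult.assoc)
    next
      case False
      then have x1: "x = 1" using \<rho> by (simp add: x_def max_def)
      have "\<rho> \<le> sqrt (1 + \<rho>\<^sup>2)" by (simp add: real_le_rsqrt)
      then have r: "\<rho> * norm (w 0) \<le> sqrt (1 + \<rho>\<^sup>2) * norm (w 0)" by (intro mult_right_mono) auto
      have "norm (w 0) \<le> D" using DD norm_ge_zero[of "w' 0"] by linarith
      then have "sqrt \<mu> * norm (w 0) \<le> sqrt \<mu> * D" using \<mu> by (intro mult_left_mono) auto
      then have "norm (w' 0) + \<rho> * norm (w 0) + sqrt \<mu> * norm (w 0) \<le> (1 + sqrt \<mu>) * D"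
        using r by (simp add: D_def algebra_simps)
      also have "\<dots> \<le> (1 + sqrt \<mu>) * (C + 1) * D"
        using C0 \<mu> D0 mult_left_mono[of 1 "C + 1" "1 + sqrt \<mu>"] by (intro mult_right_mono) auto
      finally show ?thesis by (simp add: x1 N_def K_def)
    qed
    have "x - 1 \<ge> 0" using x(1) by simp
    from profile_limit[OF ode \<mu> \<rho> \<sigma> this N] obtain r
      where r: "(?p \<longlongrightarrow> r) at_top" "norm r \<le> 2 * N"
        and rd: "\<And>t. t \<ge> x - 1 \<Longrightarrow> norm (?p t - r) \<le> \<mu> * N / (\<rho> * (1 + t))" by blast
    \<comment> \<open>After the handover the error comes from \<open>profile_limit\<close>. Before
      it, profile and limit are estimated separately, and 5 = 1 + 4, where 4 is made up of |r| \<le>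
      2 N and the factor 2 of \<open>decay_le\<close>.\<close>
    have bd: "norm (?p t - r) \<le> ((5 + \<mu>) * K) * decay \<mu> (1 + t) * D" if t: "t \<ge> 0" for t
    proof (cases "t \<ge> x - 1")
      case True
      have dp: "decay \<mu> (1 + t) > 0" using t by (intro decay_pos) auto
      have "\<mu> * N / (\<rho> * (1 + t)) = \<mu> * K * D * (1 / \<rho> * decay \<mu> x) / (1 + t)"
        by (simp add: N_def)
      also have "\<dots> \<le> \<mu> * K * D * ((1 + t) * decay \<mu> (1 + t)) / (1 + t)"
      proof (intro divide_right_mono mult_left_mono)
        have "1 / \<rho> * decay \<mu> x \<le> x * decay \<mu> x"
          using x decay_pos[OF x(1), of \<mu>] by (intro mult_right_mono) auto
        also have "\<dots> \<le> (1 + t) * decay \<mu> (1 + t)"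
          using True x(1) by (intro mult_decay_mono) auto
        finally show "1 / \<rho> * decay \<mu> x \<le> (1 + t) * decay \<mu> (1 + t)" .
      qed (use \<mu> CK D0 t in auto)
      also have "\<dots> = \<mu> * (K * decay \<mu> (1 + t) * D)"
        using t by simp
      also have "\<dots> \<le> (5 + \<mu>) * (K * decay \<mu> (1 + t) * D)"
        using CK D0 dp by (intro mult_right_mono) auto
      finally show ?thesis using rd[OF True] by (simp add: mult.assoc)
    next
      case False
      then have xr: "x = 1 / \<rho>" and "1 + t \<le> x" using t by (auto simp: x_def max_def split: if_splits)
      then have "\<rho> * (1 + t) \<le> 1" using \<rho> mult_left_mono[of "1 + t" x \<rho>] by simp
      have dp: "decay \<mu> (1 + t) > 0" using t by (intro decay_pos) auto
      have "norm (?p t) \<le> norm (w' t) + \<rho> * norm (w t)"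
        using norm_triangle_ineq[of "w' t" "\<i> * of_real (\<sigma> * \<rho>) * w t"] \<sigma>1 \<rho>
        by (simp add: profile_def norm_mult abs_mult)
      also have "\<dots> \<le> \<rho> * norm (w t) + norm (w' t) + norm (w t) / (1 + t)"
        using t by simp
      also have "\<dots> \<le> C * decay \<mu> (1 + t) * (norm (w 0) + norm (w' 0))"
        using \<rho> t \<open>\<rho> * (1 + t) \<le> 1\<close> by (intro C[OF ode]) auto
      also have "\<dots> \<le> K * decay \<mu> (1 + t) * D"
        using CK C0 dp DD by (intro mult_mono) auto
      finally have a: "norm (?p t) \<le> K * decay \<mu> (1 + t) * D" .
      have "N \<le> K * (2 * decay \<mu> (1 + t)) * D"
        unfolding N_def using CK D0 \<open>1 + t \<le> x\<close> t
        by (intro mult_right_mono mult_left_mono decay_le[OF \<mu>]) auto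
      then have b: "norm r \<le> 4 * (K * decay \<mu> (1 + t) * D)" using r(2) by (simp add: mult_ac)
      have "norm (?p t - r) \<le> 5 * (K * decay \<mu> (1 + t) * D)"
        using norm_triangle_ineq4[of "?p t" r] a b by linarith
      also have "\<dots> \<le> (5 + \<mu>) * (K * decay \<mu> (1 + t) * D)"
        using CK D0 dp \<mu> by (intro mult_right_mono) auto
      finally show ?thesis by (simp add: mult.assoc)
    qed
    \<comment> \<open>For a fixed frequency the error is O(1 / (1 + t)), whereas
      \<open>decay \<mu> (1 + t)\<close> is at least 1 / sqrt (1 + t).\<close>
    have "((\<lambda>t. norm (?p t - r) / decay \<mu> (1 + t)) \<longlongrightarrow> 0) at_top"
    proof (rule Lim_null_comparison)
      have "norm (norm (?p t - r) / decay \<mu> (1 + t)) \<le> \<mu> * N / \<rho> / sqrt (1 + t)" if t: "t \<ge> x - 1" for t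
      proof -
        have t1: "1 + t \<ge> 1" using t x(1) by simp
        have dp: "decay \<mu> (1 + t) > 0" using t1 by (rule decay_pos)
        have N0: "N \<ge> 0" unfolding N_def using CK D0 decay_pos[OF x(1), of \<mu>] by simp
        have "norm (norm (?p t - r) / decay \<mu> (1 + t)) = norm (?p t - r) / decay \<mu> (1 + t)"
          using dp by simp
        also have "\<dots> \<le> \<mu> * N / (\<rho> * (1 + t)) / decay \<mu> (1 + t)"
          using dp by (intro divide_right_mono rd t) simp
        also have "\<dots> = \<mu> * N / \<rho> / ((1 + t) * decay \<mu> (1 + t))" by simp
        also have "\<dots> \<le> \<mu> * N / \<rho> / sqrt (1 + t)"
          using sqrt_le_mult_decay[OF t1, of \<mu>] t1 \<mu> \<rho> N0 dp
          by (intro divide_left_mono mult_pos_pos) auto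
        finally show ?thesis .
      qed
      then show "\<forall>\<^sub>F t in at_top. norm (norm (?p t - r) / decay \<mu> (1 + t)) \<le> \<mu> * N / \<rho> / sqrt (1 + t)"
        by (auto simp: eventually_at_top_linorder)
      show "((\<lambda>t. \<mu> * N / \<rho> / sqrt (1 + t)) \<longlongrightarrow> 0) at_top"
        by real_asymp
    qed
    with r(1) bd show ?thesis unfolding D_def by blast
  qed
  moreover have "(5 + \<mu>) * K \<ge> 0" using CK \<mu> by simp
  ultimately show ?thesis by blast
qed

subsection \<open>Identification of the solution with its modes\<close>

text \<open>The filter is restricted to nonnegative times because the solution is not controlled at
  negative ones; at time 0 the derivative is one-sided.\<close>

definition L2_deriv :: "(real \<Rightarrow> real ^ 'd \<Rightarrow> complex) \<Rightarrow> (real ^ 'd \<Rightarrow> complex) \<Rightarrow> real \<Rightarrow> bool" where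
  "L2_deriv P P' t \<longleftrightarrow>
     ((\<lambda>s. L2_norm (\<lambda>\<xi>. (P s \<xi> - P t \<xi>) / of_real (s - t) - P' \<xi>)) \<longlongrightarrow> 0) (at t within {0..})"

lemma eventually_atLeast_within:
  assumes "\<And>s. s \<ge> 0 \<Longrightarrow> s \<noteq> t \<Longrightarrow> R s"
  shows "\<forall>\<^sub>F s in at t within {0..}. R s"
  using assms by (auto simp: eventually_at_filter intro: always_eventually)

lemma L2_difference_quotient:
  fixes P :: "real \<Rightarrow> real ^ 'd \<Rightarrow> complex"
  assumes "\<And>s. s \<ge> 0 \<Longrightarrow> P s \<in> L2" "s \<ge> 0" "t \<ge> 0"
  shows "(\<lambda>\<xi>. (P s \<xi> - P t \<xi>) / of_real (s - t)) \<in> L2"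
  using L2_scale[OF L2_diff[OF assms(1)[OF assms(2)] assms(1)[OF assms(3)]], of "inverse (of_real (s - t))"]
  by (simp add: divide_inverse mult.commute)

lemma L2_deriv_continuous:
  fixes P :: "real \<Rightarrow> real ^ 'd \<Rightarrow> complex"
  assumes P: "\<And>s. s \<ge> 0 \<Longrightarrow> P s \<in> L2" and P': "P' \<in> L2" and t: "t \<ge> 0" and d: "L2_deriv P P' t"
  shows "((\<lambda>s. L2_norm (\<lambda>\<xi>. P s \<xi> - P t \<xi>)) \<longlongrightarrow> 0) (at t within {0..})"
proof (rule Lim_null_comparison)
  let ?q = "\<lambda>s \<xi>. (P s \<xi> - P t \<xi>) / of_real (s - t)"
  show "\<forall>\<^sub>F s in at t within {0..}. norm (L2_norm (\<lambda>\<xi>. P s \<xi> - P t \<xi>))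
      \<le> \<bar>s - t\<bar> * (L2_norm (\<lambda>\<xi>. ?q s \<xi> - P' \<xi>) + L2_norm P')"
  proof (rule eventually_atLeast_within)
    fix s :: real assume s: "s \<ge> 0" "s \<noteq> t"
    have q: "?q s \<in> L2" by (rule L2_difference_quotient[OF P s(1) t])
    have "(\<lambda>\<xi>. P s \<xi> - P t \<xi>) = (\<lambda>\<xi>. of_real (s - t) * ?q s \<xi>)" using s by auto
    then have "L2_norm (\<lambda>\<xi>. P s \<xi> - P t \<xi>) = \<bar>s - t\<bar> * L2_norm (?q s)"
      by (simp only: L2_norm_scale norm_of_real)
    also have "\<dots> \<le> \<bar>s - t\<bar> * (L2_norm (\<lambda>\<xi>. ?q s \<xi> - P' \<xi>) + L2_norm P')"
      using L2_triangle[OF L2_diff[OF q P'] P'] by (intro mult_left_mono) auto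
    finally show "norm (L2_norm (\<lambda>\<xi>. P s \<xi> - P t \<xi>))
      \<le> \<bar>s - t\<bar> * (L2_norm (\<lambda>\<xi>. ?q s \<xi> - P' \<xi>) + L2_norm P')" by simp
  qed
  have "((\<lambda>s. \<bar>s - t\<bar> * (L2_norm (\<lambda>\<xi>. ?q s \<xi> - P' \<xi>) + L2_norm P')) \<longlongrightarrow> \<bar>t - t\<bar> * (0 + L2_norm P')) (at t within {0..})"
    using d by (intro tendsto_intros) (simp add: L2_deriv_def)
  then show "((\<lambda>s. \<bar>s - t\<bar> * (L2_norm (\<lambda>\<xi>. ?q s \<xi> - P' \<xi>) + L2_norm P')) \<longlongrightarrow> 0) (at t within {0..})"
    by simp
qed

lemma has_vector_derivative_quotientI:
  fixes f :: "real \<Rightarrow> complex"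
  assumes "((\<lambda>s. (f s - f t) / of_real (s - t)) \<longlongrightarrow> D) (at t within S)"
  shows "(f has_vector_derivative D) (at t within S)"
  unfolding has_vector_derivative_def has_derivative_iff_norm
proof
  show "bounded_linear (\<lambda>x. x *\<^sub>R D)" by (rule bounded_linear_scaleR_left)
  have "((\<lambda>s. norm ((f s - f t) / of_real (s - t) - D)) \<longlongrightarrow> 0) (at t within S)"
    using assms by (simp add: LIM_zero tendsto_norm_zero)
  then show "((\<lambda>y. norm (f y - f t - (y - t) *\<^sub>R D) / norm (y - t)) \<longlongrightarrow> 0) (at t within S)"
  proof (rule Lim_transform_eventually)
    show "\<forall>\<^sub>F s in at t within S. norm ((f s - f t) / of_real (s - t) - D)
        = norm (f s - f t - (s - t) *\<^sub>R D) / norm (s - t)"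
      unfolding eventually_at_filter
    proof (intro always_eventually allI impI)
      fix s assume "s \<noteq> t"
      then have "(f s - f t) / of_real (s - t) - D = (f s - f t - (s - t) *\<^sub>R D) / of_real (s - t)"
        by (simp add: scaleR_conv_of_real diff_divide_distrib)
      then show "norm ((f s - f t) / of_real (s - t) - D) = norm (f s - f t - (s - t) *\<^sub>R D) / norm (s - t)"
        by (simp only: norm_divide norm_of_real real_norm_def)
    qed
  qed
qed

text \<open>In the product rule the quotient of \<open>P\<close> is paired with \<open>Q s\<close>
  rather than \<open>Q t\<close>, so the L2 continuity of \<open>Q\<close> enters.\<close>

lemma L2_deriv_mult:
  fixes P Q :: "real \<Rightarrow> real ^ 'd \<Rightarrow> complex"
  assumes P: "\<And>s. s \<ge> 0 \<Longrightarrow> P s \<in> L2" and P': "P' \<in> L2" and dP: "L2_deriv P P' t"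
    and Q: "\<And>s. s \<ge> 0 \<Longrightarrow> Q s \<in> L2" and Q': "Q' \<in> L2" and dQ: "L2_deriv Q Q' t" and t: "t \<ge> 0"
  shows "((\<lambda>s. LINT \<xi>|lborel. P s \<xi> * Q s \<xi>) has_vector_derivative
    (LINT \<xi>|lborel. P' \<xi> * Q t \<xi>) + (LINT \<xi>|lborel. P t \<xi> * Q' \<xi>)) (at t within {0..})"
proof (rule has_vector_derivative_quotientI)
  let ?F = "at t within {0..}"
  let ?p = "\<lambda>s \<xi>. (P s \<xi> - P t \<xi>) / of_real (s - t)" and ?q = "\<lambda>s \<xi>. (Q s \<xi> - Q t \<xi>) / of_real (s - t)"
  have p: "?p s \<in> L2" and q: "?q s \<in> L2" if "s \<ge> 0" for s
    using L2_difference_quotient[OF P that t] L2_difference_quotient[OF Q that t] by auto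
  have 1: "((\<lambda>s. LINT \<xi>|lborel. ?p s \<xi> * Q s \<xi>) \<longlongrightarrow> (LINT \<xi>|lborel. P' \<xi> * Q t \<xi>)) ?F"
    using p Q P' t dP L2_deriv_continuous[OF Q Q' t dQ]
    by (intro L2_mult_tendsto eventually_atLeast_within) (auto simp: L2_deriv_def)
  have 2: "((\<lambda>s. LINT \<xi>|lborel. P t \<xi> * ?q s \<xi>) \<longlongrightarrow> (LINT \<xi>|lborel. P t \<xi> * Q' \<xi>)) ?F"
    using q P Q' t dQ
    by (intro L2_mult_tendsto eventually_atLeast_within) (auto simp: L2_deriv_def L2_norm_def)
  show "((\<lambda>s. ((LINT \<xi>|lborel. P s \<xi> * Q s \<xi>) - (LINT \<xi>|lborel. P t \<xi> * Q t \<xi>)) / of_real (s - t))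
      \<longlongrightarrow> (LINT \<xi>|lborel. P' \<xi> * Q t \<xi>) + (LINT \<xi>|lborel. P t \<xi> * Q' \<xi>)) ?F"
  proof (rule Lim_transform_eventually[OF tendsto_add[OF 1 2]], rule eventually_atLeast_within)
    fix s :: real assume s: "s \<ge> 0" "s \<noteq> t"
    have "(LINT \<xi>|lborel. ?p s \<xi> * Q s \<xi>) + (LINT \<xi>|lborel. P t \<xi> * ?q s \<xi>)
        = (LINT \<xi>|lborel. ?p s \<xi> * Q s \<xi> + P t \<xi> * ?q s \<xi>)"
      using p[OF s(1)] q[OF s(1)] P[OF t] Q[OF s(1)]
      by (intro Bochner_Integration.integral_add[symmetric] L2_mult_integrable)
    also have "\<dots> = (LINT \<xi>|lborel. (P s \<xi> * Q s \<xi> - P t \<xi> * Q t \<xi>) / of_real (s - t))"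
      by (intro Bochner_Integration.integral_cong refl)
        (simp only: times_divide_eq_left times_divide_eq_right add_divide_distrib[symmetric], simp add: algebra_simps)
    also have "\<dots> = ((LINT \<xi>|lborel. P s \<xi> * Q s \<xi>) - (LINT \<xi>|lborel. P t \<xi> * Q t \<xi>)) / of_real (s - t)"
      using P[OF s(1)] Q[OF s(1)] P[OF t] Q[OF t] by (simp add: L2_mult_integrable)
    finally show "(LINT \<xi>|lborel. ?p s \<xi> * Q s \<xi>) + (LINT \<xi>|lborel. P t \<xi> * ?q s \<xi>)
        = ((LINT \<xi>|lborel. P s \<xi> * Q s \<xi>) - (LINT \<xi>|lborel. P t \<xi> * Q t \<xi>)) / of_real (s - t)" .
  qed
qed

text \<open>On the support of \<open>\<psi>\<close> the frequency is at most \<open>R\<close>, so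
  the mean value theorem bounds the difference quotients by \<open>M\<close>, and 2 M |\<psi>|
  dominates. Dominated convergence is stated for sequences, hence the passage to \<open>X\<close>;
  its tail stays in the time window on which \<open>M\<close> is valid.\<close>

lemma L2_deriv_multiplier:
  fixes \<psi> :: "real ^ 'd \<Rightarrow> complex" and a a' :: "real \<Rightarrow> real \<Rightarrow> real"
  assumes \<psi>: "\<psi> \<in> L2" and supp: "\<And>\<xi>. norm \<xi> > R \<Longrightarrow> \<psi> \<xi> = 0" and t: "t \<ge> 0"
    and a: "\<And>s. a s \<in> borel_measurable borel" "\<And>s. a' s \<in> borel_measurable borel"
    and d: "\<And>s \<rho>. s \<ge> 0 \<Longrightarrow> ((\<lambda>s. a s \<rho>) has_real_derivative a' s \<rho>) (at s within {0..})"
    and M: "\<And>s \<rho>. 0 \<le> s \<Longrightarrow> s \<le> t + 1 \<Longrightarrow> 0 \<le> \<rho> \<Longrightarrow> \<rho> \<le> R \<Longrightarrow> \<bar>a' s \<rho>\<bar> \<le> M"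
  shows "L2_deriv (\<lambda>s \<xi>. \<psi> \<xi> * of_real (a s (norm \<xi>))) (\<lambda>\<xi>. \<psi> \<xi> * of_real (a' t (norm \<xi>))) t"
  unfolding L2_deriv_def
proof (subst tendsto_at_iff_sequentially, intro allI impI)
  fix X assume X: "\<forall>i. X i \<in> {0..} - {t}" "X \<longlonglongrightarrow> t"
  note [measurable] = L2_measurable[OF \<psi>] a
  let ?f = "\<lambda>s \<xi>. (\<psi> \<xi> * of_real (a s (norm \<xi>)) - \<psi> \<xi> * of_real (a t (norm \<xi>))) / of_real (s - t)
    - \<psi> \<xi> * of_real (a' t (norm \<xi>))"
  have f: "?f s \<xi> = \<psi> \<xi> * of_real ((a s (norm \<xi>) - a t (norm \<xi>)) / (s - t) - a' t (norm \<xi>))" for s \<xi>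
    by (simp add: diff_divide_distrib right_diff_distrib)
  have "\<forall>\<^sub>F i in sequentially. X i < t + 1" by (rule order_tendstoD(2)[OF X(2)]) simp
  then obtain N where N: "\<And>i. i \<ge> N \<Longrightarrow> X i < t + 1" by (auto simp: eventually_sequentially)
  have "(\<lambda>n. L2_norm (?f (X (n + N)))) \<longlonglongrightarrow> 0"
  proof (rule L2_dominated_convergence[OF _ L2_scale[OF \<psi>, of "of_real (2 * M)"]])
    show "?f (X (n + N)) \<in> borel_measurable lborel" for n
      unfolding f[abs_def] by measurable
    show "AE \<xi> in lborel. norm (?f (X (n + N)) \<xi>) \<le> norm (of_real (2 * M) * \<psi> \<xi>)" for n
    proof (rule AE_I2)
      fix \<xi> :: "real ^ 'd"
      let ?s = "X (n + N)"
      have s: "0 \<le> ?s" "?s \<le> t + 1" "?s \<noteq> t" using X(1) N[of "n + N"] by (auto dest: spec[of _ "n + N"])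
      show "norm (?f ?s \<xi>) \<le> norm (of_real (2 * M) * \<psi> \<xi>)"
      proof (cases "norm \<xi> > R")
        case False
        let ?\<rho> = "norm \<xi>"
        have "((\<lambda>s. a s ?\<rho>) has_real_derivative a' r ?\<rho>) (at r within {0..t + 1})" if "r \<in> {0..t + 1}" for r
          using d[of r ?\<rho>] that by (auto intro: has_field_derivative_subset)
        then have "norm (a ?s ?\<rho> - a t ?\<rho>) \<le> M * norm (?s - t)"
          using s t False M by (intro field_differentiable_bound[of "{0..t + 1}" _ "\<lambda>s. a' s ?\<rho>"]) auto
        then have "\<bar>(a ?s ?\<rho> - a t ?\<rho>) / (?s - t)\<bar> \<le> M"
          using s by (simp add: abs_divide divide_le_eq)
        moreover have "\<bar>a' t ?\<rho>\<bar> \<le> M" using M[of t ?\<rho>] t False by simp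
        ultimately have le: "\<bar>(a ?s ?\<rho> - a t ?\<rho>) / (?s - t) - a' t ?\<rho>\<bar> \<le> \<bar>2 * M\<bar>" by linarith
        show ?thesis
          unfolding f norm_mult norm_of_real
          by (subst mult.commute, rule mult_right_mono[OF le]) simp
      qed (simp add: supp)
    qed
    show "AE \<xi> in lborel. (\<lambda>n. ?f (X (n + N)) \<xi>) \<longlonglongrightarrow> 0"
    proof (rule AE_I2)
      fix \<xi> :: "real ^ 'd"
      let ?\<rho> = "norm \<xi>"
      have "((\<lambda>s. (a s ?\<rho> - a t ?\<rho>) / (s - t)) \<longlongrightarrow> a' t ?\<rho>) (at t within {0..})"
        using d[OF t, of ?\<rho>] by (simp add: has_field_derivative_iff)
      with X have "(\<lambda>n. (a (X n) ?\<rho> - a t ?\<rho>) / (X n - t)) \<longlonglongrightarrow> a' t ?\<rho>"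
        by (auto simp: tendsto_at_iff_sequentially o_def)
      then have "(\<lambda>n. (a (X (n + N)) ?\<rho> - a t ?\<rho>) / (X (n + N) - t)) \<longlonglongrightarrow> a' t ?\<rho>"
        by (rule LIMSEQ_ignore_initial_segment)
      then have "(\<lambda>n. \<psi> \<xi> * of_real ((a (X (n + N)) ?\<rho> - a t ?\<rho>) / (X (n + N) - t) - a' t ?\<rho>))
          \<longlonglongrightarrow> \<psi> \<xi> * of_real (a' t ?\<rho> - a' t ?\<rho>)"
        by (intro tendsto_intros)
      then show "(\<lambda>n. ?f (X (n + N)) \<xi>) \<longlonglongrightarrow> 0" unfolding f by simp
    qed
  qed
  then show "((\<lambda>s. L2_norm (?f s)) \<circ> X) \<longlonglongrightarrow> 0"
    unfolding o_def by (rule LIMSEQ_offset)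
qed

text \<open>Bounds uniform in the frequencies up to \<open>R\<close>: the energy at time 0 controls
  W', and integration in time then controls W.\<close>

lemma mode_ode_bound:
  fixes W W' :: "real \<Rightarrow> real"
  assumes ode: "mode_ode \<mu> \<rho> W W'" and \<mu>: "\<mu> > 0" and \<rho>: "0 \<le> \<rho>" "\<rho> \<le> R" and s: "0 \<le> s" "s \<le> T"
    and W0: "\<bar>W 0\<bar> \<le> 1" "\<bar>W' 0\<bar> \<le> 1"
  defines "M \<equiv> 1 + (R\<^sup>2 + \<mu>)"
  shows "\<bar>W' s\<bar> \<le> M" "\<bar>W s\<bar> \<le> 1 + M * T" "\<bar>(\<rho>\<^sup>2 + \<mu> / (1 + s)\<^sup>2) * W s\<bar> \<le> M * (1 + M * T)"
proof -
  have R2: "\<rho>\<^sup>2 \<le> R\<^sup>2" using \<rho> by (intro power_mono)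
  have M1: "M \<ge> 1" using \<mu> by (simp add: M_def)
  have W': "\<bar>W' r\<bar> \<le> M" if r: "r \<ge> 0" for r
  proof -
    have "(W' r)\<^sup>2 \<le> (norm (W' r))\<^sup>2 + (\<rho>\<^sup>2 + \<mu> / (1 + r)\<^sup>2) * (norm (W r))\<^sup>2"
      using \<mu> by simp
    also have "\<dots> \<le> (norm (W' 0))\<^sup>2 + (\<rho>\<^sup>2 + \<mu> / (1 + 0)\<^sup>2) * (norm (W 0))\<^sup>2"
      by (rule mode_energy_decreasing[OF ode]) (use \<mu> r in auto)
    also have "\<dots> \<le> 1 + (R\<^sup>2 + \<mu>) * 1"
      using W0 R2 \<mu> by (intro add_mono mult_mono) (auto simp: abs_square_le_1)
    also have "\<dots> = M * 1" by (simp add: M_def)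
    also have "\<dots> \<le> M\<^sup>2" unfolding power2_eq_square using M1 by (intro mult_left_mono) auto
    finally have "(\<bar>W' r\<bar>)\<^sup>2 \<le> M\<^sup>2" by simp
    then show ?thesis by (rule power2_le_imp_le) (use M1 in simp)
  qed
  show "\<bar>W' s\<bar> \<le> M" by (rule W'[OF s(1)])
  have "norm (W s - W 0) \<le> M * norm (s - 0)"
  proof (rule field_differentiable_bound[of "{0..s}" W W'])
    show "(W has_real_derivative W' r) (at r within {0..s})" if "r \<in> {0..s}" for r
      using ode that by (auto simp: mode_ode_def has_real_derivative_iff_has_vector_derivative
          intro: has_vector_derivative_within_subset)
  qed (use s W' in auto)
  moreover have "M * s \<le> M * T" using s M1 by (intro mult_left_mono) auto
  ultimately show Wb: "\<bar>W s\<bar> \<le> 1 + M * T" using W0 s by auto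
  have "\<mu> / (1 + s)\<^sup>2 \<le> \<mu> / 1"
    using s \<mu> by (intro divide_left_mono) auto
  then have "\<bar>\<rho>\<^sup>2 + \<mu> / (1 + s)\<^sup>2\<bar> \<le> M"
    using R2 \<mu> by (simp add: M_def)
  then show "\<bar>(\<rho>\<^sup>2 + \<mu> / (1 + s)\<^sup>2) * W s\<bar> \<le> M * (1 + M * T)"
    unfolding abs_mult using Wb M1 by (intro mult_mono) auto
qed

text \<open>
  The Wronskian is differentiated after pairing with a compactly supported \<open>\<psi>\<close>; since \<open>q\<close> is
  differentiable only in the weighted space, the weight is moved to \<open>\<psi>\<close>.
\<close>

lemma Wronskian_constant:
  fixes p q :: "real \<Rightarrow> real ^ 'd \<Rightarrow> complex" and W W' :: "real \<Rightarrow> real \<Rightarrow> real"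
  assumes \<mu>: "\<mu> > 0"
    and p: "\<And>t. t \<ge> 0 \<Longrightarrow> p t \<in> L2" and q: "\<And>t. t \<ge> 0 \<Longrightarrow> q t \<in> L2"
    and pH: "\<And>t. t \<ge> 0 \<Longrightarrow> (\<lambda>\<xi>. of_real (sqrt (1 + (norm \<xi>)\<^sup>2)) * p t \<xi>) \<in> L2"
    and dp: "\<And>t. t \<ge> 0 \<Longrightarrow> L2_deriv p (q t) t"
    and cq: "\<And>t. t \<ge> 0 \<Longrightarrow> ((\<lambda>s. L2_norm (\<lambda>\<xi>. q s \<xi> - q t \<xi>)) \<longlongrightarrow> 0) (at t within {0..})"
    and dq: "\<And>t. t > 0 \<Longrightarrow> L2_deriv (\<lambda>s \<xi>. q s \<xi> / of_real (sqrt (1 + (norm \<xi>)\<^sup>2)))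
        (\<lambda>\<xi>. - of_real ((norm \<xi>)\<^sup>2 + \<mu> / (1 + t)\<^sup>2) * p t \<xi> / of_real (sqrt (1 + (norm \<xi>)\<^sup>2))) t"
    and W: "\<And>t. W t \<in> borel_measurable borel" "\<And>t. W' t \<in> borel_measurable borel"
    and ode: "\<And>\<rho>. mode_ode \<mu> \<rho> (\<lambda>t. W t \<rho>) (\<lambda>t. W' t \<rho>)"
    and W0: "\<And>\<rho>. \<bar>W 0 \<rho>\<bar> \<le> 1" "\<And>\<rho>. \<bar>W' 0 \<rho>\<bar> \<le> 1"
    and t: "t > 0"
  shows "AE \<xi> in lborel. of_real (W' t (norm \<xi>)) * p t \<xi> - of_real (W t (norm \<xi>)) * q t \<xi>
    = of_real (W' 0 (norm \<xi>)) * p 0 \<xi> - of_real (W 0 (norm \<xi>)) * q 0 \<xi>"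
proof -
  let ?om = "\<lambda>\<xi>::real ^ 'd. complex_of_real (sqrt (1 + (norm \<xi>)\<^sup>2))"
  let ?c = "\<lambda>s \<rho>. \<rho>\<^sup>2 + \<mu> / (1 + s)\<^sup>2"
  have om0: "?om \<xi> \<noteq> 0" for \<xi> :: "real ^ 'd"
    using power2_norm_eq_inner by (simp add: add_nonneg_eq_0_iff)
  have om1: "norm (?om \<xi>) \<ge> 1" for \<xi> :: "real ^ 'd" by simp
  define W'' where "W'' s \<rho> = - (?c s \<rho> * W s \<rho>)" for s \<rho>
  have W''m: "W'' s \<in> borel_measurable borel" for s
    unfolding W''_def[abs_def] using W(1)[of s] by measurable
  have dW: "((\<lambda>s. W s \<rho>) has_real_derivative W' s \<rho>) (at s within {0..})"
    and dW': "((\<lambda>s. W' s \<rho>) has_real_derivative W'' s \<rho>) (at s within {0..})" if "s \<ge> 0" for s \<rho>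
    using ode[of \<rho>] that
    by (auto simp: mode_ode_def has_real_derivative_iff_has_vector_derivative W''_def algebra_simps)
  have ball: "AE \<xi> in lborel. norm \<xi> \<le> R \<longrightarrow>
      of_real (W' t (norm \<xi>)) * p t \<xi> - of_real (W t (norm \<xi>)) * q t \<xi>
      - (of_real (W' 0 (norm \<xi>)) * p 0 \<xi> - of_real (W 0 (norm \<xi>)) * q 0 \<xi>) = 0" if R: "R \<ge> 0" for R
  proof -
    define g where "g \<xi> = of_real (W' t (norm \<xi>)) * p t \<xi> - of_real (W t (norm \<xi>)) * q t \<xi>
      - (of_real (W' 0 (norm \<xi>)) * p 0 \<xi> - of_real (W 0 (norm \<xi>)) * q 0 \<xi>)" for \<xi>
    \<comment> \<open>A common bound for \<open>W\<close>, \<open>W'\<close> and \<open>W''\<close>;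
      the one for \<open>W'\<close> is below the one for \<open>W''\<close>.\<close>
    define B where "B s = max (1 + (1 + (R\<^sup>2 + \<mu>)) * s) ((1 + (R\<^sup>2 + \<mu>)) * (1 + (1 + (R\<^sup>2 + \<mu>)) * s))" for s
    have B: "\<bar>W s \<rho>\<bar> \<le> B T" "\<bar>W' s \<rho>\<bar> \<le> B T" "\<bar>W'' s \<rho>\<bar> \<le> B T"
      if "0 \<le> \<rho>" "\<rho> \<le> R" "0 \<le> s" "s \<le> T" for s \<rho> T
    proof -
      note b = mode_ode_bound[OF ode \<mu> that W0]
      show "\<bar>W s \<rho>\<bar> \<le> B T" using b(2) by (simp add: B_def)
      show "\<bar>W'' s \<rho>\<bar> \<le> B T" using b(3) by (simp add: B_def W''_def)
      have "1 + (R\<^sup>2 + \<mu>) \<le> (1 + (R\<^sup>2 + \<mu>)) * (1 + (1 + (R\<^sup>2 + \<mu>)) * T)"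
      proof -
        have "1 + (R\<^sup>2 + \<mu>) \<ge> 0" using \<mu> by simp
        moreover from this have "1 \<le> 1 + (1 + (R\<^sup>2 + \<mu>)) * T" using that by simp
        ultimately show ?thesis using mult_left_mono[of 1 _ "1 + (R\<^sup>2 + \<mu>)"] by fastforce
      qed
      then show "\<bar>W' s \<rho>\<bar> \<le> B T" using b(1) by (simp add: B_def)
    qed
    have loc: "(\<lambda>\<xi>. indicator (cball 0 R) \<xi> * of_real (a (norm \<xi>)) * f \<xi>) \<in> L2"
      if "f \<in> L2" "a \<in> borel_measurable borel" "\<And>\<rho>. 0 \<le> \<rho> \<Longrightarrow> \<rho> \<le> R \<Longrightarrow> \<bar>a \<rho>\<bar> \<le> K"
      for f :: "real ^ 'd \<Rightarrow> complex" and a :: "real \<Rightarrow> real" and K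
    proof (rule L2_dominated[OF that(1), of _ K])
      note [measurable] = L2_measurable[OF that(1)] that(2)
      have [measurable]: "(indicator (cball 0 R) :: real ^ 'd \<Rightarrow> complex) \<in> borel_measurable lborel"
        by (auto intro!: borel_measurable_indicator)
      show "(\<lambda>\<xi>. indicator (cball 0 R) \<xi> * of_real (a (norm \<xi>)) * f \<xi>) \<in> borel_measurable lborel"
        by measurable
      have "K \<ge> 0" using that(3)[of 0] R by simp
      then show "AE \<xi> in lborel. norm (indicator (cball 0 R) \<xi> * of_real (a (norm \<xi>)) * f \<xi>) \<le> K * norm (f \<xi>)"
        using that(3) by (intro AE_I2) (auto simp: norm_mult indicator_def intro!: mult_right_mono)
    qed
    \<comment> \<open>The test function is the conjugate of the Wronskian difference itself,
      restricted to the ball. The pairing with it changes between 0 and \<open>t\<close> by the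
      squared norm of \<open>\<psi>\<close>, so a constant pairing forces \<open>\<psi>\<close> to
      vanish.\<close>
    define \<psi> where "\<psi> \<xi> = cnj (indicator (cball 0 R) \<xi> * g \<xi>)" for \<xi>
    have "(\<lambda>\<xi>. indicator (cball 0 R) \<xi> * of_real (W' t (norm \<xi>)) * p t \<xi>
        - indicator (cball 0 R) \<xi> * of_real (W t (norm \<xi>)) * q t \<xi>
        - (indicator (cball 0 R) \<xi> * of_real (W' 0 (norm \<xi>)) * p 0 \<xi>
          - indicator (cball 0 R) \<xi> * of_real (W 0 (norm \<xi>)) * q 0 \<xi>)) \<in> L2"
      using t B(1,2)[of _ t t] B(1,2)[of _ 0 0] by (intro L2_diff loc p q W) auto
    then have "(\<lambda>\<xi>. indicator (cball 0 R) \<xi> * g \<xi>) \<in> L2"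
      by (simp add: g_def algebra_simps)
    then have \<psi>: "\<psi> \<in> L2" unfolding \<psi>_def[abs_def] by (rule L2_cnj)
    have \<psi>0: "\<psi> \<xi> = 0" if "norm \<xi> > R" for \<xi> using that by (simp add: \<psi>_def)
    have om_meas: "?om \<in> borel_measurable lborel"
    proof -
      have "?om \<in> borel_measurable borel"
        by (intro borel_measurable_continuous_onI continuous_intros)
      then show ?thesis by simp
    qed
    define \<eta> where "\<eta> \<xi> = \<psi> \<xi> * ?om \<xi>" for \<xi>
    have \<eta>0: "\<eta> \<xi> = 0" if "norm \<xi> > R" for \<xi> using \<psi>0[OF that] by (simp add: \<eta>_def)
    have \<eta>L: "\<eta> \<in> L2"
    proof (rule L2_dominated[OF \<psi>, of _ "sqrt (1 + R\<^sup>2)"])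
      show "\<eta> \<in> borel_measurable lborel"
        unfolding \<eta>_def[abs_def] using L2_measurable[OF \<psi>] om_meas by (rule borel_measurable_times)
      show "AE \<xi> in lborel. norm (\<eta> \<xi>) \<le> sqrt (1 + R\<^sup>2) * norm (\<psi> \<xi>)"
      proof (rule AE_I2)
        fix \<xi> :: "real ^ 'd"
        show "norm (\<eta> \<xi>) \<le> sqrt (1 + R\<^sup>2) * norm (\<psi> \<xi>)"
        proof (cases "norm \<xi> > R")
          case False
          then have "sqrt (1 + (norm \<xi>)\<^sup>2) \<le> sqrt (1 + R\<^sup>2)"
            by (intro real_sqrt_le_mono add_left_mono power_mono) auto
          then show ?thesis
            by (simp add: \<eta>_def norm_mult mult.commute[of "norm (\<psi> \<xi>)"] mult_right_mono)
        qed (simp add: \<eta>0 \<psi>0)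
      qed
    qed
    define P1 where "P1 s \<xi> = \<psi> \<xi> * of_real (W' s (norm \<xi>))" for s \<xi>
    define P2 where "P2 s \<xi> = \<eta> \<xi> * of_real (W s (norm \<xi>))" for s \<xi>
    define Q where "Q s \<xi> = q s \<xi> / ?om \<xi>" for s \<xi>
    have mult: "(\<lambda>\<xi>. f \<xi> * of_real (a (norm \<xi>))) \<in> L2"
      if f: "f \<in> L2" "\<And>\<xi>. norm \<xi> > R \<Longrightarrow> f \<xi> = 0" and a: "a \<in> borel_measurable borel"
        "\<And>\<rho>. 0 \<le> \<rho> \<Longrightarrow> \<rho> \<le> R \<Longrightarrow> \<bar>a \<rho>\<bar> \<le> K"
      for f :: "real ^ 'd \<Rightarrow> complex" and a :: "real \<Rightarrow> real" and K
    proof -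
      have "(\<lambda>\<xi>. indicator (cball 0 R) \<xi> * of_real (a (norm \<xi>)) * f \<xi>) \<in> L2"
        by (rule loc[OF f(1) a])
      also have "(\<lambda>\<xi>. indicator (cball 0 R) \<xi> * of_real (a (norm \<xi>)) * f \<xi>) = (\<lambda>\<xi>. f \<xi> * of_real (a (norm \<xi>)))"
      proof
        fix \<xi> show "indicator (cball 0 R) \<xi> * of_real (a (norm \<xi>)) * f \<xi> = f \<xi> * of_real (a (norm \<xi>))"
          using f(2)[of \<xi>] by (cases "norm \<xi> > R") auto
      qed
      finally show ?thesis .
    qed
    have P1L: "P1 s \<in> L2" and P2L: "P2 s \<in> L2"
      and P1'L: "(\<lambda>\<xi>. \<psi> \<xi> * of_real (W'' s (norm \<xi>))) \<in> L2"
      and P2'L: "(\<lambda>\<xi>. \<eta> \<xi> * of_real (W' s (norm \<xi>))) \<in> L2" if "s \<ge> 0" for s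
      unfolding P1_def[abs_def] P2_def[abs_def] using that B[of _ s s]
      by (auto intro!: mult \<psi> \<psi>0 \<eta>L \<eta>0 W W''m)
    have dP1: "L2_deriv P1 (\<lambda>\<xi>. \<psi> \<xi> * of_real (W'' s (norm \<xi>))) s"
      and dP2: "L2_deriv P2 (\<lambda>\<xi>. \<eta> \<xi> * of_real (W' s (norm \<xi>))) s" if "s \<ge> 0" for s
    proof -
      show "L2_deriv P1 (\<lambda>\<xi>. \<psi> \<xi> * of_real (W'' s (norm \<xi>))) s"
        unfolding P1_def[abs_def]
        by (rule L2_deriv_multiplier[OF \<psi> \<psi>0 that W(2) W''m dW' B(3)])
      show "L2_deriv P2 (\<lambda>\<xi>. \<eta> \<xi> * of_real (W' s (norm \<xi>))) s"
        unfolding P2_def[abs_def]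
        by (rule L2_deriv_multiplier[OF \<eta>L \<eta>0 that W(1) W(2) dW B(2)])
    qed
    have om_le: "norm (z / ?om \<xi>) \<le> norm z" for z \<xi>
      using om1[of \<xi>] by (simp add: norm_divide divide_le_eq mult_le_cancel_left1 del: norm_of_real)
    have div_om: "(\<lambda>\<xi>. f \<xi> / ?om \<xi>) \<in> L2 \<and> L2_norm (\<lambda>\<xi>. f \<xi> / ?om \<xi>) \<le> L2_norm f" if "f \<in> L2" for f
    proof -
      have m: "(\<lambda>\<xi>. f \<xi> / ?om \<xi>) \<in> borel_measurable lborel"
        using L2_measurable[OF that] om_meas by (rule borel_measurable_divide)
      have le: "AE \<xi> in lborel. norm (f \<xi> / ?om \<xi>) \<le> norm (f \<xi>)" by (intro AE_I2 om_le)
      show ?thesis using L2_dominated[OF that m, of 1] L2_norm_mono[OF that m le] le by simp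
    qed
    have QL: "Q s \<in> L2" if "s \<ge> 0" for s
      unfolding Q_def[abs_def] using div_om[OF q[OF that]] by blast
    define Q' where "Q' s \<xi> = - of_real (?c s (norm \<xi>)) * p s \<xi> / ?om \<xi>" for s \<xi>
    \<comment> \<open>After division by the weight, the coefficient is at most (1 + \<mu>) sqrt (1 +
      |\<xi>|^2), which the H^1 regularity of the solution absorbs.\<close>
    have Q'L: "Q' s \<in> L2" if s: "s \<ge> 0" for s
    proof (rule L2_dominated[OF pH[OF s], of _ "1 + \<mu>"])
      note [measurable] = L2_measurable[OF p[OF s]] om_meas
      show "Q' s \<in> borel_measurable lborel" unfolding Q'_def[abs_def] by measurable
      show "AE \<xi> in lborel. norm (Q' s \<xi>) \<le> (1 + \<mu>) * norm (?om \<xi> * p s \<xi>)"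
      proof (rule AE_I2)
        fix \<xi> :: "real ^ 'd"
        let ?z = "sqrt (1 + (norm \<xi>)\<^sup>2)"
        have z: "?z > 0" "?z * ?z = 1 + (norm \<xi>)\<^sup>2"
          by (auto simp: add_pos_nonneg)
        have "\<mu> / (1 + s)\<^sup>2 \<le> \<mu> / 1" using s \<mu> by (intro divide_left_mono) auto
        moreover have "\<mu> * (norm \<xi>)\<^sup>2 \<ge> 0" using \<mu> by simp
        ultimately have "?c s (norm \<xi>) \<le> (1 + \<mu>) * (?z * ?z)"
          unfolding z(2) by (simp add: algebra_simps)
        then have "\<bar>?c s (norm \<xi>)\<bar> / ?z \<le> (1 + \<mu>) * ?z"
          using z(1) \<mu> by (simp add: divide_le_eq mult.assoc)
        then have "\<bar>?c s (norm \<xi>)\<bar> / ?z * norm (p s \<xi>) \<le> (1 + \<mu>) * ?z * norm (p s \<xi>)"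
          by (rule mult_right_mono) simp
        then show "norm (Q' s \<xi>) \<le> (1 + \<mu>) * norm (?om \<xi> * p s \<xi>)"
          unfolding Q'_def norm_divide norm_mult norm_minus_cancel norm_of_real
          using z(1) by (simp add: mult_ac)
      qed
    qed
    have dQ: "L2_deriv Q (Q' s) s" if "s > 0" for s
      unfolding Q_def[abs_def] Q'_def[abs_def] by (rule dq[OF that])
    have cQ: "((\<lambda>r. L2_norm (\<lambda>\<xi>. Q r \<xi> - Q s \<xi>)) \<longlongrightarrow> 0) (at s within {0..})" if s: "s \<ge> 0" for s
    proof (rule tendsto_sandwich[OF _ _ tendsto_const cq[OF s]])
      show "\<forall>\<^sub>F r in at s within {0..}. L2_norm (\<lambda>\<xi>. Q r \<xi> - Q s \<xi>) \<le> L2_norm (\<lambda>\<xi>. q r \<xi> - q s \<xi>)"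
        using div_om[OF L2_diff[OF q q[OF s]]]
        by (intro eventually_atLeast_within) (simp add: Q_def diff_divide_distrib)
    qed simp
    define I where "I s = (LINT \<xi>|lborel. P1 s \<xi> * p s \<xi>) - (LINT \<xi>|lborel. P2 s \<xi> * Q s \<xi>)" for s
    have dI: "(I has_vector_derivative 0) (at s)" if s: "s > 0" for s
    proof -
      have s0: "s \<ge> 0" using s by simp
      have "(I has_vector_derivative
          ((LINT \<xi>|lborel. (\<psi> \<xi> * of_real (W'' s (norm \<xi>))) * p s \<xi>) + (LINT \<xi>|lborel. P1 s \<xi> * q s \<xi>))
          - ((LINT \<xi>|lborel. (\<eta> \<xi> * of_real (W' s (norm \<xi>))) * Q s \<xi>) + (LINT \<xi>|lborel. P2 s \<xi> * Q' s \<xi>)))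
          (at s within {0..})"
        unfolding I_def
        using s0 s by (intro has_vector_derivative_diff L2_deriv_mult P1L P2L P1'L P2'L dP1 dP2 dp dQ p q QL Q'L)
      \<comment> \<open>The four terms cancel in pairs: those with one derivative on each factor
        agree, and those with two derivatives on one factor agree by the common equation.\<close>
      also have "(\<lambda>\<xi>. (\<eta> \<xi> * of_real (W' s (norm \<xi>))) * Q s \<xi>) = (\<lambda>\<xi>. P1 s \<xi> * q s \<xi>)"
        using om0 by (auto simp: \<eta>_def Q_def P1_def)
      also have "(\<lambda>\<xi>. P2 s \<xi> * Q' s \<xi>) = (\<lambda>\<xi>. (\<psi> \<xi> * of_real (W'' s (norm \<xi>))) * p s \<xi>)"
      proof
        fix \<xi> :: "real ^ 'd"
        have gen: "(a * z * b) * (- k * d / z) = (a * (- k * b)) * d" if "z \<noteq> 0" for a b d k z :: complex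
          using that by simp
        have Wc: "complex_of_real (W'' s (norm \<xi>)) = - complex_of_real (?c s (norm \<xi>)) * of_real (W s (norm \<xi>))"
          unfolding W''_def by (simp only: of_real_minus of_real_mult mult_minus_left)
        show "P2 s \<xi> * Q' s \<xi> = (\<psi> \<xi> * of_real (W'' s (norm \<xi>))) * p s \<xi>"
          unfolding Wc P2_def \<eta>_def Q'_def by (rule gen[OF om0])
      qed
      finally have "(I has_vector_derivative 0) (at s within {0..})"
        by (simp add: add.commute)
      moreover have "at s within {0..} = at s" using s by (intro at_within_interior) auto
      ultimately show ?thesis by simp
    qed
    \<comment> \<open>The equation, and with it \<open>dI\<close>, is available only for s > 0;
      continuity of the pairing up to 0 connects it with the initial data.\<close>
    have cI: "continuous_on {0..t} I"
    proof (rule continuous_on_subset[of "{0..}"])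
      show "continuous_on {0..} I"
        unfolding continuous_on_def
      proof
        fix s :: real assume "s \<in> {0..}"
        then have s: "s \<ge> 0" by simp
        show "(I \<longlongrightarrow> I s) (at s within {0..})"
          unfolding I_def
          by (intro tendsto_diff L2_mult_tendsto eventually_atLeast_within P1L P2L p QL s cQ
              L2_deriv_continuous[OF P1L P1'L s dP1] L2_deriv_continuous[OF P2L P2'L s dP2]
              L2_deriv_continuous[OF p q s dp])
      qed
    qed auto
    have "norm (I t - I 0) \<le> 0 - (0 :: real)"
      by (rule differentiable_bound_general[OF t cI, of "\<lambda>_. 0" "\<lambda>_. 0" "\<lambda>_. 0"]) (auto intro: dI)
    then have "I t - I 0 = 0" by simp
    moreover have "I t - I 0 = of_real ((L2_norm \<psi>)\<^sup>2)"
    proof -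
      have int: "integrable lborel (\<lambda>\<xi>. P1 s \<xi> * p s \<xi>)" "integrable lborel (\<lambda>\<xi>. P2 s \<xi> * Q s \<xi>)" if "s \<ge> 0" for s
        using that by (auto intro!: L2_mult_integrable P1L P2L p QL)
      have "I t - I 0 = (LINT \<xi>|lborel. (P1 t \<xi> * p t \<xi> - P2 t \<xi> * Q t \<xi>) - (P1 0 \<xi> * p 0 \<xi> - P2 0 \<xi> * Q 0 \<xi>))"
        using int[of t] int[of 0] t by (simp add: I_def)
      also have "\<dots> = (LINT \<xi>|lborel. complex_of_real ((norm (\<psi> \<xi>))\<^sup>2))"
      proof (intro Bochner_Integration.integral_cong refl)
        fix \<xi> :: "real ^ 'd"
        have "P2 s \<xi> * Q s \<xi> = \<psi> \<xi> * (of_real (W s (norm \<xi>)) * q s \<xi>)" for s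
          using om0[of \<xi>] by (simp add: P2_def Q_def \<eta>_def)
        then have "(P1 t \<xi> * p t \<xi> - P2 t \<xi> * Q t \<xi>) - (P1 0 \<xi> * p 0 \<xi> - P2 0 \<xi> * Q 0 \<xi>) = \<psi> \<xi> * g \<xi>"
          by (simp add: P1_def g_def algebra_simps)
        also have "\<psi> \<xi> * g \<xi> = \<psi> \<xi> * cnj (\<psi> \<xi>)"
          by (cases "norm \<xi> \<le> R") (auto simp: \<psi>_def)
        finally show "(P1 t \<xi> * p t \<xi> - P2 t \<xi> * Q t \<xi>) - (P1 0 \<xi> * p 0 \<xi> - P2 0 \<xi> * Q 0 \<xi>)
            = complex_of_real ((norm (\<psi> \<xi>))\<^sup>2)"
          by (simp only: complex_norm_square)
      qed
      also have "\<dots> = of_real ((L2_norm \<psi>)\<^sup>2)"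
        unfolding L2_norm_power2 by (rule integral_complex_of_real)
      finally show ?thesis .
    qed
    ultimately have "L2_norm \<psi> = 0" by simp
    then have "AE \<xi> in lborel. \<psi> \<xi> = 0" by (rule L2_norm_eq_0_AE[OF \<psi>])
    then show ?thesis
    proof eventually_elim
      case (elim \<xi>)
      then have "norm \<xi> \<le> R \<longrightarrow> g \<xi> = 0" by (auto simp: \<psi>_def)
      then show ?case by (simp only: g_def)
    qed
  qed
  \<comment> \<open>Countably many balls exhaust the space, so the exceptional null sets can be
    united.\<close>
  have "AE \<xi> in lborel. \<forall>n::nat. norm \<xi> \<le> real n \<longrightarrow>
      of_real (W' t (norm \<xi>)) * p t \<xi> - of_real (W t (norm \<xi>)) * q t \<xi>
      - (of_real (W' 0 (norm \<xi>)) * p 0 \<xi> - of_real (W 0 (norm \<xi>)) * q 0 \<xi>) = 0"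
    by (subst AE_all_countable) (intro allI ball, simp)
  then show ?thesis
  proof eventually_elim
    case (elim \<xi>)
    obtain n :: nat where "norm \<xi> \<le> n" using real_arch_simple by blast
    with elim show ?case by auto
  qed
qed


text \<open>Constancy of the Wronskians with the two fundamental modes gives two linear equations
  for \<open>FT (v t)\<close> and \<open>FT (vt t)\<close>. Their determinant is the Wronskian of
  the two modes, which is 1, and Cramer's rule solves them.\<close>

lemma solution_mode_expansion:
  fixes v vt :: "real \<Rightarrow> real ^ 'd \<Rightarrow> complex"
  assumes \<mu>: "\<mu> > 0" and sol: "wave_solution \<mu> v0 v1 v vt"
    and A: "\<And>t. A t \<in> borel_measurable borel" "\<And>t. A' t \<in> borel_measurable borel"
    and odeA: "\<And>\<rho>. mode_ode \<mu> \<rho> (\<lambda>t. A t \<rho>) (\<lambda>t. A' t \<rho>)" and A0: "\<And>\<rho>. A 0 \<rho> = 1" "\<And>\<rho>. A' 0 \<rho> = 0"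
    and B: "\<And>t. B t \<in> borel_measurable borel" "\<And>t. B' t \<in> borel_measurable borel"
    and odeB: "\<And>\<rho>. mode_ode \<mu> \<rho> (\<lambda>t. B t \<rho>) (\<lambda>t. B' t \<rho>)" and B0: "\<And>\<rho>. B 0 \<rho> = 0" "\<And>\<rho>. B' 0 \<rho> = 1"
    and t: "t > 0"
  shows "AE \<xi> in lborel.
    FT (v t) \<xi> = of_real (A t (norm \<xi>)) * FT (v 0) \<xi> + of_real (B t (norm \<xi>)) * FT (vt 0) \<xi> \<and>
    FT (vt t) \<xi> = of_real (A' t (norm \<xi>)) * FT (v 0) \<xi> + of_real (B' t (norm \<xi>)) * FT (vt 0) \<xi>"
proof -
  have vH: "v t \<in> H1" and vtL: "vt t \<in> L2" if "t \<ge> 0" for t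
    using sol that by (auto simp: wave_solution_def)
  have vL: "v t \<in> L2" if "t \<ge> 0" for t using vH[OF that] by (simp add: H1_def)
  have pL: "FT (v t) \<in> L2" and qL: "FT (vt t) \<in> L2" if "t \<ge> 0" for t
    using vL[OF that] vtL[OF that] by (auto intro: FT_L2)
  have fv: "is_fourier (v t) (FT (v t))" and fvt: "is_fourier (vt t) (FT (vt t))" if "t \<ge> 0" for t
    using vL[OF that] vtL[OF that] by (auto intro: is_fourier_FT)
  have pH: "(\<lambda>\<xi>. of_real (sqrt (1 + (norm \<xi>)\<^sup>2)) * FT (v t) \<xi>) \<in> L2" if "t \<ge> 0" for t
    using vH[OF that] by (simp add: H1_def)
  \<comment> \<open>The L2 derivative passes to the Fourier side because the transform is linear and
    isometric on the difference quotients.\<close>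
  have dp: "L2_deriv (\<lambda>t. FT (v t)) (FT (vt t)) t" if t: "t \<ge> 0" for t
    unfolding L2_deriv_def
  proof (rule Lim_transform_eventually)
    show "((\<lambda>s. L2_norm (\<lambda>x. (v s x - v t x) / of_real (s - t) - vt t x)) \<longlongrightarrow> 0) (at t within {0..})"
      using sol t by (simp add: wave_solution_def)
    show "\<forall>\<^sub>F s in at t within {0..}. L2_norm (\<lambda>x. (v s x - v t x) / of_real (s - t) - vt t x)
        = L2_norm (\<lambda>\<xi>. (FT (v s) \<xi> - FT (v t) \<xi>) / of_real (s - t) - FT (vt t) \<xi>)"
    proof (rule eventually_atLeast_within)
      fix s :: real assume s: "s \<ge> 0" "s \<noteq> t"
      let ?c = "inverse (of_real (s - t))"
      have "L2_norm (\<lambda>\<xi>. ?c * (FT (v s) \<xi> - FT (v t) \<xi>) - FT (vt t) \<xi>)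
          = L2_norm (\<lambda>x. ?c * (v s x - v t x) - vt t x)"
        by (rule is_fourier_isometry[OF is_fourier_diff[OF is_fourier_scale[OF is_fourier_diff[OF fv[OF s(1)] fv[OF t]]] fvt[OF t]]])
      then show "L2_norm (\<lambda>x. (v s x - v t x) / of_real (s - t) - vt t x)
        = L2_norm (\<lambda>\<xi>. (FT (v s) \<xi> - FT (v t) \<xi>) / of_real (s - t) - FT (vt t) \<xi>)"
        by (simp add: divide_inverse mult.commute)
    qed
  qed
  have cq: "((\<lambda>s. L2_norm (\<lambda>\<xi>. FT (vt s) \<xi> - FT (vt t) \<xi>)) \<longlongrightarrow> 0) (at t within {0..})" if t: "t \<ge> 0" for t
  proof (rule Lim_transform_eventually)
    show "((\<lambda>s. L2_norm (\<lambda>x. vt s x - vt t x)) \<longlongrightarrow> 0) (at t within {0..})"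
      using sol t by (simp add: wave_solution_def fun_diff_def)
    show "\<forall>\<^sub>F s in at t within {0..}. L2_norm (\<lambda>x. vt s x - vt t x) = L2_norm (\<lambda>\<xi>. FT (vt s) \<xi> - FT (vt t) \<xi>)"
      by (rule eventually_atLeast_within) (rule is_fourier_isometry[OF is_fourier_diff[OF fvt fvt[OF t]], symmetric])
  qed
  have dq: "L2_deriv (\<lambda>s \<xi>. FT (vt s) \<xi> / of_real (sqrt (1 + (norm \<xi>)\<^sup>2)))
      (\<lambda>\<xi>. - of_real ((norm \<xi>)\<^sup>2 + \<mu> / (1 + t)\<^sup>2) * FT (v t) \<xi> / of_real (sqrt (1 + (norm \<xi>)\<^sup>2))) t" if t: "t > 0" for t
  proof -
    have "(\<lambda>\<xi>. (FT (vt s) \<xi> / of_real (sqrt (1 + (norm \<xi>)\<^sup>2)) - FT (vt t) \<xi> / of_real (sqrt (1 + (norm \<xi>)\<^sup>2))) / of_real (s - t)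
        - - of_real ((norm \<xi>)\<^sup>2 + \<mu> / (1 + t)\<^sup>2) * FT (v t) \<xi> / of_real (sqrt (1 + (norm \<xi>)\<^sup>2)))
      = (\<lambda>\<xi>. ((FT (vt s) \<xi> - FT (vt t) \<xi>) / of_real (s - t)
                 + of_real ((norm \<xi>)\<^sup>2) * FT (v t) \<xi>
                 + of_real (\<mu> / (1 + t)\<^sup>2) * FT (v t) \<xi>) / of_real (sqrt (1 + (norm \<xi>)\<^sup>2)))" for s
    proof
      fix \<xi> :: "real ^ 'd"
      have "(a / z - b / z) / c - - (k + m) * d / z = ((a - b) / c + k * d + m * d) / z" for a b c d k m z :: complex
        by (simp add: divide_inverse algebra_simps)
      then show "(FT (vt s) \<xi> / of_real (sqrt (1 + (norm \<xi>)\<^sup>2)) - FT (vt t) \<xi> / of_real (sqrt (1 + (norm \<xi>)\<^sup>2))) / of_real (s - t)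
        - - of_real ((norm \<xi>)\<^sup>2 + \<mu> / (1 + t)\<^sup>2) * FT (v t) \<xi> / of_real (sqrt (1 + (norm \<xi>)\<^sup>2))
        = ((FT (vt s) \<xi> - FT (vt t) \<xi>) / of_real (s - t)
                 + of_real ((norm \<xi>)\<^sup>2) * FT (v t) \<xi>
                 + of_real (\<mu> / (1 + t)\<^sup>2) * FT (v t) \<xi>) / of_real (sqrt (1 + (norm \<xi>)\<^sup>2))"
        unfolding of_real_add[of "(norm \<xi>)\<^sup>2"] .
    qed
    then show ?thesis
      using sol t by (simp only: L2_deriv_def wave_solution_def Hm1_norm_def)
  qed
  note Wr = Wronskian_constant[OF \<mu> pL qL pH dp cq dq _ _ _ _ _ t]
  have W1: "A t \<rho> * B' t \<rho> - A' t \<rho> * B t \<rho> = 1" for \<rho>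
  proof -
    let ?w = "\<lambda>t. A t \<rho> * B' t \<rho> - A' t \<rho> * B t \<rho>"
    have sub: "{0..t} \<subseteq> {0..}" by auto
    have "norm (?w t - ?w 0) \<le> 0 - (0 :: real)"
    proof (rule differentiable_bound_general[OF t, of _ "\<lambda>_. 0" "\<lambda>_. 0" "\<lambda>_. 0"])
      show "continuous_on {0..t} ?w"
        by (intro continuous_intros continuous_on_subset[OF mode_ode_continuous(1)[OF odeA] sub]
          continuous_on_subset[OF mode_ode_continuous(2)[OF odeA] sub]
          continuous_on_subset[OF mode_ode_continuous(1)[OF odeB] sub]
          continuous_on_subset[OF mode_ode_continuous(2)[OF odeB] sub])
      fix s assume s: "0 < s" "s < t"
      have "(?w has_vector_derivative
          (A s \<rho> * (- (\<rho>\<^sup>2 + \<mu> / (1 + s)\<^sup>2) *\<^sub>R B s \<rho>) + A' s \<rho> * B' s \<rho>)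
          - (A' s \<rho> * B' s \<rho> + (- (\<rho>\<^sup>2 + \<mu> / (1 + s)\<^sup>2) *\<^sub>R A s \<rho>) * B s \<rho>)) (at s)"
        by (intro has_vector_derivative_diff has_vector_derivative_mult mode_odeD[OF odeA s(1)] mode_odeD[OF odeB s(1)])
      then show "(?w has_vector_derivative 0) (at s)" by (simp add: algebra_simps)
    qed auto
    then show ?thesis by (simp add: A0 B0)
  qed
  have "AE \<xi> in lborel. of_real (A' t (norm \<xi>)) * FT (v t) \<xi> - of_real (A t (norm \<xi>)) * FT (vt t) \<xi>
    = of_real (A' 0 (norm \<xi>)) * FT (v 0) \<xi> - of_real (A 0 (norm \<xi>)) * FT (vt 0) \<xi>"
    by (rule Wr) (auto simp: A A0 odeA)
  moreover have "AE \<xi> in lborel. of_real (B' t (norm \<xi>)) * FT (v t) \<xi> - of_real (B t (norm \<xi>)) * FT (vt t) \<xi>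
    = of_real (B' 0 (norm \<xi>)) * FT (v 0) \<xi> - of_real (B 0 (norm \<xi>)) * FT (vt 0) \<xi>"
    by (rule Wr) (auto simp: B B0 odeB)
  ultimately show ?thesis
  proof eventually_elim
    case (elim \<xi>)
    let ?A = "complex_of_real (A t (norm \<xi>))" and ?A' = "complex_of_real (A' t (norm \<xi>))"
      and ?B = "complex_of_real (B t (norm \<xi>))" and ?B' = "complex_of_real (B' t (norm \<xi>))"
    let ?p = "FT (v t) \<xi>" and ?q = "FT (vt t) \<xi>"
    have e: "FT (vt 0) \<xi> = ?A * ?q - ?A' * ?p" "FT (v 0) \<xi> = ?B' * ?p - ?B * ?q"
    proof -
      have "?A' * ?p - ?A * ?q = - FT (vt 0) \<xi>" using elim(1) by (simp add: A0)
      then show "FT (vt 0) \<xi> = ?A * ?q - ?A' * ?p" by (metis minus_diff_eq minus_minus)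
    qed (use elim(2) in \<open>simp add: B0\<close>)
    have w: "?A * ?B' - ?A' * ?B = 1"
      using W1[of "norm \<xi>"] by (metis of_real_1 of_real_diff of_real_mult)
    have "?A * FT (v 0) \<xi> + ?B * FT (vt 0) \<xi> = (?A * ?B' - ?A' * ?B) * ?p"
      "?A' * FT (v 0) \<xi> + ?B' * FT (vt 0) \<xi> = (?A * ?B' - ?A' * ?B) * ?q"
      unfolding e by (simp_all add: algebra_simps)
    then show ?case by (simp add: w)
  qed
qed

subsection \<open>The scattering state\<close>

lemma L2_of_norm:
  assumes "f \<in> L2"
  shows "(\<lambda>x. complex_of_real (norm (f x))) \<in> L2"
  using L2_measurable[OF assms] by (intro L2_dominated[OF assms, of _ 1]) auto

lemma decay_inverse:
  assumes "t \<ge> 0"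
  shows "\<mu> \<noteq> 1/4 \<Longrightarrow> (1 + t) powr (1/2 - Re (nu \<mu>)) = 1 / decay \<mu> (1 + t)"
    and "\<mu> = 1/4 \<Longrightarrow> (1 + t) powr (1/2) * inverse (1 + ln (1 + t)) = 1 / decay \<mu> (1 + t)"
proof -
  have sq: "sqrt (1 + t) = (1 + t) powr (1/2)" using assms by (simp add: powr_half_sqrt)
  show "\<mu> \<noteq> 1/4 \<Longrightarrow> (1 + t) powr (1/2 - Re (nu \<mu>)) = 1 / decay \<mu> (1 + t)"
  proof -
    assume m: "\<mu> \<noteq> 1/4"
    have "exp (Re (nu \<mu>) * ln (1 + t)) = (1 + t) powr Re (nu \<mu>)"
      using assms by (simp add: powr_def)
    then show ?thesis using m unfolding decay_def growth_def sq by (simp add: powr_diff)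
  qed
  show "\<mu> = 1/4 \<Longrightarrow> (1 + t) powr (1/2) * inverse (1 + ln (1 + t)) = 1 / decay \<mu> (1 + t)"
  proof -
    assume m: "\<mu> = 1/4"
    have "a * inverse b = 1 / (b / a)" for a b :: real by (simp add: divide_inverse)
    then show ?thesis unfolding decay_def growth_def sq if_P[OF m] .
  qed
qed

text \<open>
  \<open>\<phi>\<close> and \<open>g\<close> are chosen such that \<open>g + \<i> \<rho> \<phi> = rp\<close> and \<open>g - \<i> \<rho> \<phi> = rm\<close>: the free wave with
  these data has the constant profiles \<open>rp\<close> and \<open>rm\<close>.
\<close>

lemma free_mode_difference:
  fixes w w' :: "real \<Rightarrow> complex" and rp rm :: complex and \<rho> t :: real
  assumes \<rho>: "\<rho> > 0"
  defines "\<phi> \<equiv> (rp - rm) / (2 * \<i> * of_real \<rho>)" and "g \<equiv> (rp + rm) / 2"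
    and "e \<equiv> norm (profile 1 \<rho> w w' t - rp) + norm (profile (-1) \<rho> w w' t - rm)"
  shows "norm (of_real \<rho> * (w t - (of_real (cos (t * \<rho>)) * \<phi> + of_real (sin (t * \<rho>) / \<rho>) * g))) \<le> e"
    and "norm (w' t - (- of_real (\<rho> * sin (t * \<rho>)) * \<phi> + of_real (cos (t * \<rho>)) * g)) \<le> e"
proof -
  let ?z = "cis (t * \<rho>)" and ?y = "cis (- (t * \<rho>))"
  let ?P = "profile 1 \<rho> w w' t - rp" and ?M = "profile (-1) \<rho> w w' t - rm"
  let ?dw = "w t - (of_real (cos (t * \<rho>)) * \<phi> + of_real (sin (t * \<rho>) / \<rho>) * g)"
  let ?dw' = "w' t - (- of_real (\<rho> * sin (t * \<rho>)) * \<phi> + of_real (cos (t * \<rho>)) * g)"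
  have zy: "?z * ?y = 1" "?y * ?z = 1" by (simp_all add: cis_mult)
  have cs: "complex_of_real (cos (t * \<rho>)) = (?z + ?y) / 2"
    "complex_of_real (sin (t * \<rho>)) = (?z - ?y) / (2 * \<i>)"
    by (auto simp: complex_eq_iff)
  have pr: "profile 1 \<rho> w w' t = ?y * (w' t + \<i> * of_real \<rho> * w t)"
    "profile (-1) \<rho> w w' t = ?z * (w' t - \<i> * of_real \<rho> * w t)"
    by (simp_all add: profile_def mult.commute)
  have a: "?z * ?P = w' t + \<i> * of_real \<rho> * w t - ?z * rp" "?y * ?M = w' t - \<i> * of_real \<rho> * w t - ?y * rm"
    unfolding pr right_diff_distrib[of ?z] right_diff_distrib[of ?y] mult.assoc[symmetric] zy by simp_all
  have r0: "complex_of_real \<rho> \<noteq> 0" using \<rho> by simp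
  \<comment> \<open>The difference to the free evolution is a combination of the two profile errors
    with coefficients of modulus 1/2.\<close>
  have 1: "of_real \<rho> * ?dw = (?z * ?P - ?y * ?M) / (2 * \<i>)"
    unfolding a of_real_divide cs \<phi>_def g_def using r0 by (simp add: field_simps)
  have 2: "?dw' = (?z * ?P + ?y * ?M) / 2"
    unfolding a of_real_mult cs \<phi>_def g_def using r0 by (simp add: field_simps)
  have n: "norm (?z * ?P) = norm ?P" "norm (?y * ?M) = norm ?M" by (simp_all add: norm_mult)
  have "norm (of_real \<rho> * ?dw) = norm (?z * ?P - ?y * ?M) / 2"
    unfolding 1 by (simp add: norm_divide norm_mult)
  also have "\<dots> \<le> norm (?z * ?P - ?y * ?M)" by simp
  also have "\<dots> \<le> e" unfolding e_def using norm_triangle_ineq4[of "?z * ?P" "?y * ?M"] n by simp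
  finally show "norm (of_real \<rho> * ?dw) \<le> e" .
  have "norm ?dw' = norm (?z * ?P + ?y * ?M) / 2"
    unfolding 2 by (simp add: norm_divide)
  also have "\<dots> \<le> norm (?z * ?P + ?y * ?M)" by simp
  also have "\<dots> \<le> e" unfolding e_def using norm_triangle_ineq[of "?z * ?P" "?y * ?M"] n by simp
  finally show "norm ?dw' \<le> e" .
qed


theorem corollary1p4:
  fixes \<mu> :: real
    and v0 v1 :: "real ^ 'd \<Rightarrow> complex"
    and v vt :: "real \<Rightarrow> real ^ 'd \<Rightarrow> complex"
  assumes "\<mu> > 0"
    and "v0 \<in> H1" and "v1 \<in> L2"
    and "wave_solution \<mu> v0 v1 v vt"
  shows "\<exists>v_plus \<in> Hdot1 \<times> L2.
     (\<mu> \<noteq> 1/4 \<longrightarrow>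
       ((\<lambda>t. (1 + t) powr (1/2 - Re (nu \<mu>)) *
             energy_norm ((FT (v t), vt t) - free_wave t v_plus)) \<longlongrightarrow> 0) at_top) \<and>
     (\<mu> = 1/4 \<longrightarrow>
       ((\<lambda>t. (1 + t) powr (1/2) * inverse (1 + ln (1 + t)) *
             energy_norm ((FT (v t), vt t) - free_wave t v_plus)) \<longlongrightarrow> 0) at_top)"
proof -
  note \<mu> = assms(1) and sol = assms(4)
  obtain A A' where A: "\<And>t. A t \<in> borel_measurable borel" "\<And>t. A' t \<in> borel_measurable borel"
    and odeA: "\<And>\<rho>. mode_ode \<mu> \<rho> (\<lambda>t. A t \<rho> :: real) (\<lambda>t. A' t \<rho>)"
    and A0: "\<And>\<rho>. A 0 \<rho> = 1" "\<And>\<rho>. A' 0 \<rho> = 0"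
    using mode_ode_exists[of \<mu> 1 0] \<mu> by auto
  obtain B B' where B: "\<And>t. B t \<in> borel_measurable borel" "\<And>t. B' t \<in> borel_measurable borel"
    and odeB: "\<And>\<rho>. mode_ode \<mu> \<rho> (\<lambda>t. B t \<rho> :: real) (\<lambda>t. B' t \<rho>)"
    and B0: "\<And>\<rho>. B 0 \<rho> = 0" "\<And>\<rho>. B' 0 \<rho> = 1"
    using mode_ode_exists[of \<mu> 0 1] \<mu> by auto
  define p0 q0 where "p0 = FT (v 0)" and "q0 = FT (vt 0)"
  have vH: "v t \<in> H1" and vtL: "vt t \<in> L2" if "t \<ge> 0" for t
    using sol that by (auto simp: wave_solution_def)
  have vL: "v t \<in> L2" if "t \<ge> 0" for t using vH[OF that] by (simp add: H1_def)
  have p0: "p0 \<in> L2" and q0: "q0 \<in> L2"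
    using vL[of 0] vtL[of 0] by (auto simp: p0_def q0_def intro: FT_L2)
  have pH: "(\<lambda>\<xi>. of_real (sqrt (1 + (norm \<xi>)\<^sup>2)) * p0 \<xi>) \<in> L2"
    using vH[of 0] by (simp add: H1_def p0_def)
  \<comment> \<open>Defined for every \<xi> and all times at once. The Fourier transforms of the
    solution agree with these modes only almost everywhere, with a null set that may depend on the
    time, so limits in time are taken of the modes.\<close>
  define w where "w \<xi> t = of_real (A t (norm \<xi>)) * p0 \<xi> + of_real (B t (norm \<xi>)) * q0 \<xi>" for \<xi> t
  define w' where "w' \<xi> t = of_real (A' t (norm \<xi>)) * p0 \<xi> + of_real (B' t (norm \<xi>)) * q0 \<xi>" for \<xi> t
  have w0: "w \<xi> 0 = p0 \<xi>" "w' \<xi> 0 = q0 \<xi>" for \<xi>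
    by (simp_all add: w_def w'_def A0 B0)
  have ode: "mode_ode \<mu> (norm \<xi>) (w \<xi>) (w' \<xi>)" for \<xi>
    unfolding mode_ode_def
  proof (intro allI impI conjI)
    fix t :: real assume t: "t \<ge> 0"
    let ?F = "at t within {0..}" and ?c = "- ((norm \<xi>)\<^sup>2 + \<mu> / (1 + t)\<^sup>2)"
    have dA: "((\<lambda>t. complex_of_real (A t (norm \<xi>))) has_vector_derivative of_real (A' t (norm \<xi>))) ?F"
      "((\<lambda>t. complex_of_real (A' t (norm \<xi>))) has_vector_derivative of_real (?c * A t (norm \<xi>))) ?F"
      by (rule has_vector_derivative_of_real, insert odeA[of "norm \<xi>"] t,
          simp add: mode_ode_def has_real_derivative_iff_has_vector_derivative)+
    have dB: "((\<lambda>t. complex_of_real (B t (norm \<xi>))) has_vector_derivative of_real (B' t (norm \<xi>))) ?F"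
      "((\<lambda>t. complex_of_real (B' t (norm \<xi>))) has_vector_derivative of_real (?c * B t (norm \<xi>))) ?F"
      by (rule has_vector_derivative_of_real, insert odeB[of "norm \<xi>"] t,
          simp add: mode_ode_def has_real_derivative_iff_has_vector_derivative)+
    have bl: "bounded_linear (\<lambda>x::complex. x * z)" for z by (rule bounded_linear_mult_left)
    show "(w \<xi> has_vector_derivative w' \<xi> t) ?F"
      unfolding w_def w'_def
      by (intro has_vector_derivative_add bounded_linear.has_vector_derivative[OF bl] dA dB)
    have "(w' \<xi> has_vector_derivative of_real (?c * A t (norm \<xi>)) * p0 \<xi> + of_real (?c * B t (norm \<xi>)) * q0 \<xi>) ?F"
      unfolding w'_def
      by (intro has_vector_derivative_add bounded_linear.has_vector_derivative[OF bl] dA dB)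
    also have "of_real (?c * A t (norm \<xi>)) * p0 \<xi> + of_real (?c * B t (norm \<xi>)) * q0 \<xi> = ?c *\<^sub>R w \<xi> t"
      unfolding w_def scaleR_conv_of_real of_real_mult by (simp only: distrib_left mult.assoc)
    finally show "(w' \<xi> has_vector_derivative ?c *\<^sub>R w \<xi> t) ?F" .
  qed
  have expansion: "AE \<xi> in lborel. FT (v t) \<xi> = w \<xi> t \<and> FT (vt t) \<xi> = w' \<xi> t" if t: "t \<ge> 0" for t
  proof (cases "t = 0")
    case True
    then show ?thesis by (simp add: w0 p0_def q0_def)
  next
    case False
    then show ?thesis
      unfolding w_def w'_def p0_def q0_def
      using solution_mode_expansion[OF \<mu> sol A odeA A0 B odeB B0, of t] t by simp
  qed
  \<comment> \<open>The dominating function, up to constants. It is square-integrable because the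
    initial value lies in H^1; near \<xi> = 0 the transform of the value enters without a factor
    |\<xi>|.\<close>
  define D where "D \<xi> = sqrt (1 + (norm \<xi>)\<^sup>2) * norm (p0 \<xi>) + norm (q0 \<xi>)" for \<xi>
  have D0: "D \<xi> \<ge> 0" for \<xi> by (simp add: D_def)
  have DL: "(\<lambda>\<xi>. complex_of_real (D \<xi>)) \<in> L2"
    using L2_add[OF L2_of_norm[OF pH] L2_of_norm[OF q0]] by (simp add: D_def norm_mult)
  obtain C where C0: "C \<ge> 0" and C: "\<And>\<sigma> \<rho>. \<And>w w' :: real \<Rightarrow> complex. mode_ode \<mu> \<rho> w w' \<Longrightarrow> 0 < \<rho> \<Longrightarrow> \<sigma>\<^sup>2 = 1 \<Longrightarrow>
    (\<exists>r. (profile \<sigma> \<rho> w w' \<longlongrightarrow> r) at_top \<and>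
      (\<forall>t\<ge>0. norm (profile \<sigma> \<rho> w w' t - r) \<le> C * decay \<mu> (1 + t) * (sqrt (1 + \<rho>\<^sup>2) * norm (w 0) + norm (w' 0))) \<and>
      ((\<lambda>t. norm (profile \<sigma> \<rho> w w' t - r) / decay \<mu> (1 + t)) \<longlongrightarrow> 0) at_top)"
    using mode_scattering[OF \<mu>] by blast
  define P where "P \<sigma> \<xi> = profile \<sigma> (norm \<xi>) (w \<xi>) (w' \<xi>)" for \<sigma> \<xi>
  \<comment> \<open>A limit along integer times, so that measurability is immediate; off \<xi> = 0
    it agrees with the limit along all times.\<close>
  define r where "r \<sigma> \<xi> = lim (\<lambda>n. P \<sigma> \<xi> (real n))" for \<sigma> \<xi>
  have scat: "(\<forall>t\<ge>0. norm (P \<sigma> \<xi> t - r \<sigma> \<xi>) \<le> C * decay \<mu> (1 + t) * D \<xi>) \<and>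
      ((\<lambda>t. norm (P \<sigma> \<xi> t - r \<sigma> \<xi>) / decay \<mu> (1 + t)) \<longlongrightarrow> 0) at_top" if \<sigma>: "\<sigma>\<^sup>2 = 1" and \<xi>: "\<xi> \<noteq> 0" for \<sigma> \<xi>
  proof -
    obtain z where z: "(P \<sigma> \<xi> \<longlongrightarrow> z) at_top"
      "\<forall>t\<ge>0. norm (P \<sigma> \<xi> t - z) \<le> C * decay \<mu> (1 + t) * D \<xi>"
      "((\<lambda>t. norm (P \<sigma> \<xi> t - z) / decay \<mu> (1 + t)) \<longlongrightarrow> 0) at_top"
      using C[OF ode[of \<xi>] _ \<sigma>] \<xi> by (auto simp: w0 P_def D_def)
    have "(\<lambda>n. P \<sigma> \<xi> (real n)) \<longlonglongrightarrow> z"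
      by (rule filterlim_compose[OF z(1) filterlim_real_sequentially])
    then have "r \<sigma> \<xi> = z" unfolding r_def by (rule limI)
    with z show ?thesis by simp
  qed
  \<comment> \<open>The error bound at t = 0, where \<open>decay \<mu> 1 = 1\<close>, is enough to
    make the limits square-integrable.\<close>
  have r_le: "norm (r \<sigma> \<xi>) \<le> (2 + C) * D \<xi>" if \<sigma>: "\<sigma>\<^sup>2 = 1" and "\<xi> \<noteq> 0" for \<sigma> \<xi>
  proof -
    have "\<bar>\<sigma>\<bar> = 1" using \<sigma> by (simp add: abs_square_eq_1)
    then have "norm (P \<sigma> \<xi> 0) \<le> norm (q0 \<xi>) + norm \<xi> * norm (p0 \<xi>)"
      using norm_triangle_ineq[of "q0 \<xi>" "\<i> * of_real (\<sigma> * norm \<xi>) * p0 \<xi>"]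
      by (simp add: P_def profile_def w0 norm_mult abs_mult)
    also have "norm \<xi> * norm (p0 \<xi>) \<le> sqrt (1 + (norm \<xi>)\<^sup>2) * norm (p0 \<xi>)"
      by (intro mult_right_mono real_le_rsqrt) auto
    finally have 1: "norm (P \<sigma> \<xi> 0) \<le> D \<xi>" by (simp add: D_def)
    have "norm (P \<sigma> \<xi> 0 - r \<sigma> \<xi>) \<le> C * decay \<mu> (1 + 0) * D \<xi>"
      using scat[OF that] by blast
    then have "norm (r \<sigma> \<xi>) \<le> D \<xi> + C * D \<xi>"
      using norm_triangle_sub[of "r \<sigma> \<xi>" "P \<sigma> \<xi> 0"] 1 by (simp add: norm_minus_commute)
    then show ?thesis using D0[of \<xi>] by (simp add: algebra_simps)
  qed
  note [measurable] = L2_measurable[OF p0] L2_measurable[OF q0] A B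
  have w_meas: "(\<lambda>\<xi>. w \<xi> t) \<in> borel_measurable lborel" "(\<lambda>\<xi>. w' \<xi> t) \<in> borel_measurable lborel" for t
    unfolding w_def w'_def by measurable
  note [measurable] = w_meas
  have P_meas: "(\<lambda>\<xi>. P \<sigma> \<xi> t) \<in> borel_measurable lborel" for \<sigma> t
    unfolding P_def profile_def by measurable
  note [measurable] = P_meas
  have r_meas: "r \<sigma> \<in> borel_measurable lborel" for \<sigma>
    unfolding r_def[abs_def] by (rule borel_measurable_lim_metric) measurable
  note [measurable] = r_meas
  have AE0: "AE \<xi> in lborel. (\<xi> :: real ^ 'd) \<noteq> 0" by (rule AE_lborel_singleton)
  have rL: "r \<sigma> \<in> L2" if "\<sigma>\<^sup>2 = 1" for \<sigma>
    using AE0 r_le[OF that] D0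
    by (intro L2_dominated[OF DL, of _ "2 + C"] r_meas) (auto elim!: eventually_mono)
  \<comment> \<open>Because of the division by |\<xi>|, only |\<xi>| \<phi> inherits
    square-integrability from the limits; this is why the first component belongs to the homogeneous
    space.\<close>
  define \<phi> where "\<phi> \<xi> = (r 1 \<xi> - r (-1) \<xi>) / (2 * \<i> * of_real (norm \<xi>))" for \<xi>
  define g where "g \<xi> = (r 1 \<xi> + r (-1) \<xi>) / 2" for \<xi>
  have \<phi>_meas: "\<phi> \<in> borel_measurable lborel" unfolding \<phi>_def[abs_def] by measurable
  have gL: "g \<in> L2"
    using L2_scale[OF L2_add[OF rL[of 1] rL[of "-1"]], of "1/2"] by (simp add: g_def[abs_def])
  have \<phi>L: "(\<lambda>\<xi>. of_real (norm \<xi>) * \<phi> \<xi>) \<in> L2"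
  proof (rule L2_dominated[OF L2_diff[OF rL[of 1] rL[of "-1"]], of _ 1])
    show "(\<lambda>\<xi>. of_real (norm \<xi>) * \<phi> \<xi>) \<in> borel_measurable lborel"
      using \<phi>_meas by measurable
    show "AE \<xi> in lborel. norm (of_real (norm \<xi>) * \<phi> \<xi>) \<le> 1 * norm (r 1 \<xi> - r (-1) \<xi>)"
    proof (rule AE_I2)
      fix \<xi> :: "real ^ 'd"
      have "norm (of_real (norm \<xi>) * \<phi> \<xi>) = (if \<xi> = 0 then 0 else norm (r 1 \<xi> - r (-1) \<xi>) / 2)"
        by (simp add: \<phi>_def norm_mult norm_divide)
      also have "\<dots> \<le> 1 * norm (r 1 \<xi> - r (-1) \<xi>)" by simp
      finally show "norm (of_real (norm \<xi>) * \<phi> \<xi>) \<le> 1 * norm (r 1 \<xi> - r (-1) \<xi>)" .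
    qed
  qed auto
  define G where "G = FT_inv g"
  have GL: "G \<in> L2" unfolding G_def by (rule FT_inv_L2[OF gL])
  have FTG: "AE \<xi> in lborel. FT G \<xi> = g \<xi>" unfolding G_def by (rule FT_FT_inv[OF gL])
  note [measurable] = L2_measurable[OF FT_L2[OF GL]] \<phi>_meas
  define E where "E t \<xi> = norm (P 1 \<xi> t - r 1 \<xi>) + norm (P (-1) \<xi> t - r (-1) \<xi>)" for t \<xi>
  have E0: "E t \<xi> \<ge> 0" for t \<xi> by (simp add: E_def)
  have EL: "(\<lambda>\<xi>. complex_of_real (E t \<xi>)) \<in> L2" if t: "t \<ge> 0" for t
  proof (rule L2_dominated[OF DL])
    show "(\<lambda>\<xi>. complex_of_real (E t \<xi>)) \<in> borel_measurable lborel"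
      unfolding E_def by measurable
    show "AE \<xi> in lborel. norm (complex_of_real (E t \<xi>)) \<le> 2 * (C * decay \<mu> (1 + t)) * norm (complex_of_real (D \<xi>))"
      using AE0
    proof eventually_elim
      case (elim \<xi>)
      have "norm (P 1 \<xi> t - r 1 \<xi>) \<le> C * decay \<mu> (1 + t) * D \<xi>"
        "norm (P (-1) \<xi> t - r (-1) \<xi>) \<le> C * decay \<mu> (1 + t) * D \<xi>"
        using scat[of 1 \<xi>] scat[of "-1" \<xi>] elim t by auto
      then have "E t \<xi> \<le> 2 * (C * decay \<mu> (1 + t)) * D \<xi>" by (simp add: E_def)
      then show ?case using D0[of \<xi>] E0[of t \<xi>] by (simp only: norm_of_real abs_of_nonneg)
    qed
  qed
  have energy: "energy_norm ((FT (v t), vt t) - free_wave t (\<phi>, G)) \<le> 2 * L2_norm (\<lambda>\<xi>. complex_of_real (E t \<xi>))"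
    if t: "t \<ge> 0" for t
  proof -
    let ?f1 = "\<lambda>\<xi>. of_real (cos (t * norm \<xi>)) * \<phi> \<xi> + of_real (sin (t * norm \<xi>) / norm \<xi>) * FT G \<xi>"
    let ?f2 = "\<lambda>\<xi>. - of_real (norm \<xi> * sin (t * norm \<xi>)) * \<phi> \<xi> + of_real (cos (t * norm \<xi>)) * FT G \<xi>"
    note [measurable] = L2_measurable[OF FT_L2[OF vL[OF t]]] L2_measurable[OF FT_L2[OF vtL[OF t]]]
    \<comment> \<open>\<open>FT_inv ?f2\<close> has the intended meaning only if \<open>?f2\<close>
      is square-integrable; the factor |\<xi>| is therefore kept together with
      \<open>\<phi>\<close>.\<close>
    have "(\<lambda>\<xi>. of_real (- sin (t * norm \<xi>)) * (of_real (norm \<xi>) * \<phi> \<xi>)) \<in> L2"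
      using L2_measurable[OF \<phi>L]
      by (intro L2_dominated[OF \<phi>L, of _ 1]) (auto simp: norm_mult intro!: mult_left_le_one_le)
    moreover have "(\<lambda>\<xi>. of_real (cos (t * norm \<xi>)) * FT G \<xi>) \<in> L2"
      by (intro L2_dominated[OF FT_L2[OF GL], of _ 1]) (auto simp: norm_mult intro!: mult_left_le_one_le)
    ultimately have "(\<lambda>\<xi>. of_real (- sin (t * norm \<xi>)) * (of_real (norm \<xi>) * \<phi> \<xi>) + of_real (cos (t * norm \<xi>)) * FT G \<xi>) \<in> L2"
      by (rule L2_add)
    then have f2: "?f2 \<in> L2" by (simp add: mult_ac)
    have fw: "(FT (v t), vt t) - free_wave t (\<phi>, G) = (FT (v t) - ?f1, vt t - FT_inv ?f2)"
      by (simp add: free_wave_def)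
    have AE: "AE \<xi> in lborel. norm (of_real (norm \<xi>) * (FT (v t) \<xi> - ?f1 \<xi>)) \<le> norm (complex_of_real (E t \<xi>)) \<and>
        norm (FT (vt t) \<xi> - ?f2 \<xi>) \<le> norm (complex_of_real (E t \<xi>))"
      using AE0 FTG expansion[OF t]
    proof eventually_elim
      case (elim \<xi>)
      have "norm \<xi> > 0" using elim by simp
      note d = free_mode_difference[OF this, where w="w \<xi>" and w'="w' \<xi>" and t=t and rp="r 1 \<xi>" and rm="r (-1) \<xi>"]
      have "norm (complex_of_real (E t \<xi>)) = E t \<xi>" using E0[of t \<xi>] by simp
      then show ?case using d elim by (simp only: E_def P_def \<phi>_def g_def)
    qed
    have 1: "Hdot1_norm (FT (v t) - ?f1) \<le> L2_norm (\<lambda>\<xi>. complex_of_real (E t \<xi>))"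
      unfolding Hdot1_norm_def fun_diff_def
    proof (rule L2_norm_mono[OF EL[OF t]])
      show "(\<lambda>\<xi>. of_real (norm \<xi>) * (FT (v t) \<xi> - ?f1 \<xi>)) \<in> borel_measurable lborel" by measurable
    qed (use AE in eventually_elim, simp only:)
    have "L2_norm (vt t - FT_inv ?f2) = L2_norm (\<lambda>\<xi>. FT (vt t) \<xi> - ?f2 \<xi>)"
      unfolding fun_diff_def
      by (rule is_fourier_isometry[OF is_fourier_diff[OF is_fourier_FT[OF vtL[OF t]] is_fourier_FT_inv[OF f2]], symmetric])
    also have "\<dots> \<le> L2_norm (\<lambda>\<xi>. complex_of_real (E t \<xi>))"
    proof (rule L2_norm_mono[OF EL[OF t]])
      show "(\<lambda>\<xi>. FT (vt t) \<xi> - ?f2 \<xi>) \<in> borel_measurable lborel" by measurable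
    qed (use AE in eventually_elim, simp only:)
    finally have 2: "L2_norm (vt t - FT_inv ?f2) \<le> L2_norm (\<lambda>\<xi>. complex_of_real (E t \<xi>))" .
    have "energy_norm ((FT (v t), vt t) - free_wave t (\<phi>, G)) \<le> Hdot1_norm (FT (v t) - ?f1) + L2_norm (vt t - FT_inv ?f2)"
      unfolding fw energy_norm_def fst_conv snd_conv
      by (rule sqrt_sum_squares_le_sum) (auto simp: Hdot1_norm_def)
    with 1 2 show ?thesis by linarith
  qed
  have lim: "((\<lambda>t. L2_norm (\<lambda>\<xi>. complex_of_real (E t \<xi>)) / decay \<mu> (1 + t)) \<longlongrightarrow> 0) at_top"
  proof (rule tendsto_at_topI_sequentially)
    fix X :: "nat \<Rightarrow> real" assume X: "filterlim X at_top sequentially"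
    \<comment> \<open>The estimates hold at nonnegative times, while a sequence that tends to
      infinity may begin with negative terms.\<close>
    define Y where "Y n = max 0 (X n)" for n
    have Y0: "Y n \<ge> 0" for n by (simp add: Y_def)
    have evY: "\<forall>\<^sub>F n in sequentially. Y n = X n"
      using X[unfolded filterlim_at_top, rule_format, of 0] by eventually_elim (simp add: Y_def)
    have Y: "filterlim Y at_top sequentially"
      by (rule filterlim_at_top_mono[OF X]) (simp add: Y_def)
    have "(\<lambda>n. L2_norm (\<lambda>\<xi>. complex_of_real (E (Y n) \<xi> / decay \<mu> (1 + Y n)))) \<longlonglongrightarrow> 0"
    proof (rule L2_dominated_convergence[OF _ L2_scale[OF DL, of "of_real (2 * C)"]])
      show "(\<lambda>\<xi>. complex_of_real (E (Y n) \<xi> / decay \<mu> (1 + Y n))) \<in> borel_measurable lborel" for n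
        unfolding E_def by measurable
      show "AE \<xi> in lborel. norm (complex_of_real (E (Y n) \<xi> / decay \<mu> (1 + Y n)))
          \<le> norm (complex_of_real (2 * C) * complex_of_real (D \<xi>))" for n
        using AE0
      proof eventually_elim
        case (elim \<xi>)
        have dp: "decay \<mu> (1 + Y n) > 0" using Y0[of n] by (intro decay_pos) auto
        have "norm (P 1 \<xi> (Y n) - r 1 \<xi>) \<le> C * decay \<mu> (1 + Y n) * D \<xi>"
          "norm (P (-1) \<xi> (Y n) - r (-1) \<xi>) \<le> C * decay \<mu> (1 + Y n) * D \<xi>"
          using scat[of 1 \<xi>] scat[of "-1" \<xi>] elim Y0[of n] by auto
        then have "E (Y n) \<xi> \<le> 2 * C * D \<xi> * decay \<mu> (1 + Y n)" by (simp add: E_def mult_ac)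
        then have "E (Y n) \<xi> / decay \<mu> (1 + Y n) \<le> 2 * C * D \<xi>" using dp by (simp add: divide_le_eq)
        moreover have "E (Y n) \<xi> / decay \<mu> (1 + Y n) \<ge> 0" using dp by (simp add: E_def)
        ultimately show ?case using C0 D0[of \<xi>] by (simp only: norm_mult norm_of_real abs_of_nonneg abs_numeral)
      qed
      show "AE \<xi> in lborel. (\<lambda>n. complex_of_real (E (Y n) \<xi> / decay \<mu> (1 + Y n))) \<longlonglongrightarrow> 0"
        using AE0
      proof eventually_elim
        case (elim \<xi>)
        have "((\<lambda>t. E t \<xi> / decay \<mu> (1 + t)) \<longlongrightarrow> 0 + 0) at_top"
          unfolding E_def add_divide_distrib using scat[of 1 \<xi>] scat[of "-1" \<xi>] elim
          by (intro tendsto_add) auto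
        then have "((\<lambda>t. complex_of_real (E t \<xi> / decay \<mu> (1 + t))) \<longlongrightarrow> of_real (0 + 0)) at_top"
          by (rule tendsto_of_real)
        from filterlim_compose[OF this Y] show ?case by simp
      qed
    qed
    moreover have "L2_norm (\<lambda>\<xi>. complex_of_real (E (Y n) \<xi> / decay \<mu> (1 + Y n)))
        = L2_norm (\<lambda>\<xi>. complex_of_real (E (Y n) \<xi>)) / decay \<mu> (1 + Y n)" for n
      using L2_norm_scale[of "of_real (1 / decay \<mu> (1 + Y n))" "\<lambda>\<xi>. complex_of_real (E (Y n) \<xi>)"]
        decay_pos[of "1 + Y n" \<mu>] Y0[of n] by (simp add: norm_divide)
    ultimately have "(\<lambda>n. L2_norm (\<lambda>\<xi>. complex_of_real (E (Y n) \<xi>)) / decay \<mu> (1 + Y n)) \<longlonglongrightarrow> 0"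
      by simp
    then show "(\<lambda>n. L2_norm (\<lambda>\<xi>. complex_of_real (E (X n) \<xi>)) / decay \<mu> (1 + X n)) \<longlonglongrightarrow> 0"
      by (rule Lim_transform_eventually) (use evY in eventually_elim, simp)
  qed
  have main: "((\<lambda>t. 1 / decay \<mu> (1 + t) * energy_norm ((FT (v t), vt t) - free_wave t (\<phi>, G))) \<longlongrightarrow> 0) at_top"
  proof (rule tendsto_sandwich[OF _ _ tendsto_const tendsto_mult_right_zero[OF lim, of 2]])
    have ge: "\<forall>\<^sub>F t in at_top. t \<ge> (0 :: real)" by (rule eventually_ge_at_top)
    show "\<forall>\<^sub>F t in at_top. 0 \<le> 1 / decay \<mu> (1 + t) * energy_norm ((FT (v t), vt t) - free_wave t (\<phi>, G))"
      using ge
    proof eventually_elim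
      case (elim t)
      then have "decay \<mu> (1 + t) > 0" by (intro decay_pos) auto
      then show ?case by (simp add: energy_norm_def)
    qed
    show "\<forall>\<^sub>F t in at_top. 1 / decay \<mu> (1 + t) * energy_norm ((FT (v t), vt t) - free_wave t (\<phi>, G))
        \<le> 2 * (L2_norm (\<lambda>\<xi>. complex_of_real (E t \<xi>)) / decay \<mu> (1 + t))"
      using ge
    proof eventually_elim
      case (elim t)
      then have dp: "decay \<mu> (1 + t) > 0" by (intro decay_pos) auto
      have "1 / decay \<mu> (1 + t) * energy_norm ((FT (v t), vt t) - free_wave t (\<phi>, G))
          \<le> 1 / decay \<mu> (1 + t) * (2 * L2_norm (\<lambda>\<xi>. complex_of_real (E t \<xi>)))"
        using dp by (intro mult_left_mono energy elim) auto
      then show ?case by simp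
    qed
  qed
  have ge: "\<forall>\<^sub>F t in at_top. t \<ge> (0 :: real)" by (rule eventually_ge_at_top)
  have "(\<phi>, G) \<in> Hdot1 \<times> L2"
    using \<phi>_meas \<phi>L GL by (simp add: Hdot1_def)
  moreover have "((\<lambda>t. (1 + t) powr (1/2 - Re (nu \<mu>)) *
             energy_norm ((FT (v t), vt t) - free_wave t (\<phi>, G))) \<longlongrightarrow> 0) at_top" if "\<mu> \<noteq> 1/4"
    by (rule Lim_transform_eventually[OF main]) (use ge in eventually_elim, simp only: decay_inverse(1)[OF _ that])
  moreover have "((\<lambda>t. (1 + t) powr (1/2) * inverse (1 + ln (1 + t)) *
             energy_norm ((FT (v t), vt t) - free_wave t (\<phi>, G))) \<longlongrightarrow> 0) at_top" if "\<mu> = 1/4"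
    by (rule Lim_transform_eventually[OF main]) (use ge in eventually_elim, simp only: decay_inverse(2)[OF _ that])
  ultimately show ?thesis by blast
qed

end
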